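(* For each $n\ge1$ let $\mathcal T^{(n)}$ be a (deterministic or random) tree with $n$ vertices and let $r_n>0$. Conditioned on $\mathcal T^{(n)}$, let each edge $e$ be deleted at a random time $T_e$, where the $T_e$ are i.i.d. with the exponential distribution $\mathrm{Exp}(r_n)$ of rate $r_n$. Let $X^{(n)}(\cdot)=(X^{(n)}_i(\cdot))_{i=1}^\infty$ be the fragmentation process of normalized component sizes (see context), and let $Q^{(n)}(t):=\sum_{i=1}^\infty (X^{(n)}_i(t))^2$. Let $d^{(n)}(v,w)$ denote the graph distance between vertices $v$ and $w$ in $\mathcal T^{(n)}$. Then, for every $t\ge0$, $$1-\mathbb E\,Q^{(n)}(t)\le t\,r_n\,\mathbb E\,d^{(n)}(V_1,V_2),$$ where $V_1$ and $V_2$ are two independent uniformly random vertices of $\mathcal T^{(n)}$ (conditionally on $\mathcal T^{(n)}$). Consequently, if $r_n\,\mathbb E\,d^{(n)}(V_1,V_2)=O(1)$ as $n\to\infty$, then the family of processes $X^{(n)}(\cdot)$, $n\ge1$, is tight in $D(\mathbb R_+,\mathbb S^{\downarrow}_{\le1})$.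
   Context: $\mathbb R_+:=[0,\infty)$. $\mathbb S^{\downarrow}_{\le1}:=\{(x_i)_{i=1}^\infty: x_1\ge x_2\ge\dots\ge0,\ \sum_{i}x_i\le1\}$, with the product topology (as a subspace of $\mathbb R^\infty$). $D(\mathbb R_+,\mathbb S^{\downarrow}_{\le1})$ is the space of càdlàg functions $\mathbb R_+\to\mathbb S^{\downarrow}_{\le1}$ with the Skorohod $J_1$ topology. Let $\mathcal T^{(n)}(t)$ be the forest obtained from $\mathcal T^{(n)}$ by removing all edges deleted up to time $t$ (i.e. with $T_e\le t$; $\mathcal T^{(n)}(0)=\mathcal T^{(n)}$), with components $\mathcal T^{(n)}_i(t)$, $i=1,\dots,\nu^{(n)}(t)$, arranged in order of decreasing size (number of vertices). Set $X^{(n)}_i(t):=|\mathcal T^{(n)}_i(t)|/n$ for $i\le\nu^{(n)}(t)$ and $X^{(n)}_i(t):=0$ for $i>\nu^{(n)}(t)$. In particular $X^{(n)}(0)=(1,0,0,\dots)$. *)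

theory Defs
  imports "HOL-Probability.Probability"
begin

section \<open>Finite simple graphs and trees\<close>

text \<open>A simple graph is a pair of a vertex set and a set of edges, an edge being a two-element set
  of vertices.\<close>

type_synonym 'v sgraph = "'v set \<times> 'v set set"

abbreviation verts :: "'v sgraph \<Rightarrow> 'v set" where "verts G \<equiv> fst G"
abbreviation edges :: "'v sgraph \<Rightarrow> 'v set set" where "edges G \<equiv> snd G"

definition adj :: "'v sgraph \<Rightarrow> ('v \<times> 'v) set" where
  "adj G = {(u, v). {u, v} \<in> edges G}"

definition is_sgraph :: "'v sgraph \<Rightarrow> bool" where
  "is_sgraph G \<longleftrightarrow> finite (verts G) \<and>
     (\<forall>e\<in>edges G. \<exists>u\<in>verts G. \<exists>v\<in>verts G. u \<noteq> v \<and> e = {u, v})"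

definition is_connected :: "'v sgraph \<Rightarrow> bool" where
  "is_connected G \<longleftrightarrow> verts G \<noteq> {} \<and> (\<forall>u\<in>verts G. \<forall>v\<in>verts G. (u, v) \<in> (adj G)\<^sup>*)"

definition is_cycle :: "'v sgraph \<Rightarrow> 'v list \<Rightarrow> bool" where
  "is_cycle G vs \<longleftrightarrow> 3 \<le> length vs \<and> distinct vs \<and>
     (\<forall>i<length vs. {vs ! i, vs ! (Suc i mod length vs)} \<in> edges G)"

definition is_tree :: "'v sgraph \<Rightarrow> bool" where
  "is_tree G \<longleftrightarrow> is_sgraph G \<and> is_connected G \<and> (\<nexists>vs. is_cycle G vs)"

text \<open>The least length of a walk from \<open>u\<close> to \<open>v\<close>; only meaningful if the two are connected.\<close>

definition graph_dist :: "'v sgraph \<Rightarrow> 'v \<Rightarrow> 'v \<Rightarrow> nat" where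
  "graph_dist G u v = (LEAST k. (u, v) \<in> adj G ^^ k)"

definition components :: "'v sgraph \<Rightarrow> 'v set set" where
  "components G = verts G // (adj G)\<^sup>*"


section \<open>The fragmentation process\<close>

definition component_sizes :: "'v sgraph \<Rightarrow> nat list" where
  "component_sizes G = rev (sorted_list_of_multiset (image_mset card (mset_set (components G))))"

text \<open>Sequences are indexed from \<open>0\<close>, so entry \<open>i\<close> is the relative size of the component
  of rank \<open>i + 1\<close>.\<close>

definition ranked_masses :: "'v sgraph \<Rightarrow> nat \<Rightarrow> real" where
  "ranked_masses G = (\<lambda>i. if i < length (component_sizes G)
     then real (component_sizes G ! i) / real (card (verts G)) else 0)"

text \<open>The forest left at time \<open>t\<close> when edge \<open>e\<close> is deleted at time \<open>\<tau> e\<close>.\<close>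

definition pruned :: "'v sgraph \<Rightarrow> ('v set \<Rightarrow> real) \<Rightarrow> real \<Rightarrow> 'v sgraph" where
  "pruned G \<tau> t = (verts G, {e \<in> edges G. \<not> \<tau> e \<le> t})"

definition fragmentation :: "'v sgraph \<Rightarrow> ('v set \<Rightarrow> real) \<Rightarrow> real \<Rightarrow> nat \<Rightarrow> real" where
  "fragmentation G \<tau> = (\<lambda>t\<in>{0..}. ranked_masses (pruned G \<tau> t))"

definition sum_squares :: "(nat \<Rightarrow> real) \<Rightarrow> real" where
  "sum_squares x = (\<Sum>i. (x i)\<^sup>2)"

text \<open>The space of decreasing nonnegative sequences of sum at most \<open>1\<close>. The library metric
  on \<^typ>\<open>nat \<Rightarrow> real\<close> induces the product topology.\<close>

definition mass_sequences :: "(nat \<Rightarrow> real) set" where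
  "mass_sequences =
     {x. (\<forall>i. 0 \<le> x i \<and> x (Suc i) \<le> x i) \<and> summable x \<and> (\<Sum>i. x i) \<le> 1}"


section \<open>The Skorohod space on the half line\<close>

text \<open>Functions on \<open>[0, \<infinity>)\<close> are represented as functions on the reals that are
  \<open>undefined\<close> at negative arguments.\<close>

definition cadlag_paths :: "'a::metric_space set \<Rightarrow> (real \<Rightarrow> 'a) set" where
  "cadlag_paths S = {x \<in> {0..} \<rightarrow>\<^sub>E S.
     (\<forall>t\<ge>0. continuous (at_right t) x) \<and> (\<forall>t>0. \<exists>l\<in>S. (x \<longlongrightarrow> l) (at_left t))}"

text \<open>Increasing bijections of \<open>[0, \<infinity>)\<close>; these are automatically continuous.\<close>

definition time_change :: "(real \<Rightarrow> real) \<Rightarrow> bool" where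
  "time_change \<mu> \<longleftrightarrow> strict_mono_on {0..} \<mu> \<and> \<mu> ` {0..} = {0..}"

definition J1_close :: "real \<Rightarrow> real \<Rightarrow> (real \<Rightarrow> 'a::metric_space) \<Rightarrow> (real \<Rightarrow> 'a) \<Rightarrow> bool" where
  "J1_close N \<epsilon> x y \<longleftrightarrow> (\<exists>\<mu>. time_change \<mu> \<and>
     (\<forall>s\<in>{0..N}. \<bar>\<mu> s - s\<bar> < \<epsilon> \<and> dist (y (\<mu> s)) (x s) < \<epsilon>))"

text \<open>The Skorohod \<open>J1\<close> topology on cadlag paths, given by its neighbourhoods. That the
  resulting convergence is the usual one is lemma \<open>limitin_J1_iff\<close> below; since the \<open>J1\<close> topology
  is metrizable, it is determined by its convergent sequences.\<close>

definition J1_topology :: "'a::metric_space set \<Rightarrow> (real \<Rightarrow> 'a) topology" where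
  "J1_topology S = topology (\<lambda>U. U \<subseteq> cadlag_paths S \<and>
     (\<forall>x\<in>U. \<exists>N \<epsilon>. 0 < \<epsilon> \<and> (\<forall>y\<in>cadlag_paths S. J1_close N \<epsilon> x y \<longrightarrow> y \<in> U)))"

lemma J1_close_mono: "J1_close N \<epsilon> x y \<Longrightarrow> N' \<le> N \<Longrightarrow> \<epsilon> \<le> \<epsilon>' \<Longrightarrow> J1_close N' \<epsilon>' x y"
  unfolding J1_close_def by (meson atLeastAtMost_iff order.strict_trans2 order.trans)

lemma J1_close_refl: "0 < \<epsilon> \<Longrightarrow> J1_close N \<epsilon> x x"
  unfolding J1_close_def time_change_def
  by (intro exI[of _ "\<lambda>s. s"]) (auto simp: strict_mono_on_def)

lemma J1_close_trans:
  assumes "J1_close N \<epsilon> x y" "J1_close (N + \<epsilon>) \<delta> y z"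
  shows "J1_close N (\<epsilon> + \<delta>) x z"
proof -
  obtain f where f: "time_change f"
    "\<forall>s\<in>{0..N}. \<bar>f s - s\<bar> < \<epsilon> \<and> dist (y (f s)) (x s) < \<epsilon>"
    using assms(1) by (auto simp: J1_close_def)
  obtain g where g: "time_change g"
    "\<forall>s\<in>{0..N + \<epsilon>}. \<bar>g s - s\<bar> < \<delta> \<and> dist (z (g s)) (y s) < \<delta>"
    using assms(2) by (auto simp: J1_close_def)
  have f0: "f s \<ge> 0" if "s \<ge> 0" for s
    using f(1) that by (auto simp: time_change_def)
  have "(g \<circ> f) ` {0..} = {0..}"
    using f(1) g(1) by (simp only: time_change_def image_comp[symmetric])
  moreover have "strict_mono_on {0..} (g \<circ> f)"
    using f(1) g(1) f0 by (auto simp: time_change_def strict_mono_on_def)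
  ultimately have "time_change (g \<circ> f)"
    by (simp add: time_change_def)
  moreover have "\<bar>(g \<circ> f) s - s\<bar> < \<epsilon> + \<delta> \<and> dist (z ((g \<circ> f) s)) (x s) < \<epsilon> + \<delta>"
    if s: "s \<in> {0..N}" for s
  proof -
    have a: "\<bar>f s - s\<bar> < \<epsilon>" "dist (y (f s)) (x s) < \<epsilon>"
      using f(2) s by auto
    then have "f s \<in> {0..N + \<epsilon>}"
      using s f0[of s] by auto
    then have b: "\<bar>g (f s) - f s\<bar> < \<delta>" "dist (z (g (f s))) (y (f s)) < \<delta>"
      using g(2) by auto
    show ?thesis
      using a b dist_triangle[of "z (g (f s))" "x s" "y (f s)"] by auto
  qed
  ultimately show ?thesis
    unfolding J1_close_def by blast
qed

lemma openin_J1_topology: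
  "openin (J1_topology S) U \<longleftrightarrow> U \<subseteq> cadlag_paths S \<and>
     (\<forall>x\<in>U. \<exists>N \<epsilon>. 0 < \<epsilon> \<and> (\<forall>y\<in>cadlag_paths S. J1_close N \<epsilon> x y \<longrightarrow> y \<in> U))"
proof -
  let ?P = "\<lambda>U x. \<exists>N \<epsilon>. 0 < \<epsilon> \<and> (\<forall>y\<in>cadlag_paths S. J1_close N \<epsilon> x y \<longrightarrow> y \<in> U)"
  have inter: "?P (U \<inter> V) x" if "?P U x" "?P V x" for U V x
  proof -
    obtain N \<epsilon> N' \<epsilon>' where
      "0 < \<epsilon>" "\<forall>y\<in>cadlag_paths S. J1_close N \<epsilon> x y \<longrightarrow> y \<in> U"
      "0 < \<epsilon>'" "\<forall>y\<in>cadlag_paths S. J1_close N' \<epsilon>' x y \<longrightarrow> y \<in> V"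
      using \<open>?P U x\<close> \<open>?P V x\<close> by blast
    then have "0 < min \<epsilon> \<epsilon>' \<and>
        (\<forall>y\<in>cadlag_paths S. J1_close (max N N') (min \<epsilon> \<epsilon>') x y \<longrightarrow> y \<in> U \<inter> V)"
      by (auto dest: J1_close_mono[OF _ max.cobounded1 min.cobounded1]
          J1_close_mono[OF _ max.cobounded2 min.cobounded2])
    then show ?thesis by blast
  qed
  have "istopology (\<lambda>U. U \<subseteq> cadlag_paths S \<and> (\<forall>x\<in>U. ?P U x))"
    unfolding istopology_def
  proof (intro conjI allI impI; (elim conjE)?)
    fix U V
    assume "\<forall>x\<in>U. ?P U x" "\<forall>x\<in>V. ?P V x"
    then show "\<forall>x\<in>U \<inter> V. ?P (U \<inter> V) x"
      using inter by simp
  next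
    fix \<K>
    assume "\<forall>K\<in>\<K>. K \<subseteq> cadlag_paths S \<and> (\<forall>x\<in>K. ?P K x)"
    then show "\<forall>x\<in>\<Union>\<K>. ?P (\<Union>\<K>) x"
      by (meson UnionE UnionI)
  qed auto
  then show ?thesis
    by (simp add: J1_topology_def topology_inverse')
qed

lemma topspace_J1_topology: "topspace (J1_topology S) = cadlag_paths S"
proof -
  have "openin (J1_topology S) (cadlag_paths S)"
    by (auto simp: openin_J1_topology intro: exI[of _ "1 :: real"])
  then show ?thesis
    by (meson openin_J1_topology openin_subset openin_topspace subset_antisym)
qed

lemma limitin_J1_iff:
  assumes "x \<in> cadlag_paths S" "\<And>n. y n \<in> cadlag_paths S"
  shows "limitin (J1_topology S) y x sequentially \<longleftrightarrow>
    (\<forall>N. \<forall>\<epsilon>>0. \<forall>\<^sub>F n in sequentially. \<exists>\<mu>. time_change \<mu> \<and>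
       (\<forall>s\<in>{0..N}. \<bar>\<mu> s - s\<bar> < \<epsilon> \<and> dist (y n (\<mu> s)) (x s) < \<epsilon>))"
    (is "?L \<longleftrightarrow> ?R")
proof -
  have "?R \<longleftrightarrow> (\<forall>N. \<forall>\<epsilon>>0. \<forall>\<^sub>F n in sequentially. J1_close N \<epsilon> x (y n))"
    by (simp add: J1_close_def)
  also have "\<dots> \<longleftrightarrow> ?L"
  proof
    assume close: "\<forall>N. \<forall>\<epsilon>>0. \<forall>\<^sub>F n in sequentially. J1_close N \<epsilon> x (y n)"
    have "\<forall>\<^sub>F n in sequentially. y n \<in> U" if "openin (J1_topology S) U" "x \<in> U" for U
    proof -
      obtain N \<epsilon> where "0 < \<epsilon>" and U: "\<forall>z\<in>cadlag_paths S. J1_close N \<epsilon> x z \<longrightarrow> z \<in> U"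
        using \<open>openin (J1_topology S) U\<close> \<open>x \<in> U\<close> by (auto simp: openin_J1_topology)
      then have "\<forall>\<^sub>F n in sequentially. J1_close N \<epsilon> x (y n)"
        using close by simp
      then show ?thesis
        by eventually_elim (use U assms(2) in blast)
    qed
    then show ?L
      using assms(1) by (simp add: limitin_def topspace_J1_topology)
  next
    assume lim: ?L
    show "\<forall>N. \<forall>\<epsilon>>0. \<forall>\<^sub>F n in sequentially. J1_close N \<epsilon> x (y n)"
    proof (intro allI impI)
      fix N \<epsilon> :: real
      assume "0 < \<epsilon>"
      define U where "U = {z \<in> cadlag_paths S. \<exists>M \<delta>. 0 < \<delta> \<and>
        (\<forall>w\<in>cadlag_paths S. J1_close M \<delta> z w \<longrightarrow> J1_close N \<epsilon> x w)}"
      have "openin (J1_topology S) U"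
        unfolding openin_J1_topology
      proof (intro conjI ballI)
        fix z
        assume "z \<in> U"
        then obtain M \<delta> where "0 < \<delta>"
          and M: "\<forall>w\<in>cadlag_paths S. J1_close M \<delta> z w \<longrightarrow> J1_close N \<epsilon> x w"
          by (auto simp: U_def)
        have "w \<in> U" if w: "w \<in> cadlag_paths S" "J1_close M (\<delta> / 2) z w" for w
        proof -
          have "J1_close N \<epsilon> x u" if "u \<in> cadlag_paths S" "J1_close (M + \<delta> / 2) (\<delta> / 2) w u" for u
            using J1_close_trans[OF w(2) that(2)] M that(1) by simp
          moreover have "0 < \<delta> / 2"
            using \<open>0 < \<delta>\<close> by simp
          ultimately show ?thesis
            using w(1) unfolding U_def by blast
        qed
        then show "\<exists>N \<epsilon>. 0 < \<epsilon> \<and> (\<forall>w\<in>cadlag_paths S. J1_close N \<epsilon> z w \<longrightarrow> w \<in> U)"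
          using \<open>0 < \<delta>\<close> by (intro exI[of _ M] exI[of _ "\<delta> / 2"]) simp
      qed (auto simp: U_def)
      moreover have "x \<in> U"
        using assms(1) \<open>0 < \<epsilon>\<close> by (auto simp: U_def)
      ultimately have "\<forall>\<^sub>F n in sequentially. y n \<in> U"
        using lim by (simp add: limitin_def)
      then show "\<forall>\<^sub>F n in sequentially. J1_close N \<epsilon> x (y n)"
        by eventually_elim (auto simp: U_def intro: J1_close_refl)
    qed
  qed
  finally show ?thesis by simp
qed


section \<open>Random elements, conditioning and tightness\<close>

definition borel_of :: "'a topology \<Rightarrow> 'a measure" where
  "borel_of X = sigma (topspace X) {U. openin X U}"

text \<open>A tight family of random elements of a topological space, the \<open>i\<close>-th one being defined on the
  probability space \<open>M i\<close>. Being a random element (Borel measurability) is part of the claim.\<close>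

definition tight_family ::
  "'b topology \<Rightarrow> 'i set \<Rightarrow> ('i \<Rightarrow> 'w measure) \<Rightarrow> ('i \<Rightarrow> 'w \<Rightarrow> 'b) \<Rightarrow> bool" where
  "tight_family X I M Y \<longleftrightarrow> (\<forall>i\<in>I. Y i \<in> M i \<rightarrow>\<^sub>M borel_of X) \<and>
     (\<forall>\<epsilon>>0. \<exists>K. compactin X K \<and>
        (\<forall>i\<in>I. measure (distr (M i) (borel_of X) (Y i)) K \<ge> 1 - \<epsilon>))"

text \<open>The conditional probability measure given \<open>Z = z\<close>, for an event of positive probability.\<close>

definition given :: "'w measure \<Rightarrow> ('w \<Rightarrow> 'z) \<Rightarrow> 'z \<Rightarrow> 'w measure" where
  "given M Z z = uniform_measure M {\<omega> \<in> space M. Z \<omega> = z}"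

definition iid_exponential ::
  "'w measure \<Rightarrow> real \<Rightarrow> 'e set \<Rightarrow> ('e \<Rightarrow> 'w \<Rightarrow> real) \<Rightarrow> bool" where
  "iid_exponential P r I \<tau> \<longleftrightarrow> prob_space.indep_vars P (\<lambda>_. borel) \<tau> I \<and>
     (\<forall>e\<in>I. distributed P lborel (\<tau> e) (exponential_density r))"

definition indep_uniform_pair ::
  "'w measure \<Rightarrow> 'v set \<Rightarrow> ('w \<Rightarrow> 'v) \<Rightarrow> ('w \<Rightarrow> 'v) \<Rightarrow> bool" where
  "indep_uniform_pair P A V1 V2 \<longleftrightarrow>
     prob_space.indep_var P (count_space UNIV) V1 (count_space UNIV) V2 \<and>
     distr P (count_space UNIV) V1 = measure_pmf (pmf_of_set A) \<and>
     distr P (count_space UNIV) V2 = measure_pmf (pmf_of_set A)"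

text \<open>A random tree with \<open>n\<close> vertices whose labels lie in a countable type. Hence there are
  countably many possible trees, and conditioning on the tree is conditioning on events of positive
  probability.\<close>

definition random_tree :: "'w measure \<Rightarrow> nat \<Rightarrow> ('w \<Rightarrow> 'v::countable sgraph) \<Rightarrow> bool" where
  "random_tree M n T \<longleftrightarrow> T \<in> M \<rightarrow>\<^sub>M count_space {G. is_tree G \<and> card (verts G) = n}"

end

theory Submission
  imports Defs "HOL-Library.Diagonal_Subsequence"
begin

text \<open>
  The number \<open>n\<^sup>2 (1 - Q)\<close> counts the pairs of vertices that are no longer connected. In a tree, a
  pair that is connected by the edges in \<open>A\<close> but not by those in \<open>B \<subseteq> A\<close> is separated by an edge of
  \<open>A - B\<close>, and at most \<open>d(v, w)\<close> edges of the tree separate \<open>v\<close> and \<open>w\<close>. This gives the bound on \<open>Q\<close>.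

  For tightness, a loss of \<open>\<eta>\<close> in \<open>Q\<close> moves every ranked mass by at most \<open>sqrt \<eta>\<close>, so it suffices to
  control the modulus of the decreasing function \<open>Q\<close>. Let \<open>\<sigma>\<close> be the time when \<open>Q\<close> first reaches
  \<open>1 - k \<eta>\<close>. On the event \<open>\<sigma> < T\<^sub>e\<close>, \<open>\<sigma>\<close> is also the passage time when \<open>e\<close> is never deleted, which
  is independent of \<open>T\<^sub>e\<close>; so \<open>e\<close> is deleted in \<open>(\<sigma>, \<sigma> + \<delta>]\<close> with probability at most \<open>r \<delta>\<close>. By
  Markov's inequality \<open>Q\<close> is unlikely to lose \<open>\<eta>\<close> in \<open>\<delta>\<close> units of time after one of its boundedly
  many passages. Otherwise the half line has a grid of mesh at least \<open>\<delta>\<close> on whose cells the path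
  oscillates little, and such paths form a relatively compact set: two paths whose grids and grid
  values nearly agree are matched by a bi-Lipschitz time change, and along a fast Cauchy sequence
  these time changes can be composed.
\<close>

section \<open>Component sizes and edges separating two vertices\<close>

text \<open>Three obstacles shape the proof. The topology is given by neighbourhoods rather than by
  a metric, so compactness is obtained from convergent subsequences. A limit of time changes need
  not be strictly increasing, so the time changes that are composed carry two-sided slope bounds.
  And the path need not depend continuously on the deletion times, so its measurability takes an
  argument of its own.

  The passages play the role of the stopping times in Aldous' criterion. Edges can be treated one at
  a time because the loss of \<open>Q\<close> is dominated by a quantity that is additive over the
  deleted edges; then only the probability of each single deletion matters, and no joint behaviour
  of the edges after a passage is needed.

  The tree is random and only the average of its mean distance is bounded. Trees for which
  \<open>r * mean_dist\<close> is at least some \<open>A\<close> are therefore discarded first, and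
  the mesh chosen for the remaining ones depends on \<open>A\<close> but not on the number of
  vertices.\<close>

definition conn_pairs :: "'v sgraph \<Rightarrow> ('v \<times> 'v) set" where
  "conn_pairs G = {(v, w) \<in> verts G \<times> verts G. (v, w) \<in> (adj G)\<^sup>*}"

lemma adj_mono: "B \<subseteq> A \<Longrightarrow> adj (V, B) \<subseteq> adj (V, A)"
  by (auto simp: adj_def)

lemma sym_adj: "sym (adj G)"
  by (auto simp: sym_def adj_def insert_commute)

lemma sym_adj_rtrancl: "sym ((adj G)\<^sup>*)"
  by (simp add: sym_adj sym_rtrancl)

lemma is_sgraph_subset: "is_sgraph (V, A) \<Longrightarrow> B \<subseteq> A \<Longrightarrow> is_sgraph (V, B)"
  by (auto simp: is_sgraph_def)

lemma is_sgraph_edges_subset: "is_sgraph G \<Longrightarrow> edges G \<subseteq> Pow (verts G)"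
  by (fastforce simp: is_sgraph_def)

lemma is_sgraph_finite_edges: "is_sgraph G \<Longrightarrow> finite (edges G)"
  using is_sgraph_edges_subset by (metis finite_Pow_iff finite_subset is_sgraph_def)

lemma adj_subset_verts: "is_sgraph G \<Longrightarrow> adj G \<subseteq> verts G \<times> verts G"
  using is_sgraph_edges_subset by (fastforce simp: adj_def)

lemma reach_in_verts:
  assumes "is_sgraph G" "v \<in> verts G" "(v, w) \<in> (adj G)\<^sup>*"
  shows "w \<in> verts G"
  using assms(3,2) by induction (use adj_subset_verts[OF assms(1)] in auto)

lemma finite_components: "is_sgraph G \<Longrightarrow> finite (components G)"
  unfolding components_def quotient_def is_sgraph_def by auto

lemma componentE:
  assumes "C \<in> components G"
  obtains v where "v \<in> verts G" "C = (adj G)\<^sup>* `` {v}"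
  using assms by (auto simp: components_def elim: quotientE)

lemma component_subset: "is_sgraph G \<Longrightarrow> C \<in> components G \<Longrightarrow> C \<subseteq> verts G"
  by (metis Image_singleton_iff componentE reach_in_verts subsetI)

lemma finite_component: "is_sgraph G \<Longrightarrow> C \<in> components G \<Longrightarrow> finite C"
  by (rule finite_subset[OF component_subset]) (auto simp: is_sgraph_def)

lemma component_nonempty: "C \<in> components G \<Longrightarrow> C \<noteq> {}"
  by (erule componentE) auto

lemma component_connected:
  assumes "C \<in> components G" "v \<in> C" "w \<in> C"
  shows "(v, w) \<in> (adj G)\<^sup>*"
proof -
  obtain u where "C = (adj G)\<^sup>* `` {u}"
    using assms(1) by (auto simp: components_def elim: quotientE)
  then show ?thesis
    using assms(2,3) sym_adj_rtrancl[of G] by (meson Image_singleton_iff rtrancl_trans symD)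
qed

lemma component_closed:
  assumes "C \<in> components G" "v \<in> C" "(v, w) \<in> (adj G)\<^sup>*"
  shows "w \<in> C"
  using assms by (auto simp: components_def elim!: quotientE)

lemma component_of: "v \<in> verts G \<Longrightarrow> (adj G)\<^sup>* `` {v} \<in> components G"
  by (simp add: components_def quotientI)

lemma component_eq:
  assumes "C \<in> components G" "v \<in> C"
  shows "C = (adj G)\<^sup>* `` {v}"
  using component_connected[OF assms] component_closed[OF assms] by blast

lemma components_disjoint:
  assumes "C \<in> components G" "D \<in> components G" "v \<in> C" "v \<in> D"
  shows "C = D"
  using assms component_eq by metis

lemma sum_card_components:
  assumes "is_sgraph G"
  shows "(\<Sum>C\<in>components G. card C) = card (verts G)"
proof -
  have "card (\<Union>C\<in>components G. C) = (\<Sum>C\<in>components G. card C)"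
  proof (intro card_UN_disjoint ballI impI)
    fix C D assume CD: "C \<in> components G" "D \<in> components G" "C \<noteq> D"
    then show "C \<inter> D = {}"
      using components_disjoint[OF CD(1,2)] by blast
  qed (use finite_components[OF assms] finite_component[OF assms] in auto)
  moreover have "(\<Union>C\<in>components G. C) = verts G"
  proof (intro equalityI subsetI)
    fix v assume "v \<in> (\<Union>C\<in>components G. C)"
    then show "v \<in> verts G" using component_subset[OF assms] by blast
  next
    fix v assume "v \<in> verts G"
    then show "v \<in> (\<Union>C\<in>components G. C)" using component_of[of v G] by blast
  qed
  ultimately show ?thesis by simp
qed

text \<open>Pairs are ordered and include the diagonal, so a component contributes exactly the block
  \<open>C \<times> C\<close>, and these blocks are disjoint.\<close>

lemma sum_card_components_square:
  assumes "is_sgraph G"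
  shows "(\<Sum>C\<in>components G. (card C)\<^sup>2) = card (conn_pairs G)"
proof -
  have "card (\<Union>C\<in>components G. C \<times> C) = (\<Sum>C\<in>components G. card (C \<times> C))"
  proof (intro card_UN_disjoint ballI impI)
    fix C D assume CD: "C \<in> components G" "D \<in> components G" "C \<noteq> D"
    then show "(C \<times> C) \<inter> (D \<times> D) = {}"
      using components_disjoint[OF CD(1,2)] by blast
  next
    fix C assume "C \<in> components G"
    then show "finite (C \<times> C)" using finite_component[OF assms] by blast
  qed (use finite_components[OF assms] in blast)
  moreover have "(\<Union>C\<in>components G. C \<times> C) = conn_pairs G"
  proof (intro equalityI subsetI)
    fix p assume "p \<in> (\<Union>C\<in>components G. C \<times> C)"
    then obtain C v w where "C \<in> components G" "v \<in> C" "w \<in> C" "p = (v, w)" by blast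
    then show "p \<in> conn_pairs G"
      using component_subset[OF assms, of C] component_connected[of C G v w] by (auto simp: conn_pairs_def)
  next
    fix p assume "p \<in> conn_pairs G"
    then obtain v w where "v \<in> verts G" "(v, w) \<in> (adj G)\<^sup>*" "p = (v, w)"
      by (auto simp: conn_pairs_def)
    then show "p \<in> (\<Union>C\<in>components G. C \<times> C)"
      using component_of[of v G] by blast
  qed
  ultimately show ?thesis by (simp add: power2_eq_square card_cartesian_product)
qed

section \<open>Ranked masses as order statistics of the component sizes\<close>

lemma nth_filter_sorted_desc:
  assumes "sorted_wrt (\<ge>) ys" "\<And>x y. P x \<Longrightarrow> x \<le> y \<Longrightarrow> P y"
  shows "i < length ys \<and> P (ys ! i) \<longleftrightarrow> i < length (filter P ys)"
  using assms(1)
proof (induction ys arbitrary: i)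
  case (Cons a ys)
  show ?case
  proof (cases "P a")
    case True
    then show ?thesis using Cons by (cases i) auto
  next
    case False
    then have neg: "\<not> P y" if "y \<in> set (a # ys)" for y
      using Cons.prems assms(2) that by auto
    then have "filter P (a # ys) = []"
      by (simp add: filter_empty_conv)
    moreover have "\<not> P ((a # ys) ! i)" if "i < length (a # ys)"
      using neg nth_mem[OF that] by blast
    ultimately show ?thesis by (metis list.size(3) not_less_zero)
  qed
qed simp

lemma component_sizes_desc: "sorted_wrt (\<ge>) (component_sizes G)"
  by (simp add: component_sizes_def sorted_wrt_rev)

lemma mset_component_sizes:
  "mset (component_sizes G) = image_mset card (mset_set (components G))"
  by (simp add: component_sizes_def)

lemma sum_component_sizes:
  fixes f :: "nat \<Rightarrow> 'b::comm_monoid_add"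
  shows "(\<Sum>i<length (component_sizes G). f (component_sizes G ! i)) = (\<Sum>C\<in>components G. f (card C))"
proof -
  have "(\<Sum>i<length (component_sizes G). f (component_sizes G ! i))
      = sum_list (map f (component_sizes G))"
    by (simp add: sum_list_sum_nth atLeast0LessThan)
  also have "\<dots> = sum_mset (image_mset f (mset (component_sizes G)))"
    by (simp flip: sum_mset_sum_list)
  also have "\<dots> = (\<Sum>C\<in>components G. f (card C))"
    by (simp add: mset_component_sizes sum_unfold_sum_mset image_mset.compositionality comp_def)
  finally show ?thesis .
qed

text \<open>Ranks are compared by counting components above a threshold, so that later estimates
  need injections between sets of components and never the sorted list. As \<open>x\<close> is
  nonnegative, the zeros that pad the sequence never count.\<close>

lemma less_ranked_masses_iff:
  assumes "is_sgraph G" "0 \<le> x"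
  shows "x < ranked_masses G i \<longleftrightarrow> i < card {C \<in> components G. x < card C / card (verts G)}"
proof -
  let ?P = "\<lambda>k. x < real k / real (card (verts G))"
  let ?l = "component_sizes G"
  have "x < ranked_masses G i \<longleftrightarrow> i < length ?l \<and> ?P (?l ! i)"
    using assms(2) by (auto simp: ranked_masses_def)
  \<comment> \<open>A property that passes to larger numbers holds on an initial segment of a
    decreasing list, so only the length of the filtered list matters.\<close>
  also have "\<dots> \<longleftrightarrow> i < length (filter ?P ?l)"
    by (rule nth_filter_sorted_desc[OF component_sizes_desc])
      (meson divide_right_mono of_nat_0_le_iff of_nat_mono order.strict_trans2)
  also have "length (filter ?P ?l) = size (filter_mset ?P (mset ?l))"
    by (metis mset_filter size_mset)
  also have "\<dots> = card {C \<in> components G. ?P (card C)}"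
    by (simp add: mset_component_sizes filter_mset_image_mset filter_mset_mset_set
        finite_components[OF assms(1)])
  finally show ?thesis .
qed

lemma ranked_masses_nonneg: "0 \<le> ranked_masses G i"
  by (simp add: ranked_masses_def)

lemma ranked_masses_sums:
  fixes f :: "real \<Rightarrow> real"
  assumes "f 0 = 0"
  shows "(\<lambda>i. f (ranked_masses G i)) sums (\<Sum>C\<in>components G. f (card C / card (verts G)))"
proof -
  have "(\<lambda>i. f (ranked_masses G i)) sums (\<Sum>i<length (component_sizes G). f (ranked_masses G i))"
    by (rule sums_finite) (auto simp: ranked_masses_def assms)
  also have "(\<Sum>i<length (component_sizes G). f (ranked_masses G i))
      = (\<Sum>i<length (component_sizes G). f (component_sizes G ! i / card (verts G)))"
    by (intro sum.cong) (auto simp: ranked_masses_def)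
  finally show ?thesis
    by (simp add: sum_component_sizes[of "\<lambda>k. f (real k / real (card (verts G)))"])
qed

lemma sum_squares_ranked_masses:
  assumes "is_sgraph G"
  shows "sum_squares (ranked_masses G) = card (conn_pairs G) / (card (verts G))\<^sup>2"
proof -
  have "sum_squares (ranked_masses G) = (\<Sum>C\<in>components G. (card C / card (verts G))\<^sup>2)"
    unfolding sum_squares_def
    using ranked_masses_sums[of "\<lambda>x. x\<^sup>2" G] by (simp add: sums_iff)
  also have "\<dots> = real (\<Sum>C\<in>components G. (card C)\<^sup>2) / (card (verts G))\<^sup>2"
    by (simp add: power_divide sum_divide_distrib)
  finally show ?thesis
    using sum_card_components_square[OF assms] by simp
qed

lemma ranked_masses_in_mass_sequences:
  assumes "is_sgraph G"
  shows "ranked_masses G \<in> mass_sequences"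
proof -
  have s: "ranked_masses G sums (\<Sum>C\<in>components G. card C / card (verts G))"
    using ranked_masses_sums[of "\<lambda>x. x" G] by simp
  have "(\<Sum>C\<in>components G. card C / card (verts G)) = real (\<Sum>C\<in>components G. card C) / card (verts G)"
    by (simp add: sum_divide_distrib)
  also have "\<dots> \<le> 1"
    by (simp add: sum_card_components[OF assms])
  moreover have "ranked_masses G (Suc i) \<le> ranked_masses G i" for i
  proof (cases "Suc i < length (component_sizes G)")
    case True
    then show ?thesis
      using sorted_wrt_nth_less[OF component_sizes_desc, of i "Suc i" G]
      by (simp add: ranked_masses_def divide_right_mono)
  qed (simp add: ranked_masses_def)
  moreover have "summable (ranked_masses G)" "(\<Sum>i. ranked_masses G i) = (\<Sum>C\<in>components G. card C / card (verts G))"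
    using s by (simp_all add: sums_iff)
  ultimately show ?thesis
    by (simp add: mass_sequences_def ranked_masses_nonneg)
qed

section \<open>Stability of the ranked masses under the loss of pairs\<close>

definition lost_pairs :: "'v set \<Rightarrow> 'v set set \<Rightarrow> 'v set set \<Rightarrow> ('v \<times> 'v) set" where
  "lost_pairs V A B = conn_pairs (V, A) - conn_pairs (V, B)"

lemma conn_pairs_mono: "B \<subseteq> A \<Longrightarrow> conn_pairs (V, B) \<subseteq> conn_pairs (V, A)"
  using rtrancl_mono[OF adj_mono, of B A V] by (auto simp: conn_pairs_def)

lemma finite_conn_pairs: "finite V \<Longrightarrow> finite (conn_pairs (V, A))"
  by (rule finite_subset[of _ "V \<times> V"]) (auto simp: conn_pairs_def)

lemma finite_lost_pairs: "finite V \<Longrightarrow> finite (lost_pairs V A B)"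
  by (simp add: lost_pairs_def finite_conn_pairs)

lemma sum_squares_diff:
  assumes "is_sgraph (V, A)" "B \<subseteq> A"
  shows "sum_squares (ranked_masses (V, A)) - sum_squares (ranked_masses (V, B))
    = card (lost_pairs V A B) / (card V)\<^sup>2"
proof -
  have "card (lost_pairs V A B) = card (conn_pairs (V, A)) - card (conn_pairs (V, B))"
    unfolding lost_pairs_def using assms
    by (intro card_Diff_subset conn_pairs_mono finite_conn_pairs) (auto simp: is_sgraph_def)
  moreover have "card (conn_pairs (V, B)) \<le> card (conn_pairs (V, A))"
    using assms by (intro card_mono conn_pairs_mono finite_conn_pairs) (auto simp: is_sgraph_def)
  ultimately show ?thesis
    using sum_squares_ranked_masses[OF assms(1)] sum_squares_ranked_masses[OF is_sgraph_subset[OF assms]]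
    by (simp add: of_nat_diff diff_divide_distrib)
qed

text \<open>Otherwise every vertex of \<open>C\<close> loses more than \<open>m\<close> of its partners, and \<open>C\<close> has more
  than \<open>m\<close> vertices.\<close>

lemma large_child:
  fixes m :: real
  assumes G: "is_sgraph (V, A)" and BA: "B \<subseteq> A" and C: "C \<in> components (V, A)"
    and m: "0 \<le> m" "card (lost_pairs V A B) \<le> m\<^sup>2" "m < card C"
  shows "\<exists>D\<in>components (V, B). D \<subseteq> C \<and> card C - m \<le> card D"
proof (rule ccontr)
  assume neg: "\<not> ?thesis"
  have GB: "is_sgraph (V, B)"
    using is_sgraph_subset G BA by blast
  have finC: "finite C" "C \<subseteq> V" "C \<noteq> {}"
    using component_subset[OF G C] finite_component[OF G C] component_nonempty[OF C] by auto
  let ?ch = "\<lambda>v. (adj (V, B))\<^sup>* `` {v}"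
  have ch_sub: "?ch v \<subseteq> C" if "v \<in> C" for v
    using component_closed[OF C that] rtrancl_mono[OF adj_mono[OF BA]] by blast
  have small: "card (?ch v) < card C - m" if "v \<in> C" for v
  proof -
    have "?ch v \<in> components (V, B)"
      using component_of[of v "(V, B)"] that finC by auto
    then show ?thesis using neg ch_sub[OF that] by force
  qed
  have "(SIGMA v:C. C - ?ch v) \<subseteq> lost_pairs V A B"
    using finC component_connected[OF C] by (auto simp: lost_pairs_def conn_pairs_def)
  then have "card (SIGMA v:C. C - ?ch v) \<le> card (lost_pairs V A B)"
    using G by (intro card_mono finite_lost_pairs) (auto simp: is_sgraph_def)
  then have "real (card (SIGMA v:C. C - ?ch v)) \<le> m\<^sup>2"
    using m(2) by linarith
  moreover have "real (card (SIGMA v:C. C - ?ch v)) = (\<Sum>v\<in>C. real (card (C - ?ch v)))"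
    using finC by (subst card_SigmaI) auto
  moreover have "(\<Sum>v\<in>C. m) < (\<Sum>v\<in>C. real (card (C - ?ch v)))"
  proof (rule sum_strict_mono)
    fix v assume v: "v \<in> C"
    have "card (C - ?ch v) = card C - card (?ch v)"
      using ch_sub[OF v] finC by (meson card_Diff_subset finite_subset)
    moreover have "card (?ch v) \<le> card C"
      using ch_sub[OF v] finC by (simp add: card_mono)
    ultimately show "m < real (card (C - ?ch v))"
      using small[OF v] by (simp add: of_nat_diff)
  qed (use finC in auto)
  moreover have "m\<^sup>2 \<le> (\<Sum>v\<in>C. m)"
    using m by (simp add: power2_eq_square mult_right_mono)
  ultimately show False by linarith
qed

text \<open>The heavy components of \<open>A\<close> inject into those of \<open>B\<close>: each
  keeps a child of nearly its size by \<open>large_child\<close>, and children of different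
  components are disjoint. Counting above the thresholds \<open>x + e\<close> and \<open>x\<close>
  then contradicts a larger gap at rank \<open>i\<close>.\<close>

lemma ranked_masses_le:
  assumes G: "is_sgraph (V, A)" and BA: "B \<subseteq> A" and V: "V \<noteq> {}" and e: "0 \<le> e"
    "card (lost_pairs V A B) / (card V)\<^sup>2 \<le> e\<^sup>2"
  shows "ranked_masses (V, A) i \<le> ranked_masses (V, B) i + e"
proof (rule ccontr)
  assume neg: "\<not> ?thesis"
  define x where "x = ranked_masses (V, B) i"
  have GB: "is_sgraph (V, B)" using is_sgraph_subset G BA by blast
  have n: "card V > 0" using G V by (simp add: is_sgraph_def card_gt_0_iff)
  have x: "0 \<le> x" by (simp add: x_def ranked_masses_nonneg)
  let ?CA = "{C \<in> components (V, A). x + e < card C / card V}"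
  let ?CB = "{C \<in> components (V, B). x < card C / card V}"
  have "i < card ?CA"
    using less_ranked_masses_iff[OF G, of "x + e" i] x e neg by (simp add: x_def)
  moreover have "\<not> i < card ?CB"
    using less_ranked_masses_iff[OF GB, of x i] x by (simp add: x_def)
  moreover have "card ?CA \<le> card ?CB"
  proof -
    have "\<exists>D. D \<in> ?CB \<and> D \<subseteq> C" if "C \<in> ?CA" for C
    proof -
      \<comment> \<open>Here \<open>large_child\<close> is used with \<open>m = e * card V\<close>,
        whose square bounds the number of lost pairs by hypothesis.\<close>
      have "\<exists>D\<in>components (V, B). D \<subseteq> C \<and> card C - e * card V \<le> card D"
        using that mult_nonneg_nonneg[OF x of_nat_0_le_iff[of "card V"]] e n
        by (intro large_child[OF G BA]) (auto simp: field_simps power2_eq_square)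
      then show ?thesis
        using that x e n by (auto simp: field_simps)
    qed
    then have "\<exists>f. \<forall>C\<in>?CA. f C \<in> ?CB \<and> f C \<subseteq> C"
      by (intro bchoice ballI)
    then obtain f where f0: "\<forall>C\<in>?CA. f C \<in> ?CB \<and> f C \<subseteq> C" by (rule exE)
    note f = f0[THEN bspec, THEN conjunct1] f0[THEN bspec, THEN conjunct2]
    have "inj_on f ?CA"
    proof
      fix C D assume CD: "C \<in> ?CA" "D \<in> ?CA" "f C = f D"
      obtain v where "v \<in> f C"
        using f(1)[OF CD(1)] component_nonempty[of "f C"] by auto
      then have "v \<in> C" "v \<in> D" using f(2)[OF CD(1)] f(2)[OF CD(2)] CD(3) by auto
      then show "C = D" using CD(1,2) components_disjoint[of C "(V, A)" D v] by auto
    qed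
    then show ?thesis
      using f finite_components[OF GB] by (intro card_inj_on_le[of f]) auto
  qed
  ultimately show False by simp
qed

text \<open>Now parents replace children, and they have to be distinct. Two components of
  \<open>B\<close> of mass above \<open>e\<close> inside one component of \<open>A\<close> would
  lose all pairs between them, which is more than the square of \<open>e * card V\<close>.\<close>

lemma ranked_masses_ge:
  assumes G: "is_sgraph (V, A)" and BA: "B \<subseteq> A" and V: "V \<noteq> {}" and e: "0 \<le> e"
    "card (lost_pairs V A B) / (card V)\<^sup>2 \<le> e\<^sup>2"
  shows "ranked_masses (V, B) i \<le> ranked_masses (V, A) i + e"
proof (rule ccontr)
  assume neg: "\<not> ?thesis"
  define x where "x = ranked_masses (V, A) i"
  have GB: "is_sgraph (V, B)" using is_sgraph_subset G BA by blast
  have n: "card V > 0" using G V by (simp add: is_sgraph_def card_gt_0_iff)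
  have x: "0 \<le> x" by (simp add: x_def ranked_masses_nonneg)
  let ?CA = "{C \<in> components (V, A). x < card C / card V}"
  let ?CB = "{C \<in> components (V, B). x + e < card C / card V}"
  have "\<not> i < card ?CA"
    using less_ranked_masses_iff[OF G, of "x" i] x by (simp add: x_def)
  moreover have "i < card ?CB"
    using less_ranked_masses_iff[OF GB, of "x + e" i] x e neg by (simp add: x_def)
  moreover have "card ?CB \<le> card ?CA"
  proof -
    have "\<exists>C. C \<in> ?CA \<and> D \<subseteq> C" if D: "D \<in> ?CB" for D
    proof -
      obtain v where v: "v \<in> V" "D = (adj (V, B))\<^sup>* `` {v}"
        using D by (auto elim: componentE)
      let ?C = "(adj (V, A))\<^sup>* `` {v}"
      have C: "?C \<in> components (V, A)" using component_of[of v "(V, A)"] v by simp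
      have sub: "D \<subseteq> ?C" using v rtrancl_mono[OF adj_mono[OF BA]] by blast
      have "card D \<le> card ?C"
        using finite_component[OF G C] sub by (simp add: card_mono)
      then have "card D / card V \<le> card ?C / card V"
        by (simp add: divide_right_mono)
      then show ?thesis using C sub D e by force
    qed
    then have "\<exists>f. \<forall>C\<in>?CB. f C \<in> ?CA \<and> C \<subseteq> f C"
      by (intro bchoice ballI)
    then obtain f where f0: "\<forall>C\<in>?CB. f C \<in> ?CA \<and> C \<subseteq> f C" by (rule exE)
    note f = f0[THEN bspec, THEN conjunct1] f0[THEN bspec, THEN conjunct2]
    have "inj_on f ?CB"
    proof (rule inj_onI, rule ccontr)
      fix C D assume CD: "C \<in> ?CB" "D \<in> ?CB" "f C = f D" "C \<noteq> D"
      have fin: "finite C" "finite D" "C \<subseteq> V" "D \<subseteq> V"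
        using CD finite_component[OF GB] component_subset[OF GB] by auto
      have "C \<times> D \<subseteq> lost_pairs V A B"
      proof (clarsimp simp: lost_pairs_def)
        fix v w assume vw: "v \<in> C" "w \<in> D"
        have "(v, w) \<in> (adj (V, A))\<^sup>*"
          using f(1)[OF CD(1)] f(2)[OF CD(1)] f(2)[OF CD(2)] CD(3) vw
            component_connected[of "f C" "(V, A)" v w] by auto
        moreover have "(v, w) \<notin> (adj (V, B))\<^sup>*"
          using component_closed[of C "(V, B)" v w] components_disjoint[of C "(V, B)" D w] CD vw by auto
        ultimately show "(v, w) \<in> conn_pairs (V, A) \<and> (v, w) \<notin> conn_pairs (V, B)"
          using fin vw by (auto simp: conn_pairs_def)
      qed
      then have "card (C \<times> D) \<le> card (lost_pairs V A B)"
        using G by (intro card_mono finite_lost_pairs) (auto simp: is_sgraph_def)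
      then have "real (card C * card D) \<le> card (lost_pairs V A B)"
        by (simp add: card_cartesian_product flip: of_nat_mult)
      moreover have "e * card V < card C" "e * card V < card D"
        using CD(1,2) mult_nonneg_nonneg[OF x of_nat_0_le_iff[of "card V"]] n
        by (simp_all add: field_simps)
      then have "(e * card V) * (e * card V) < real (card C) * real (card D)"
        using e by (intro mult_strict_mono') auto
      moreover have "card (lost_pairs V A B) \<le> e\<^sup>2 * (card V)\<^sup>2"
        using e n by (simp add: field_simps)
      ultimately show False by (simp add: power2_eq_square algebra_simps)
    qed
    then show ?thesis
      using f finite_components[OF G] by (intro card_inj_on_le[of f]) auto
  qed
  ultimately show False by simp
qed

text \<open>The metric on sequences gives the coordinates the weights \<open>(1/2)^n\<close>, which
  add up to 2.\<close>

lemma dist_fun_le: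
  fixes x y :: "nat \<Rightarrow> 'a::metric_space"
  assumes "\<And>i. dist (x i) (y i) \<le> e"
  shows "dist x y \<le> 2 * e"
proof -
  have e: "0 \<le> e" using assms[of 0] zero_le_dist order_trans by blast
  have s: "summable (\<lambda>n. (1/2::real)^n * min (dist (x (from_nat n)) (y (from_nat n))) 1)"
    by (rule summable_comparison_test'[of "\<lambda>n. (1/2)^n"]) (auto simp: summable_geometric_iff)
  have "dist x y \<le> (\<Sum>n. (1/2)^n * e)"
    unfolding dist_fun_def
    by (intro suminf_le s) (auto intro!: summable_mult2 mult_left_mono min.coboundedI1 assms)
  also have "\<dots> = (\<Sum>n. (1/2)^n) * e"
    by (rule suminf_mult2[symmetric]) auto
  also have "\<dots> = 2 * e"
    by (simp add: suminf_geometric)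
  finally show ?thesis .
qed

lemma dist_ranked_masses_le:
  assumes G: "is_sgraph (V, A)" and BA: "B \<subseteq> A" and V: "V \<noteq> {}"
  shows "dist (ranked_masses (V, A)) (ranked_masses (V, B))
    \<le> 2 * sqrt (sum_squares (ranked_masses (V, A)) - sum_squares (ranked_masses (V, B)))"
proof -
  let ?e = "sqrt (card (lost_pairs V A B) / (card V)\<^sup>2)"
  have "dist (ranked_masses (V, A)) (ranked_masses (V, B)) \<le> 2 * ?e"
    using ranked_masses_le[OF assms, of ?e] ranked_masses_ge[OF assms, of ?e]
    by (intro dist_fun_le) (simp add: dist_real_def abs_le_iff algebra_simps)
  then show ?thesis by (simp add: sum_squares_diff[OF G BA])
qed

section \<open>Separating edges in a tree\<close>

definition sep_edges :: "'v sgraph \<Rightarrow> 'v \<Rightarrow> 'v \<Rightarrow> 'v set set" where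
  "sep_edges G v w = {e \<in> edges G. (v, w) \<notin> (adj (verts G, edges G - {e}))\<^sup>*}"

text \<open>In a tree the separating edges are those of the path from \<open>v\<close> to
  \<open>w\<close>; defining them by deletion avoids choosing it. Each step of a walk adds at most
  its own edge: any other edge that separates \<open>v\<close> from \<open>w\<close> already
  separates \<open>v\<close> from the previous vertex.\<close>

lemma sep_edges_relpow:
  assumes "(v, w) \<in> adj G ^^ k"
  shows "finite (sep_edges G v w) \<and> card (sep_edges G v w) \<le> k"
  using assms
proof (induction k arbitrary: w)
  case 0
  then have "sep_edges G v w = {}" by (auto simp: sep_edges_def)
  then show ?case by simp
next
  case (Suc k)
  then obtain u where u: "(v, u) \<in> adj G ^^ k" "(u, w) \<in> adj G" by auto
  have "sep_edges G v w \<subseteq> insert {u, w} (sep_edges G v u)"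
  proof
    fix e assume e: "e \<in> sep_edges G v w"
    show "e \<in> insert {u, w} (sep_edges G v u)"
    proof (rule ccontr)
      assume "e \<notin> insert {u, w} (sep_edges G v u)"
      then have "(v, u) \<in> (adj (verts G, edges G - {e}))\<^sup>*" "(u, w) \<in> adj (verts G, edges G - {e})"
        using e u by (auto simp: sep_edges_def adj_def)
      then have "(v, w) \<in> (adj (verts G, edges G - {e}))\<^sup>*"
        by (rule rtrancl.rtrancl_into_rtrancl)
      then show False using e by (simp add: sep_edges_def)
    qed
  qed
  moreover have "finite (sep_edges G v u)" "card (sep_edges G v u) \<le> k"
    using Suc.IH[OF u(1)] by auto
  ultimately show ?case
    using card_mono[of "insert {u, w} (sep_edges G v u)" "sep_edges G v w"]
    by (auto simp: finite_subset card_insert_if split: if_splits)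
qed

lemma graph_dist_relpow: "(v, w) \<in> (adj G)\<^sup>* \<Longrightarrow> (v, w) \<in> adj G ^^ graph_dist G v w"
  unfolding graph_dist_def by (meson LeastI rtrancl_imp_relpow)

lemma card_sep_edges_le:
  assumes "(v, w) \<in> (adj G)\<^sup>*"
  shows "card (sep_edges G v w) \<le> graph_dist G v w"
  using sep_edges_relpow[OF graph_dist_relpow[OF assms]] by blast

text \<open>A crude bound suffices, as it only serves to make the distance of the random vertices
  integrable.\<close>

lemma graph_dist_le:
  assumes "is_sgraph G" "(v, w) \<in> (adj G)\<^sup>*"
  shows "graph_dist G v w \<le> (card (verts G))\<^sup>2"
proof -
  have fin: "finite (adj G)" and card: "card (adj G) \<le> (card (verts G))\<^sup>2"
    using adj_subset_verts[OF assms(1)] assms(1)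
    by (auto simp: is_sgraph_def finite_subset power2_eq_square
        intro: card_mono[of "verts G \<times> verts G", unfolded card_cartesian_product])
  obtain k where "k \<le> card (adj G)" "(v, w) \<in> adj G ^^ k"
    using rtrancl_finite_eq_relpow[OF fin] assms(2) by auto
  then show ?thesis
    using card Least_le[of "\<lambda>k. (v, w) \<in> adj G ^^ k" k] by (simp add: graph_dist_def)
qed

text \<open>Loop erasure: when the new first vertex already occurs, everything before that
  occurrence is dropped.\<close>

lemma rtrancl_distinct_path:
  assumes "(a, b) \<in> R\<^sup>*"
  shows "\<exists>vs. vs \<noteq> [] \<and> hd vs = a \<and> last vs = b \<and> distinct vs \<and> successively (\<lambda>x y. (x, y) \<in> R) vs"
  using assms
proof (induction rule: converse_rtrancl_induct)
  case base
  show ?case by (rule exI[of _ "[b]"]) simp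
next
  case (step a c)
  then obtain vs where vs: "vs \<noteq> []" "hd vs = c" "last vs = b" "distinct vs"
      "successively (\<lambda>x y. (x, y) \<in> R) vs" by blast
  show ?case
  proof (cases "a \<in> set vs")
    case True
    then obtain ys zs where yz: "vs = ys @ a # zs" by (meson split_list)
    then show ?thesis
      using vs by (intro exI[of _ "a # zs"]) (auto simp: successively_append_iff)
  next
    case False
    then show ?thesis
      using vs step.hyps(1)
      by (intro exI[of _ "a # vs"]) (auto simp: successively_Cons)
  qed
qed

text \<open>A detour from \<open>a\<close> to \<open>b\<close> that avoids the edge can be made
  simple, and together with the edge it is a cycle. It has at least three vertices, since one would
  mean \<open>a = b\<close> and two would use the edge itself.\<close>

lemma tree_edge_bridge:
  assumes "is_tree G" "{a, b} \<in> edges G"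
  shows "(a, b) \<notin> (adj (verts G, edges G - {{a, b}}))\<^sup>*"
proof
  assume "(a, b) \<in> (adj (verts G, edges G - {{a, b}}))\<^sup>*"
  then obtain vs where vs: "vs \<noteq> []" "hd vs = a" "last vs = b" "distinct vs"
      "successively (\<lambda>x y. (x, y) \<in> adj (verts G, edges G - {{a, b}})) vs"
    using rtrancl_distinct_path by metis
  have ab: "a \<noteq> b"
    using assms unfolding is_tree_def is_sgraph_def by (metis doubleton_eq_iff)
  have step: "{vs ! i, vs ! Suc i} \<in> edges G - {{a, b}}" if "Suc i < length vs" for i
    using vs(5) that by (simp add: successively_conv_nth adj_def)
  have "length vs \<noteq> 1"
    using vs ab by (auto simp: length_Suc_conv)
  moreover have "length vs \<noteq> 2"
  proof
    assume "length vs = 2"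
    then have "vs = [a, b]"
      using vs(2,3) by (auto simp: length_Suc_conv numeral_2_eq_2)
    then show False using step[of 0] by simp
  qed
  moreover have "length vs \<noteq> 0" using vs by simp
  ultimately have len: "3 \<le> length vs" by linarith
  have "{vs ! i, vs ! (Suc i mod length vs)} \<in> edges G" if i: "i < length vs" for i
  proof (cases "Suc i < length vs")
    case True
    then show ?thesis using step[of i] by simp
  next
    case False
    \<comment> \<open>The last vertex wraps around to the first, and the closing edge is the deleted
      one.\<close>
    then have "Suc i = length vs" using i by simp
    have "vs ! i = b"
      using last_conv_nth[OF vs(1)] vs(3) \<open>Suc i = length vs\<close> by (metis diff_Suc_1)
    moreover have "vs ! (Suc i mod length vs) = a"
      using hd_conv_nth[OF vs(1)] vs(2) \<open>Suc i = length vs\<close> by simp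
    ultimately show ?thesis using assms(2) by (simp add: insert_commute)
  qed
  then have "is_cycle G vs" using len vs by (simp add: is_cycle_def)
  then show False using assms(1) by (auto simp: is_tree_def)
qed

text \<open>The walk has to use the new edge. While the current vertex is out of reach of
  \<open>v\<close>, the induction keeps \<open>v\<close> joined to one endpoint and the current
  vertex to the other; crossing back would bring the current vertex within reach again.\<close>

lemma rtrancl_delete_edge:
  assumes "(v, w) \<in> (adj (V, insert {a, b} A))\<^sup>*" "(v, w) \<notin> (adj (V, A))\<^sup>*"
  shows "(v, a) \<in> (adj (V, A))\<^sup>* \<and> (b, w) \<in> (adj (V, A))\<^sup>* \<or>
    (v, b) \<in> (adj (V, A))\<^sup>* \<and> (a, w) \<in> (adj (V, A))\<^sup>*"
  using assms
proof (induction rule: rtrancl_induct)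
  case (step u w)
  show ?case
  proof (cases "(v, u) \<in> (adj (V, A))\<^sup>*")
    case True
    then have "(u, w) \<notin> adj (V, A)" using step.prems by (meson rtrancl.rtrancl_into_rtrancl)
    then have "{u, w} = {a, b}" using step.hyps(2) by (auto simp: adj_def)
    then show ?thesis using True by (auto simp: doubleton_eq_iff)
  next
    case False
    have IH: "(v, a) \<in> (adj (V, A))\<^sup>* \<and> (b, u) \<in> (adj (V, A))\<^sup>* \<or>
        (v, b) \<in> (adj (V, A))\<^sup>* \<and> (a, u) \<in> (adj (V, A))\<^sup>*"
      using step.IH[OF False] .
    show ?thesis
    proof (cases "(u, w) \<in> adj (V, A)")
      case True
      then show ?thesis using IH by (meson rtrancl.rtrancl_into_rtrancl)
    next
      case False
      then have "{u, w} = {a, b}" using step.hyps(2) by (auto simp: adj_def)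
      then show ?thesis using IH step.prems by (auto simp: doubleton_eq_iff)
    qed
  qed
qed simp

text \<open>Restore the edges of \<open>A - B\<close> one at a time and take an edge that reconnects
  \<open>v\<close> and \<open>w\<close>. If they were also joined in the tree without it, so would
  be its two endpoints, although every edge of a tree is a bridge.\<close>

lemma sep_edge_ex:
  assumes tree: "is_tree G" and A: "A \<subseteq> edges G" and B: "B \<subseteq> A"
    and vw: "(v, w) \<in> (adj (verts G, A))\<^sup>*" "(v, w) \<notin> (adj (verts G, B))\<^sup>*"
  shows "\<exists>e\<in>A - B. e \<in> sep_edges G v w"
proof -
  have G: "is_sgraph G" using tree by (simp add: is_tree_def)
  have "finite (A - B)"
    using A is_sgraph_finite_edges[OF G] finite_subset by blast
  moreover have "(v, w) \<in> (adj (verts G, B \<union> D))\<^sup>* \<Longrightarrow> \<exists>e\<in>D. e \<in> sep_edges G v w"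
    if "finite D" "D \<subseteq> A - B" for D
    using that
  proof (induction rule: finite_induct)
    case (insert e D)
    show ?case
    proof (cases "(v, w) \<in> (adj (verts G, B \<union> D))\<^sup>*")
      case True
      then show ?thesis using insert by auto
    next
      case False
      have eG: "e \<in> edges G" using insert.prems A by auto
      then obtain a b where e: "e = {a, b}" using G by (auto simp: is_sgraph_def)
      let ?R = "(adj (verts G, edges G - {e}))\<^sup>*"
      have sub: "(adj (verts G, B \<union> D))\<^sup>* \<subseteq> ?R"
        using insert.hyps insert.prems A B by (intro rtrancl_mono adj_mono) auto
      have "(v, w) \<notin> ?R"
      proof
        assume R: "(v, w) \<in> ?R"
        have "(v, a) \<in> ?R \<and> (b, w) \<in> ?R \<or> (v, b) \<in> ?R \<and> (a, w) \<in> ?R"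
          using rtrancl_delete_edge[of v w "verts G" a b "B \<union> D"] insert.prems(1) False sub
          by (auto simp: e)
        \<comment> \<open>From one endpoint go to \<open>v\<close>, along the detour to
          \<open>w\<close>, and on to the other endpoint, using symmetry.\<close>
        then have "(a, b) \<in> ?R"
          using R sym_adj_rtrancl by (meson rtrancl_trans symD)
        then show False
          using tree_edge_bridge[OF tree] eG e by simp
      qed
      then show ?thesis using eG by (auto simp: sep_edges_def)
    qed
  qed (use vw in auto)
  ultimately show ?thesis
    using vw(1) B by (metis Un_Diff_cancel subset_refl sup.absorb2)
qed

section \<open>Compactness in the J1 topology\<close>

lemma time_change_inverse:
  assumes "time_change \<mu>"
  obtains \<nu> where "time_change \<nu>" "\<And>s. 0 \<le> s \<Longrightarrow> 0 \<le> \<nu> s \<and> \<mu> (\<nu> s) = s" "\<And>s. 0 \<le> s \<Longrightarrow> \<nu> (\<mu> s) = s"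
proof -
  have mono: "strict_mono_on {0..} \<mu>" and im: "\<mu> ` {0..} = {0..}"
    using assms by (auto simp: time_change_def)
  have inj: "inj_on \<mu> {0..}" using mono by (rule strict_mono_on_imp_inj_on)
  define \<nu> where "\<nu> = the_inv_into {0..} \<mu>"
  have 1: "0 \<le> \<nu> s \<and> \<mu> (\<nu> s) = s" if "0 \<le> s" for s
  proof -
    have s: "s \<in> \<mu> ` {0..}" using im that by simp
    show ?thesis
      using the_inv_into_into[OF inj s subset_refl] f_the_inv_into_f[OF inj s] by (simp add: \<nu>_def)
  qed
  have 2: "\<nu> (\<mu> s) = s" if "0 \<le> s" for s
    using the_inv_into_f_f[OF inj] that by (simp add: \<nu>_def)
  have "strict_mono_on {0..} \<nu>"
  proof (rule strict_mono_onI)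
    fix s t :: real assume st: "s \<in> {0..}" "t \<in> {0..}" "s < t"
    then show "\<nu> s < \<nu> t"
      using 1[of s] 1[of t] strict_mono_on_leD[OF mono, of "\<nu> t" "\<nu> s"] by force
  qed
  moreover have "\<nu> ` {0..} = {0..}"
  proof (intro equalityI subsetI)
    fix s :: real assume "s \<in> {0..}"
    then have "s = \<nu> (\<mu> s)" "\<mu> s \<in> {0..}" using 2 im by auto
    then show "s \<in> \<nu> ` {0..}" by (rule image_eqI)
  qed (use 1 in auto)
  ultimately show thesis using that 1 2 by (simp add: time_change_def)
qed

text \<open>Only times up to \<open>N\<close> are controlled. The inverse time change maps
  \<open>{0..N - \<epsilon>}\<close> into \<open>{0..N}\<close>, because times move by less than
  \<epsilon>; this is the loss of horizon.\<close>

lemma J1_close_sym: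
  assumes "J1_close N \<epsilon> x y" "0 < \<epsilon>"
  shows "J1_close (N - \<epsilon>) \<epsilon> y x"
proof -
  obtain \<mu> where \<mu>: "time_change \<mu>"
    "\<And>s. s \<in> {0..N} \<Longrightarrow> \<bar>\<mu> s - s\<bar> < \<epsilon> \<and> dist (y (\<mu> s)) (x s) < \<epsilon>"
    using assms by (auto simp: J1_close_def)
  obtain \<nu> where \<nu>: "time_change \<nu>" "\<And>s. 0 \<le> s \<Longrightarrow> 0 \<le> \<nu> s \<and> \<mu> (\<nu> s) = s"
    using time_change_inverse[OF \<mu>(1)] by metis
  have "\<bar>\<nu> s - s\<bar> < \<epsilon> \<and> dist (x (\<nu> s)) (y s) < \<epsilon>" if s: "s \<in> {0..N - \<epsilon>}" for s
  proof -
    have N: "0 \<le> N" using s assms(2) by auto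
    have "\<nu> s \<le> N"
    proof (rule ccontr)
      assume "\<not> \<nu> s \<le> N"
      then have "\<mu> N < \<mu> (\<nu> s)"
        using \<mu>(1) N by (auto simp: time_change_def strict_mono_on_def)
      then show False using \<nu>(2)[of s] \<mu>(2)[of N] s N by auto
    qed
    then show ?thesis
      using \<mu>(2)[of "\<nu> s"] \<nu>(2)[of s] s by (auto simp: dist_commute abs_minus_commute)
  qed
  then show ?thesis using \<nu>(1) unfolding J1_close_def by blast
qed

text \<open>The witness is an interior: paths all of whose neighbours in some radius are close to
  \<open>x\<close>. It is open because half of the radius around such a path leaves the other half
  for the triangle inequality.\<close>

lemma J1_close_interior:
  assumes "x \<in> cadlag_paths S" "0 < \<epsilon>"
  shows "\<exists>U. openin (J1_topology S) U \<and> x \<in> U \<and> (\<forall>y\<in>U. J1_close N \<epsilon> x y)"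
proof (intro exI conjI ballI)
  let ?U = "{z \<in> cadlag_paths S. \<exists>M \<delta>. 0 < \<delta> \<and>
    (\<forall>w\<in>cadlag_paths S. J1_close M \<delta> z w \<longrightarrow> J1_close N \<epsilon> x w)}"
  show "openin (J1_topology S) ?U"
    unfolding openin_J1_topology
  proof (intro conjI ballI)
    fix z assume "z \<in> ?U"
    then obtain M \<delta> where \<delta>: "0 < \<delta>"
      and M: "\<And>w. w \<in> cadlag_paths S \<Longrightarrow> J1_close M \<delta> z w \<Longrightarrow> J1_close N \<epsilon> x w"
      by blast
    have "w \<in> ?U" if w: "w \<in> cadlag_paths S" "J1_close M (\<delta> / 2) z w" for w
    proof -
      have "\<forall>u\<in>cadlag_paths S. J1_close (M + \<delta> / 2) (\<delta> / 2) w u \<longrightarrow> J1_close N \<epsilon> x u"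
        using J1_close_trans[OF w(2)] M by fastforce
      then show ?thesis using w(1) half_gt_zero[OF \<delta>] by blast
    qed
    then show "\<exists>N \<epsilon>. 0 < \<epsilon> \<and> (\<forall>w\<in>cadlag_paths S. J1_close N \<epsilon> z w \<longrightarrow> w \<in> ?U)"
      using half_gt_zero[OF \<delta>] by blast
  qed blast
  show "x \<in> ?U" using assms by blast
  fix y assume "y \<in> ?U"
  then show "J1_close N \<epsilon> x y"
    using J1_close_refl by blast
qed

text \<open>The criterion of \<open>limitin_J1_iff\<close> without the space \<open>S\<close>, in a
  form that combines directly with \<open>J1_close_trans\<close>.\<close>

definition J1_limit :: "(nat \<Rightarrow> real \<Rightarrow> 'a::metric_space) \<Rightarrow> (real \<Rightarrow> 'a) \<Rightarrow> bool" where
  "J1_limit f y \<longleftrightarrow> (\<forall>N. \<forall>\<epsilon>>0. \<forall>\<^sub>F n in sequentially. J1_close N \<epsilon> y (f n))"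

lemma J1_limitD: "J1_limit f y \<Longrightarrow> 0 < \<epsilon> \<Longrightarrow> \<forall>\<^sub>F n in sequentially. J1_close N \<epsilon> y (f n)"
  by (simp add: J1_limit_def)

lemma J1_limit_in_openin:
  assumes "J1_limit f y" "openin (J1_topology S) U" "y \<in> U" "\<And>n. f n \<in> cadlag_paths S"
  shows "\<forall>\<^sub>F n in sequentially. f n \<in> U"
proof -
  obtain N \<epsilon> where "0 < \<epsilon>" and U: "\<forall>z\<in>cadlag_paths S. J1_close N \<epsilon> y z \<longrightarrow> z \<in> U"
    using assms(2,3) by (auto simp: openin_J1_topology)
  show ?thesis
    using J1_limitD[OF assms(1) \<open>0 < \<epsilon>\<close>, of N] by eventually_elim (use U assms(4) in blast)
qed

text \<open>The horizon \<open>n\<close> and the radius \<open>1 / (n + 1)\<close> eventually beat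
  every \<open>N\<close> and \<epsilon>, so one closeness statement for each \<open>n\<close> takes
  care of all neighbourhoods.\<close>

lemma J1_limit_perturb:
  fixes f g :: "nat \<Rightarrow> real \<Rightarrow> 'a::metric_space"
  assumes lim: "J1_limit g y" and close: "\<And>n. J1_close (real n) (1 / (real n + 1)) (g n) (f n)"
  shows "J1_limit f y"
  unfolding J1_limit_def
proof (intro allI impI)
  fix N \<epsilon> :: real assume \<epsilon>: "0 < \<epsilon>"
  have "(\<lambda>n. 1 / (real n + 1)) \<longlonglongrightarrow> 0"
    using LIMSEQ_inverse_real_of_nat by (simp add: inverse_eq_divide add.commute)
  then have ev: "\<forall>\<^sub>F n in sequentially. 1 / (real n + 1) < \<epsilon> / 2"
    by (rule order_tendstoD) (use \<epsilon> in simp)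
  have ev2: "\<forall>\<^sub>F n in sequentially. N + \<epsilon> + 1 \<le> real n"
    using filterlim_real_sequentially by (simp add: filterlim_at_top)
  show "\<forall>\<^sub>F n in sequentially. J1_close N \<epsilon> y (f n)"
    using J1_limitD[OF lim half_gt_zero[OF \<epsilon>], of N] ev ev2
  proof eventually_elim
    case (elim n)
    have "J1_close (N + \<epsilon> / 2) (\<epsilon> / 2) (g n) (f n)"
      by (rule J1_close_mono[OF close]) (use elim \<epsilon> in linarith)+
    from J1_close_trans[OF elim(1) this] show ?case by simp
  qed
qed

text \<open>Its use is by contraposition: a sequence without close pairs has no convergent
  subsequence.\<close>

lemma J1_limit_close_pair:
  assumes lim: "J1_limit f y" and \<epsilon>: "0 < \<epsilon>"
  shows "\<exists>m n. m < n \<and> J1_close N \<epsilon> (f m) (f n)"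
proof -
  have "\<forall>\<^sub>F n in sequentially. J1_close (N + \<epsilon>) (\<epsilon> / 2) y (f n)"
    using J1_limitD[OF lim half_gt_zero[OF \<epsilon>]] .
  then obtain k where k: "\<And>n. k \<le> n \<Longrightarrow> J1_close (N + \<epsilon>) (\<epsilon> / 2) y (f n)"
    by (auto simp: eventually_sequentially)
  have "J1_close (N + \<epsilon> - \<epsilon> / 2) (\<epsilon> / 2) (f k) y"
    by (intro J1_close_sym k) (use \<epsilon> in auto)
  then have a: "J1_close N (\<epsilon> / 2) (f k) y"
    by (rule J1_close_mono) (use \<epsilon> in auto)
  have b: "J1_close (N + \<epsilon> / 2) (\<epsilon> / 2) y (f (Suc k))"
    by (rule J1_close_mono[OF k]) (use \<epsilon> in auto)
  show ?thesis
    using J1_close_trans[OF a b] by (intro exI[of _ k] exI[of _ "Suc k"]) simp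
qed

text \<open>The classical passage from sequences to covers, with \<open>J1_close\<close> in place of
  a metric: sequences in the closure are shadowed by sequences in \<open>K0\<close>, and then finite
  nets and a Lebesgue number produce a finite subcover.\<close>

theorem J1_compactin_closure:
  fixes S :: "'a::metric_space set"
  assumes K0: "K0 \<subseteq> cadlag_paths S"
    and seq: "\<And>f :: nat \<Rightarrow> real \<Rightarrow> 'a. range f \<subseteq> K0 \<Longrightarrow>
      \<exists>r y. strict_mono r \<and> y \<in> cadlag_paths S \<and> J1_limit (f \<circ> r) y"
  shows "compactin (J1_topology S) ((J1_topology S) closure_of K0)"
proof -
  let ?X = "J1_topology S"
  define K where "K = ?X closure_of K0"
  have KD: "K \<subseteq> cadlag_paths S"
    using closure_of_subset_topspace[of ?X K0] by (simp add: K_def topspace_J1_topology)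
  have seqK: "\<exists>r y. strict_mono r \<and> y \<in> K \<and> J1_limit (f \<circ> r) y" if f: "range f \<subseteq> K" for f :: "nat \<Rightarrow> _"
  proof -
    have "\<exists>g\<in>K0. J1_close (real n) (1 / (real n + 1)) g (f n)" for n
    proof -
      have fn: "f n \<in> K" using f by auto
      then have fnD: "f n \<in> cadlag_paths S" using KD by auto
      have h0: "0 < 1 / (real n + 1)" by simp
      \<comment> \<open>One extra unit of horizon pays for the loss in \<open>J1_close_sym\<close>,
        as the radius is at most 1.\<close>
      obtain U where U: "openin ?X U" "f n \<in> U"
          "\<forall>y\<in>U. J1_close (real n + 1) (1 / (real n + 1)) (f n) y"
        using J1_close_interior[OF fnD h0, where N = "real n + 1"] by (elim exE conjE)
      then obtain g where "g \<in> K0" "g \<in> U"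
        using fn by (auto simp: K_def in_closure_of)
      then have "J1_close (real n + 1 - 1 / (real n + 1)) (1 / (real n + 1)) g (f n)"
        by (intro J1_close_sym U(3)[rule_format]) auto
      then have "J1_close (real n) (1 / (real n + 1)) g (f n)"
        by (rule J1_close_mono) auto
      then show ?thesis using \<open>g \<in> K0\<close> by auto
    qed
    then obtain g where g: "\<And>n. g n \<in> K0" "\<And>n. J1_close (real n) (1 / (real n + 1)) (g n) (f n)"
      by metis
    obtain r y where r: "strict_mono r" and y: "y \<in> cadlag_paths S" and lim: "J1_limit (g \<circ> r) y"
      using seq[of g] g(1) by auto
    have "y \<in> K"
      unfolding K_def in_closure_of
    proof (intro conjI allI impI)
      fix U assume "y \<in> U \<and> openin ?X U"
      then have "\<forall>\<^sub>F n in sequentially. (g \<circ> r) n \<in> U"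
        using J1_limit_in_openin[OF lim] g(1) K0 by auto
      then have "\<exists>n. (g \<circ> r) n \<in> U"
        by (rule eventually_happens'[OF sequentially_bot])
      then show "\<exists>z. z \<in> K0 \<and> z \<in> U" using g(1) by auto
    qed (use y in \<open>simp add: topspace_J1_topology\<close>)
    moreover have "J1_limit (f \<circ> r) y"
    proof (rule J1_limit_perturb[OF lim])
      fix n
      have "real n \<le> real (r n)" using seq_suble[OF r, of n] by simp
      moreover from this have "1 / (real (r n) + 1) \<le> 1 / (real n + 1)"
        by (simp add: frac_le)
      ultimately show "J1_close (real n) (1 / (real n + 1)) ((g \<circ> r) n) ((f \<circ> r) n)"
        using J1_close_mono[OF g(2)[of "r n"]] by simp
    qed
    ultimately show ?thesis using r by blast
  qed
  \<comment> \<open>Finite nets: otherwise an infinite sequence in \<open>K\<close> without close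
    pairs could be chosen greedily.\<close>
  have net: "\<exists>F. finite F \<and> F \<subseteq> K \<and> (\<forall>x\<in>K. \<exists>z\<in>F. J1_close N \<epsilon> z x)" if \<epsilon>: "0 < \<epsilon>" for N \<epsilon>
  proof (rule ccontr)
    assume neg: "\<not> ?thesis"
    have "\<exists>f::nat \<Rightarrow> _. \<forall>n. f n \<in> K \<and> (\<forall>m<n. \<not> J1_close N \<epsilon> (f m) (f n))"
    proof (rule dependent_wellorder_choice)
      fix n :: nat and f assume "\<And>m. m < n \<Longrightarrow> f m \<in> K \<and> (\<forall>k<m. \<not> J1_close N \<epsilon> (f k) (f m))"
      then have "finite (f ` {..<n})" "f ` {..<n} \<subseteq> K" by auto
      then obtain x where "x \<in> K" "\<forall>z\<in>f ` {..<n}. \<not> J1_close N \<epsilon> z x"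
        using neg by meson
      then show "\<exists>x. x \<in> K \<and> (\<forall>m<n. \<not> J1_close N \<epsilon> (f m) x)" by auto
    qed auto
    then obtain f :: "nat \<Rightarrow> _" where f: "\<And>n. f n \<in> K" "\<And>m n. m < n \<Longrightarrow> \<not> J1_close N \<epsilon> (f m) (f n)"
      by auto
    then obtain r y where r: "strict_mono r" and lim: "J1_limit (f \<circ> r) y"
      using seqK[of f] by auto
    obtain m n where "m < n" "J1_close N \<epsilon> ((f \<circ> r) m) ((f \<circ> r) n)"
      using J1_limit_close_pair[OF lim \<epsilon>] by blast
    then show False using f(2)[of "r m" "r n"] r by (auto simp: strict_mono_def)
  qed
  have "\<exists>\<F>. finite \<F> \<and> \<F> \<subseteq> \<U> \<and> K \<subseteq> \<Union>\<F>"
    if \<U>: "\<forall>U\<in>\<U>. openin ?X U" "K \<subseteq> \<Union>\<U>" for \<U>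
  proof -
    \<comment> \<open>A Lebesgue number for the cover. Otherwise there are centres
      \<open>f n\<close> near which every member of the cover is missed by some path. A
      subsequential limit of the centres lies in some \<open>U\<close> of the cover, and the nearby
      paths \<open>z n\<close> outside \<open>U\<close> would have to enter it.\<close>
    have "\<exists>N \<epsilon>. 0 < \<epsilon> \<and> (\<forall>x\<in>K. \<exists>U\<in>\<U>. \<forall>y\<in>cadlag_paths S. J1_close N \<epsilon> x y \<longrightarrow> y \<in> U)"
    proof (rule ccontr)
      assume neg: "\<not> ?thesis"
      have "\<exists>x\<in>K. \<forall>U\<in>\<U>. \<exists>y\<in>cadlag_paths S. J1_close (real n) (1 / (real n + 1)) x y \<and> y \<notin> U" for n
      proof (rule ccontr)
        assume "\<not> ?thesis"
        then have "0 < 1 / (real n + 1) \<and> (\<forall>x\<in>K. \<exists>U\<in>\<U>. \<forall>y\<in>cadlag_paths S.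
            J1_close (real n) (1 / (real n + 1)) x y \<longrightarrow> y \<in> U)" by auto
        then show False using neg by blast
      qed
      then obtain f where f: "\<And>n. f n \<in> K" "\<And>n. \<forall>U\<in>\<U>. \<exists>y\<in>cadlag_paths S.
          J1_close (real n) (1 / (real n + 1)) (f n) y \<and> y \<notin> U" by metis
      then obtain r y where r: "strict_mono r" and y: "y \<in> K" and lim: "J1_limit (f \<circ> r) y"
        using seqK[of f] by auto
      obtain U where U: "U \<in> \<U>" "y \<in> U" using y \<U>(2) by auto
      have "\<forall>n. \<exists>z. z \<in> cadlag_paths S \<and> z \<notin> U \<and> J1_close (real n) (1 / (real n + 1)) (f n) z"
        using f(2) U(1) by blast
      then obtain z where z0: "\<forall>n. z n \<in> cadlag_paths S \<and> z n \<notin> U \<and>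
          J1_close (real n) (1 / (real n + 1)) (f n) (z n)"
        unfolding choice_iff by (rule exE)
      then have z: "\<And>n. z n \<in> cadlag_paths S" "\<And>n. z n \<notin> U"
          "\<And>n. J1_close (real n) (1 / (real n + 1)) (f n) (z n)"
        by (simp_all only: z0 simp_thms)
      have "J1_limit (z \<circ> r) y"
      proof (rule J1_limit_perturb[OF lim])
        fix n
        have "real n \<le> real (r n)" using seq_suble[OF r, of n] by simp
        moreover from this have "1 / (real (r n) + 1) \<le> 1 / (real n + 1)"
          by (simp add: frac_le)
        ultimately show "J1_close (real n) (1 / (real n + 1)) ((f \<circ> r) n) ((z \<circ> r) n)"
          using J1_close_mono[OF z(3)[of "r n"]] by simp
      qed
      then have "\<forall>\<^sub>F n in sequentially. (z \<circ> r) n \<in> U"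
        by (rule J1_limit_in_openin) (use U \<U>(1) z(1) in auto)
      then have "\<exists>n. (z \<circ> r) n \<in> U"
        by (rule eventually_happens'[OF sequentially_bot])
      then show False using z(2) by auto
    qed
    then obtain N \<epsilon> where \<epsilon>: "0 < \<epsilon>"
        and leb: "\<And>x. x \<in> K \<Longrightarrow> \<exists>U\<in>\<U>. \<forall>y\<in>cadlag_paths S. J1_close N \<epsilon> x y \<longrightarrow> y \<in> U"
      by auto
    obtain F where F: "finite F" "F \<subseteq> K" "\<And>x. x \<in> K \<Longrightarrow> \<exists>z\<in>F. J1_close N \<epsilon> z x"
      using net[OF \<epsilon>, of N] by auto
    obtain h where h: "\<And>x. x \<in> K \<Longrightarrow> h x \<in> \<U>"
        "\<And>x y. x \<in> K \<Longrightarrow> y \<in> cadlag_paths S \<Longrightarrow> J1_close N \<epsilon> x y \<Longrightarrow> y \<in> h x"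
      using leb by metis
    have "K \<subseteq> \<Union>(h ` F)"
      using F(2,3) h(2) KD by blast
    then show ?thesis
      using F h(1) by (intro exI[of _ "h ` F"]) auto
  qed
  then show ?thesis
    using KD by (simp add: compactin_def topspace_J1_topology flip: K_def)
qed

text \<open>The logarithmic slope condition behind Billingsley's complete metric. Exponentials make
  the parameters add under composition, and the lower slope bound passes to pointwise
  limits.\<close>

definition lip_change :: "real \<Rightarrow> (real \<Rightarrow> real) \<Rightarrow> bool" where
  "lip_change a \<mu> \<longleftrightarrow> \<mu> 0 = 0 \<and> (\<forall>s\<ge>0. \<bar>\<mu> s - s\<bar> \<le> a) \<and>
     (\<forall>s t. 0 \<le> s \<longrightarrow> s \<le> t \<longrightarrow> exp (- a) * (t - s) \<le> \<mu> t - \<mu> s \<and> \<mu> t - \<mu> s \<le> exp a * (t - s))"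

lemma lip_changeD:
  assumes "lip_change a \<mu>"
  shows "\<mu> 0 = 0" "0 \<le> s \<Longrightarrow> \<bar>\<mu> s - s\<bar> \<le> a"
    "0 \<le> s \<Longrightarrow> s \<le> t \<Longrightarrow> exp (- a) * (t - s) \<le> \<mu> t - \<mu> s"
    "0 \<le> s \<Longrightarrow> s \<le> t \<Longrightarrow> \<mu> t - \<mu> s \<le> exp a * (t - s)"
  using assms unfolding lip_change_def by blast+

lemma lip_change_less:
  assumes "lip_change a \<mu>" "0 \<le> s" "s < t"
  shows "\<mu> s < \<mu> t"
proof -
  have "0 < exp (- a) * (t - s)" using assms(3) by simp
  then show ?thesis using lip_changeD(3)[OF assms(1), of s t] assms by linarith
qed

lemma lip_change_nonneg: "lip_change a \<mu> \<Longrightarrow> 0 \<le> s \<Longrightarrow> 0 \<le> \<mu> s"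
  using lip_changeD(1)[of a \<mu>] lip_change_less[of a \<mu> 0 s] by (cases "s = 0") auto

lemma lip_change_abs:
  assumes "lip_change a \<mu>" "0 \<le> s" "0 \<le> t"
  shows "\<bar>\<mu> t - \<mu> s\<bar> \<le> exp a * \<bar>t - s\<bar>"
proof (cases "s \<le> t")
  case True
  then show ?thesis
    using lip_changeD(4)[OF assms(1,2) True] lip_change_less[OF assms(1,2), of t] by (cases "s = t") auto
next
  case False
  then show ?thesis
    using lip_changeD(4)[OF assms(1,3), of s] lip_change_less[OF assms(1,3), of s]
    by (simp add: abs_if algebra_simps)
qed

lemma lip_change_time_change:
  assumes "lip_change a \<mu>"
  shows "time_change \<mu>"
proof -
  have "strict_mono_on {0..} \<mu>"
    using lip_change_less[OF assms] by (auto simp: strict_mono_on_def)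
  moreover have "\<mu> ` {0..} = {0..}"
  proof (intro equalityI subsetI)
    fix y :: real assume y: "y \<in> {0..}"
    have a: "0 \<le> a" using lip_changeD(2)[OF assms, of 0] by auto
    have cont: "continuous_on {0..y + a} \<mu>"
      by (rule lipschitz_on_continuous_on[where L = "exp a"], rule lipschitz_onI)
        (use lip_change_abs[OF assms] in \<open>auto simp: dist_real_def\<close>)
    \<comment> \<open>At \<open>y + a\<close> the function has reached at least \<open>y\<close>,
      since it moves points by at most \<open>a\<close>.\<close>
    have "\<exists>x. 0 \<le> x \<and> x \<le> y + a \<and> \<mu> x = y"
      using lip_changeD(1)[OF assms] lip_changeD(2)[OF assms, of "y + a"] y a
      by (intro IVT' cont) auto
    then show "y \<in> \<mu> ` {0..}" by auto
  qed (use lip_change_nonneg[OF assms] in auto)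
  ultimately show ?thesis by (simp add: time_change_def)
qed

lemma lip_change_inverse:
  assumes "lip_change a \<mu>"
  obtains \<nu> where "lip_change a \<nu>" "\<And>s. 0 \<le> s \<Longrightarrow> \<mu> (\<nu> s) = s" "\<And>s. 0 \<le> s \<Longrightarrow> \<nu> (\<mu> s) = s"
proof -
  obtain \<nu> where \<nu>: "time_change \<nu>" "\<And>s. 0 \<le> s \<Longrightarrow> 0 \<le> \<nu> s \<and> \<mu> (\<nu> s) = s"
      "\<And>s. 0 \<le> s \<Longrightarrow> \<nu> (\<mu> s) = s"
    using time_change_inverse[OF lip_change_time_change[OF assms]] by metis
  have "exp (- a) * (t - s) \<le> \<nu> t - \<nu> s \<and> \<nu> t - \<nu> s \<le> exp a * (t - s)" if st: "0 \<le> s" "s \<le> t" for s t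
  proof -
    have le: "\<nu> s \<le> \<nu> t"
      using \<nu>(1) st strict_mono_on_leD by (fastforce simp: time_change_def)
    have "exp (- a) * (\<nu> t - \<nu> s) \<le> t - s" "t - s \<le> exp a * (\<nu> t - \<nu> s)"
      using lip_changeD(3,4)[OF assms _ le] \<nu>(2)[of s] \<nu>(2)[of t] st by auto
    then show ?thesis
      by (simp add: exp_minus field_simps)
  qed
  moreover have "\<nu> 0 = 0" using \<nu>(3)[of 0] lip_changeD(1)[OF assms] by simp
  moreover have "\<bar>\<nu> s - s\<bar> \<le> a" if "0 \<le> s" for s
    using lip_changeD(2)[OF assms, of "\<nu> s"] \<nu>(2)[OF that] by simp
  ultimately have "lip_change a \<nu>" unfolding lip_change_def by blast
  then show thesis using that \<nu> by blast
qed

lemma lip_change_comp: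
  assumes f: "lip_change a f" and g: "lip_change b g"
  shows "lip_change (a + b) (g \<circ> f)"
  unfolding lip_change_def
proof (intro conjI allI impI)
  show "(g \<circ> f) 0 = 0" using f g by (simp add: lip_changeD)
  fix s :: real assume s: "0 \<le> s"
  show "\<bar>(g \<circ> f) s - s\<bar> \<le> a + b"
    using lip_changeD(2)[OF f s] lip_changeD(2)[OF g lip_change_nonneg[OF f s]] by simp
  fix t :: real assume t: "s \<le> t"
  have le: "f s \<le> f t"
    using lip_change_less[OF f s, of t] t by (cases "s = t") auto
  have "exp (- (a + b)) * (t - s) = exp (- b) * (exp (- a) * (t - s))"
    by (simp flip: exp_add)
  also have "\<dots> \<le> exp (- b) * (f t - f s)"
    using lip_changeD(3)[OF f s t] by simp
  also have "\<dots> \<le> (g \<circ> f) t - (g \<circ> f) s"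
    using lip_changeD(3)[OF g lip_change_nonneg[OF f s] le] by simp
  finally show "exp (- (a + b)) * (t - s) \<le> (g \<circ> f) t - (g \<circ> f) s" .
  have "(g \<circ> f) t - (g \<circ> f) s \<le> exp b * (f t - f s)"
    using lip_changeD(4)[OF g lip_change_nonneg[OF f s] le] by simp
  also have "\<dots> \<le> exp b * (exp a * (t - s))"
    using lip_changeD(4)[OF f s t] by simp
  also have "\<dots> = exp (a + b) * (t - s)"
    by (simp add: exp_add)
  finally show "(g \<circ> f) t - (g \<circ> f) s \<le> exp (a + b) * (t - s)" .
qed

lemma lip_change_mono:
  assumes "lip_change a f" "a \<le> b"
  shows "lip_change b f"
  unfolding lip_change_def
proof (intro conjI allI impI)
  fix s t :: real assume s: "0 \<le> s" "s \<le> t"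
  show "exp (- b) * (t - s) \<le> f t - f s"
    using lip_changeD(3)[OF assms(1) s] mult_right_mono[of "exp (- b)" "exp (- a)" "t - s"] assms(2) s
    by simp
  show "f t - f s \<le> exp b * (t - s)"
    using lip_changeD(4)[OF assms(1) s] mult_right_mono[of "exp a" "exp b" "t - s"] assms(2) s
    by simp
qed (use lip_changeD(1,2)[OF assms(1)] assms(2) in force)+

lemma lip_change_id: "lip_change 0 (\<lambda>s. s)"
  by (simp add: lip_change_def)

lemma lip_change_limit:
  assumes f: "\<And>n. lip_change a (f n)" and lim: "\<And>s. 0 \<le> s \<Longrightarrow> (\<lambda>n. f n s) \<longlonglongrightarrow> g s"
  shows "lip_change a g"
  unfolding lip_change_def
proof (intro conjI allI impI)
  show "g 0 = 0"
    using lim[of 0] lip_changeD(1)[OF f] by (simp add: LIMSEQ_const_iff)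
  fix s :: real assume s: "0 \<le> s"
  have "(\<lambda>n. \<bar>f n s - s\<bar>) \<longlonglongrightarrow> \<bar>g s - s\<bar>"
    by (intro tendsto_intros lim s)
  then show "\<bar>g s - s\<bar> \<le> a"
    by (rule LIMSEQ_le_const2) (use lip_changeD(2)[OF f s] in auto)
  fix t :: real assume t: "s \<le> t"
  have l: "(\<lambda>n. f n t - f n s) \<longlonglongrightarrow> g t - g s"
    by (intro tendsto_intros lim) (use s t in auto)
  show "exp (- a) * (t - s) \<le> g t - g s"
    by (rule LIMSEQ_le_const[OF l]) (use lip_changeD(3)[OF f s t] in auto)
  show "g t - g s \<le> exp a * (t - s)"
    by (rule LIMSEQ_le_const2[OF l]) (use lip_changeD(4)[OF f s t] in auto)
qed

text \<open>The time change is the identity plus a combination of hat functions centred at the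
  points \<open>a i\<close>, whose supports meet no other \<open>a j\<close>.\<close>

lemma lip_change_interpolation:
  fixes a b :: "'i \<Rightarrow> real" and \<delta> \<eta> \<kappa> :: real
  assumes "finite I" and \<delta>: "0 < \<delta>" and \<eta>: "0 \<le> \<eta>"
    and a: "\<And>i. i \<in> I \<Longrightarrow> \<delta> \<le> a i" "\<And>i j. i \<in> I \<Longrightarrow> j \<in> I \<Longrightarrow> i \<noteq> j \<Longrightarrow> \<delta> \<le> \<bar>a i - a j\<bar>"
    and b: "\<And>i. i \<in> I \<Longrightarrow> \<bar>b i - a i\<bar> \<le> \<kappa>"
    and \<kappa>: "card I * \<kappa> \<le> \<eta>" "card I * \<kappa> \<le> \<delta> * (1 - exp (- \<eta>))"
  shows "\<exists>\<mu>. lip_change \<eta> \<mu> \<and> (\<forall>i\<in>I. \<mu> (a i) = b i)"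
proof -
  define \<phi> where "\<phi> i s = max 0 (1 - \<bar>s - a i\<bar> / \<delta>)" for i s
  define \<mu> where "\<mu> s = s + (\<Sum>i\<in>I. (b i - a i) * \<phi> i s)" for s
  have \<phi>_bd: "\<bar>\<phi> i s\<bar> \<le> 1" for i s
    using \<delta> by (auto simp: \<phi>_def)
  have \<phi>_lip: "\<bar>\<phi> i t - \<phi> i s\<bar> \<le> \<bar>t - s\<bar> / \<delta>" for i s t
  proof -
    have "\<bar>\<phi> i t - \<phi> i s\<bar> \<le> \<bar>\<bar>s - a i\<bar> / \<delta> - \<bar>t - a i\<bar> / \<delta>\<bar>"
      unfolding \<phi>_def by linarith
    also have "\<dots> = \<bar>\<bar>s - a i\<bar> - \<bar>t - a i\<bar>\<bar> / \<delta>"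
      using \<delta> by (simp flip: diff_divide_distrib add: abs_divide)
    also have "\<dots> \<le> \<bar>t - s\<bar> / \<delta>"
      using \<delta> by (intro divide_right_mono) linarith+
    finally show ?thesis .
  qed
  have \<phi>_a: "\<phi> i (a j) = (if i = j then 1 else 0)" if "i \<in> I" "j \<in> I" for i j
    using a(2)[OF that(2,1)] \<delta> by (auto simp: \<phi>_def)
  have \<phi>_0: "\<phi> i 0 = 0" if "i \<in> I" for i
    using a(1)[OF that] \<delta> by (auto simp: \<phi>_def)
  \<comment> \<open>Neighbouring hats can overlap, so all terms are bounded at once; this is the
    factor \<open>card I\<close> in the hypotheses on \<kappa>.\<close>
  have bd: "\<bar>(\<Sum>i\<in>I. (b i - a i) * c i)\<bar> \<le> card I * \<kappa> * C"
    if "\<And>i. i \<in> I \<Longrightarrow> \<bar>c i\<bar> \<le> C" for c :: "'i \<Rightarrow> real" and C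
  proof -
    have "\<bar>(\<Sum>i\<in>I. (b i - a i) * c i)\<bar> \<le> (\<Sum>i\<in>I. \<kappa> * C :: real)"
      by (rule order_trans[OF sum_abs], rule sum_mono)
        (use b that in \<open>auto simp: abs_mult intro!: mult_mono order_trans[OF abs_ge_zero b]\<close>)
    then show ?thesis by simp
  qed
  have "lip_change \<eta> \<mu>"
    unfolding lip_change_def
  proof (intro conjI allI impI)
    show "\<mu> 0 = 0" by (simp add: \<mu>_def \<phi>_0)
    show "\<bar>\<mu> s - s\<bar> \<le> \<eta>" for s
      using bd[of "\<lambda>i. \<phi> i s" 1] \<phi>_bd \<kappa>(1) by (simp add: \<mu>_def)
    fix s t :: real assume st: "0 \<le> s" "s \<le> t"
    have "\<bar>(\<Sum>i\<in>I. (b i - a i) * (\<phi> i t - \<phi> i s))\<bar> \<le> card I * \<kappa> * ((t - s) / \<delta>)"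
      using \<phi>_lip[of _ t s] st by (intro bd) auto
    also have "\<dots> \<le> \<delta> * (1 - exp (- \<eta>)) * ((t - s) / \<delta>)"
      using \<delta> st by (intro mult_right_mono \<kappa>) auto
    also have "\<dots> = (1 - exp (- \<eta>)) * (t - s)" using \<delta> by simp
    finally have *: "\<bar>(\<Sum>i\<in>I. (b i - a i) * (\<phi> i t - \<phi> i s))\<bar> \<le> (1 - exp (- \<eta>)) * (t - s)" .
    have eq: "\<mu> t - \<mu> s = t - s + (\<Sum>i\<in>I. (b i - a i) * (\<phi> i t - \<phi> i s))"
      by (simp add: \<mu>_def sum_subtractf right_diff_distrib)
    show "exp (- \<eta>) * (t - s) \<le> \<mu> t - \<mu> s"
      using * unfolding eq by (simp add: algebra_simps abs_le_iff)
    \<comment> \<open>By convexity of the exponential, the Lipschitz bound chosen for the lower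
      slope also serves the upper one.\<close>
    have "1 - exp (- \<eta>) \<le> exp \<eta> - 1"
      using exp_ge_add_one_self[of \<eta>] exp_ge_add_one_self[of "- \<eta>"] by linarith
    then have "(1 - exp (- \<eta>)) * (t - s) \<le> (exp \<eta> - 1) * (t - s)"
      using st by (intro mult_right_mono) auto
    then show "\<mu> t - \<mu> s \<le> exp \<eta> * (t - s)"
      using * unfolding eq by (simp add: algebra_simps abs_le_iff)
  qed
  moreover have "\<mu> (a j) = b j" if j: "j \<in> I" for j
  proof -
    have "(\<Sum>i\<in>I. (b i - a i) * \<phi> i (a j)) = (\<Sum>i\<in>I. if i = j then b j - a j else 0)"
      by (intro sum.cong) (auto simp: \<phi>_a j)
    then show ?thesis using assms(1) j by (simp add: \<mu>_def)
  qed
  ultimately show ?thesis by blast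
qed

section \<open>Limits of fast Cauchy sequences of paths\<close>

lemma two_geometric_tendsto_0: "(\<lambda>n. 2 * (1/2 :: real) ^ n) \<longlonglongrightarrow> 0"
  by (rule tendsto_mult_right_zero, rule LIMSEQ_power_zero) simp

lemma geometric_dist_bound:
  fixes z :: "nat \<Rightarrow> 'a::metric_space"
  assumes "\<And>n. n0 \<le> n \<Longrightarrow> dist (z n) (z (Suc n)) \<le> (1/2) ^ n" "n0 \<le> n"
  shows "dist (z n) (z (n + k)) \<le> 2 * (1/2) ^ n - 2 * (1/2) ^ (n + k)"
proof (induction k)
  case (Suc k)
  have "dist (z n) (z (n + Suc k)) \<le> dist (z n) (z (n + k)) + dist (z (n + k)) (z (Suc (n + k)))"
    using dist_triangle by simp
  also have "\<dots> \<le> 2 * (1/2) ^ n - 2 * (1/2) ^ (n + k) + (1/2) ^ (n + k)"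
    using Suc.IH assms(1)[of "n + k"] assms(2) by linarith
  finally show ?case by simp
qed simp

lemma geometric_limit:
  fixes z :: "nat \<Rightarrow> 'a::metric_space"
  assumes S: "Topological_Spaces.complete S" and zS: "\<And>n. n0 \<le> n \<Longrightarrow> z n \<in> S"
    and z: "\<And>n. n0 \<le> n \<Longrightarrow> dist (z n) (z (Suc n)) \<le> (1/2) ^ n"
  shows "\<exists>l\<in>S. \<forall>n\<ge>n0. dist (z n) l \<le> 2 * (1/2) ^ n"
proof -
  have bd: "dist (z n) (z (n + k)) \<le> 2 * (1/2) ^ n" if "n0 \<le> n" for n k
    using geometric_dist_bound[of n0 z, OF z that, of k] zero_le_power[of "1/2 :: real" "n + k"] by linarith
  have "Cauchy (\<lambda>n. z (n0 + n))"
    unfolding Cauchy_altdef2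
  proof (intro allI impI)
    fix e :: real assume "0 < e"
    then obtain N where N: "(1/2) ^ N < e / 2"
      using real_arch_pow_inv[of "e / 2" "1/2"] by auto
    have "dist (z (n0 + n)) (z (n0 + N)) < e" if "N \<le> n" for n
    proof -
      have "dist (z (n0 + N)) (z (n0 + N + (n - N))) \<le> 2 * (1/2) ^ (n0 + N)"
        by (rule bd) simp
      also have "\<dots> \<le> 2 * (1/2) ^ N" by (simp add: power_add mult_le_cancel_right1 power_le_one)
      also have "\<dots> < e" using N by simp
      finally show ?thesis using that by (simp add: dist_commute)
    qed
    then show "\<exists>N. \<forall>n\<ge>N. dist (z (n0 + n)) (z (n0 + N)) < e" by blast
  qed
  then obtain l where l: "l \<in> S" "(\<lambda>n. z (n0 + n)) \<longlonglongrightarrow> l"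
    using S zS unfolding Real_Vector_Spaces.complete_def by (metis le_add1)
  have "dist (z n) l \<le> 2 * (1/2) ^ n" if "n0 \<le> n" for n
  proof -
    have "(\<lambda>k. z (n0 + (k + (n - n0)))) \<longlonglongrightarrow> l"
      using l(2) by (rule LIMSEQ_ignore_initial_segment)
    then have "(\<lambda>k. z (n + k)) \<longlonglongrightarrow> l"
      using that by (simp add: algebra_simps)
    then have "(\<lambda>k. dist (z n) (z (n + k))) \<longlonglongrightarrow> dist (z n) l"
      by (intro tendsto_intros)
    then show ?thesis
      by (rule LIMSEQ_le_const2) (use bd[OF that] in auto)
  qed
  then show ?thesis using l(1) by blast
qed

text \<open>The start is a real threshold, since the index from which the paths are controlled will
  depend on the time at which they are evaluated.\<close>

lemma geometric_limit_real:
  fixes z :: "nat \<Rightarrow> 'a::metric_space"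
  assumes "Topological_Spaces.complete S" and "\<And>n. c \<le> real n \<Longrightarrow> z n \<in> S"
    and "\<And>n. c \<le> real n \<Longrightarrow> dist (z n) (z (Suc n)) \<le> (1/2) ^ n"
  shows "\<exists>l\<in>S. \<forall>n. c \<le> real n \<longrightarrow> dist (z n) l \<le> 2 * (1/2) ^ n"
  using geometric_limit[OF assms(1), of "nat \<lceil>c\<rceil>" z] assms(2,3) by (simp add: nat_ceiling_le_eq)

text \<open>The filter has to stay on nonnegative times, because \<open>lip_change\<close> says
  nothing about the others.\<close>

lemma lip_change_tendsto:
  assumes \<mu>: "lip_change a \<mu>" and t: "0 \<le> t" and F: "F \<le> at t" "\<forall>\<^sub>F u in F. 0 \<le> u"
  shows "(\<mu> \<longlongrightarrow> \<mu> t) F"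
proof (rule metric_tendsto_imp_tendsto)
  show "((\<lambda>u. exp a * u) \<longlongrightarrow> exp a * t) F"
    by (rule tendsto_mono[OF F(1)]) (intro tendsto_intros)
  show "\<forall>\<^sub>F u in F. dist (\<mu> u) (\<mu> t) \<le> dist (exp a * u) (exp a * t)"
    using F(2)
  proof eventually_elim
    case (elim u)
    show ?case
      using lip_change_abs[OF \<mu> t elim] by (simp add: dist_real_def abs_mult flip: right_diff_distrib)
  qed
qed

lemma cadlag_right_tendsto: "x \<in> cadlag_paths S \<Longrightarrow> 0 \<le> t \<Longrightarrow> (x \<longlongrightarrow> x t) (at_right t)"
  by (simp add: cadlag_paths_def continuous_within)

lemma cadlag_comp_right:
  assumes x: "x \<in> cadlag_paths S" and \<mu>: "lip_change a \<mu>" and t: "0 \<le> t"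
  shows "((\<lambda>u. x (\<mu> u)) \<longlongrightarrow> x (\<mu> t)) (at_right t)"
proof -
  have "(\<mu> \<longlongrightarrow> \<mu> t) (at_right t)"
    by (rule lip_change_tendsto[OF \<mu> t at_le]) (use t in \<open>auto simp: eventually_at_right_field intro!: exI[of _ "t + 1"]\<close>)
  moreover have "\<forall>\<^sub>F u in at_right t. \<mu> u \<in> {\<mu> t<..} \<and> \<mu> u \<noteq> \<mu> t"
    using lip_change_less[OF \<mu> t] by (auto simp: eventually_at_right_field intro!: exI[of _ "t + 1"]) force
  ultimately have "filterlim \<mu> (at_right (\<mu> t)) (at_right t)"
    by (simp add: filterlim_at)
  then show ?thesis
    using cadlag_right_tendsto[OF x lip_change_nonneg[OF \<mu> t]] filterlim_compose by fastforce
qed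

lemma cadlag_comp_left:
  assumes x: "x \<in> cadlag_paths S" and \<mu>: "lip_change a \<mu>" and t: "0 < t"
  shows "\<exists>l\<in>S. ((\<lambda>u. x (\<mu> u)) \<longlongrightarrow> l) (at_left t)"
proof -
  have "0 < \<mu> t" using lip_change_less[OF \<mu> _ t] lip_changeD(1)[OF \<mu>] by simp
  then obtain l where l: "l \<in> S" "(x \<longlongrightarrow> l) (at_left (\<mu> t))"
    using x by (auto simp: cadlag_paths_def)
  have ev: "\<forall>\<^sub>F u in at_left t. 0 \<le> u \<and> u < t"
    using t by (auto simp: eventually_at_left_field intro!: exI[of _ 0])
  have "(\<mu> \<longlongrightarrow> \<mu> t) (at_left t)"
    by (rule lip_change_tendsto[OF \<mu> less_imp_le[OF t] at_le]) (use eventually_mono[OF ev] in auto)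
  moreover have "\<forall>\<^sub>F u in at_left t. \<mu> u \<in> {..<\<mu> t} \<and> \<mu> u \<noteq> \<mu> t"
    using ev by eventually_elim (use lip_change_less[OF \<mu>, of _ t] in force)
  ultimately have "filterlim \<mu> (at_left (\<mu> t)) (at_left t)"
    by (simp add: filterlim_at)
  then show ?thesis using l filterlim_compose by blast
qed

definition lip_close :: "real \<Rightarrow> real \<Rightarrow> (real \<Rightarrow> 'a::metric_space) \<Rightarrow> (real \<Rightarrow> 'a) \<Rightarrow> bool" where
  "lip_close N \<epsilon> x y \<longleftrightarrow> (\<exists>\<mu>. lip_change \<epsilon> \<mu> \<and> (\<forall>s\<in>{0..N}. dist (y (\<mu> s)) (x s) \<le> \<epsilon>))"

text \<open>\<open>\<nu> n\<close> is the infinite composition of \<open>\<mu> n\<close>,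
  \<open>\<mu> (n + 1)\<close> and so on, which carries the clock of the n-th path to a common
  limiting clock. The parameters form a geometric series, so the partial compositions converge with
  uniform slope bounds.\<close>

lemma lip_close_chain_changes:
  fixes \<mu> :: "nat \<Rightarrow> real \<Rightarrow> real"
  assumes \<mu>: "\<And>n. lip_change ((1/2) ^ n) (\<mu> n)"
  shows "\<exists>\<nu>. (\<forall>n. lip_change (2 * (1/2) ^ n) (\<nu> n)) \<and> (\<forall>n s. 0 \<le> s \<longrightarrow> \<nu> (Suc n) (\<mu> n s) = \<nu> n s)"
proof -
  define c where "c n = rec_nat (\<lambda>s. s) (\<lambda>m f. \<mu> (n + m) \<circ> f)" for n
  have c0: "c n 0 = (\<lambda>s. s)" and cS: "c n (Suc m) = \<mu> (n + m) \<circ> c n m" for n m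
    by (simp_all add: c_def)
  \<comment> \<open>The parameter is the partial sum of \<open>(1/2) ^ i\<close> over
    \<open>n \<le> i < n + m\<close>.\<close>
  have lip: "lip_change (2 * (1/2) ^ n - 2 * (1/2) ^ (n + m)) (c n m)" for n m
  proof (induction m)
    case 0
    show ?case by (simp add: c0 lip_change_id)
  next
    case (Suc m)
    from lip_change_comp[OF Suc.IH \<mu>[of "n + m"]] show ?case by (simp add: cS comp_def)
  qed
  have lip2: "lip_change (2 * (1/2) ^ n) (c n m)" for n m
    by (rule lip_change_mono[OF lip]) simp
  have shift: "c n (Suc m) s = c (Suc n) m (\<mu> n s)" for n m s
    by (induction m) (simp_all add: c0 cS)
  have "\<exists>l. (\<lambda>m. c n m s) \<longlonglongrightarrow> l" if s: "0 \<le> s" for n s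
  proof -
    have "\<exists>l\<in>UNIV. \<forall>m\<ge>0. dist (c n m s) l \<le> 2 * (1/2) ^ m"
    proof (rule geometric_limit)
      fix m
      have "dist (c n m s) (c n (Suc m) s) \<le> (1/2) ^ (n + m)"
        using lip_changeD(2)[OF \<mu>[of "n + m"] lip_change_nonneg[OF lip s, of n m]]
        by (simp add: cS dist_real_def abs_minus_commute)
      also have "\<dots> \<le> (1/2) ^ m" by (simp add: power_add mult_le_cancel_right1 power_le_one)
      finally show "dist (c n m s) (c n (Suc m) s) \<le> (1/2) ^ m" .
    qed (simp_all add: complete_UNIV)
    then obtain l where l: "\<And>m. dist (c n m s) l \<le> 2 * (1/2) ^ m" by auto
    have "(\<lambda>m. c n m s) \<longlonglongrightarrow> l"
      using two_geometric_tendsto_0 by (rule metric_tendsto_imp_tendsto) (use l in \<open>auto simp: dist_real_def\<close>)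
    then show ?thesis by blast
  qed
  then have "convergent (\<lambda>m. c n m s)" if "0 \<le> s" for n s
    using that by (simp add: convergent_def)
  then have \<nu>': "(\<lambda>m. c n m s) \<longlonglongrightarrow> lim (\<lambda>m. c n m s)" if "0 \<le> s" for n s
    using that by (simp add: convergent_LIMSEQ_iff)
  define \<nu> where "\<nu> n s = lim (\<lambda>m. c n m s)" for n s
  have \<nu>: "(\<lambda>m. c n m s) \<longlonglongrightarrow> \<nu> n s" if "0 \<le> s" for n s
    unfolding \<nu>_def using \<nu>' that by simp
  have "lip_change (2 * (1/2) ^ n) (\<nu> n)" for n
    by (rule lip_change_limit[OF lip2 \<nu>])
  \<comment> \<open>The composition of \<open>m + 1\<close> factors from \<open>n\<close> on is that
    of \<open>m\<close> factors from \<open>n + 1\<close> on, after \<open>\<mu> n\<close>; now let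
    \<open>m\<close> tend to infinity.\<close>
  moreover have "\<nu> (Suc n) (\<mu> n s) = \<nu> n s" if "0 \<le> s" for n s
    using LIMSEQ_Suc[OF \<nu>[OF that, of n]] \<nu>[OF lip_change_nonneg[OF \<mu> that], of "Suc n" n]
    by (simp add: shift LIMSEQ_unique)
  ultimately show ?thesis by blast
qed

text \<open>Read on the limiting clock, through the inverses \<open>\<theta> n\<close> of
  \<open>\<nu> n\<close>, consecutive paths differ by at most \<open>(1/2) ^ n\<close> once
  \<open>n\<close> is large compared with the time. They converge uniformly on bounded intervals,
  and such limits inherit one-sided limits.\<close>

lemma lip_close_chain_limit:
  fixes g :: "nat \<Rightarrow> real \<Rightarrow> 'a::metric_space"
  assumes S: "Topological_Spaces.complete S" and g: "\<And>n. g n \<in> cadlag_paths S"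
    and close: "\<And>n. lip_close (real n) ((1/2) ^ n) (g n) (g (Suc n))"
  shows "\<exists>y\<in>cadlag_paths S. J1_limit g y"
proof -
  obtain \<mu> where \<mu>: "\<And>n. lip_change ((1/2) ^ n) (\<mu> n)"
      "\<And>n s. s \<in> {0..real n} \<Longrightarrow> dist (g (Suc n) (\<mu> n s)) (g n s) \<le> (1/2) ^ n"
    using close unfolding lip_close_def by metis
  obtain \<nu> where \<nu>: "\<And>n. lip_change (2 * (1/2) ^ n) (\<nu> n)"
      "\<And>n s. 0 \<le> s \<Longrightarrow> \<nu> (Suc n) (\<mu> n s) = \<nu> n s"
    using lip_close_chain_changes[of \<mu>, OF \<mu>(1)] by blast
  have "\<exists>\<theta>. lip_change (2 * (1/2) ^ n) \<theta> \<and> (\<forall>s\<ge>0. \<nu> n (\<theta> s) = s \<and> \<theta> (\<nu> n s) = s)" for n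
    using lip_change_inverse[OF \<nu>(1)[of n]] by metis
  then obtain \<theta> where \<theta>: "\<And>n. lip_change (2 * (1/2) ^ n) (\<theta> n)"
      "\<And>n s. 0 \<le> s \<Longrightarrow> \<nu> n (\<theta> n s) = s" "\<And>n s. 0 \<le> s \<Longrightarrow> \<theta> n (\<nu> n s) = s" by metis
  \<comment> \<open>Each \<open>\<theta> n\<close> moves times by at most 2, so
    \<open>u + 2 \<le> n\<close> keeps \<open>\<theta> n u\<close> within the horizon of the n-th
    closeness.\<close>
  have pow: "2 * (1/2 :: real) ^ n \<le> 2" for n by (simp add: power_le_one)
  have step: "dist (g n (\<theta> n u)) (g (Suc n) (\<theta> (Suc n) u)) \<le> (1/2) ^ n"
    if u: "0 \<le> u" "u + 2 \<le> real n" for n u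
  proof -
    have nn: "0 \<le> \<theta> n u" by (rule lip_change_nonneg[OF \<theta>(1) u(1)])
    have "u = \<nu> (Suc n) (\<mu> n (\<theta> n u))"
      using \<nu>(2)[OF nn, of n] \<theta>(2)[OF u(1), of n] by simp
    then have "\<theta> (Suc n) u = \<mu> n (\<theta> n u)"
      using \<theta>(3)[OF lip_change_nonneg[OF \<mu>(1)[of n] nn], of "Suc n"] by simp
    moreover have "\<theta> n u \<in> {0..real n}"
      using nn lip_changeD(2)[OF \<theta>(1) u(1), of n] pow[of n] u(2) by auto
    ultimately show ?thesis using \<mu>(2)[of "\<theta> n u" n] by (simp add: dist_commute)
  qed
  have gS: "g n u \<in> S" if "0 \<le> u" for n u
    using g[of n] that by (auto simp: cadlag_paths_def)
  have "\<exists>l\<in>S. \<forall>n. u + 2 \<le> real n \<longrightarrow> dist (g n (\<theta> n u)) l \<le> 2 * (1/2) ^ n" if u: "0 \<le> u" for u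
    by (rule geometric_limit_real[OF S]) (use gS lip_change_nonneg[OF \<theta>(1) u] step[OF u] in auto)
  then obtain y0 where y0: "\<And>u. 0 \<le> u \<Longrightarrow> y0 u \<in> S"
      "\<And>u n. 0 \<le> u \<Longrightarrow> u + 2 \<le> real n \<Longrightarrow> dist (g n (\<theta> n u)) (y0 u) \<le> 2 * (1/2) ^ n" by metis
  define y where "y = restrict y0 {0..}"
  have yS: "y u \<in> S" if "0 \<le> u" for u using y0(1) that by (simp add: y_def)
  have yd: "dist (g n (\<theta> n u)) (y u) \<le> 2 * (1/2) ^ n" if "0 \<le> u" "u + 2 \<le> real n" for u n
    using y0(2)[of u n] that by (simp add: y_def)
  have small_ev: "\<forall>\<^sub>F n in sequentially. c \<le> real n \<and> 2 * (1/2) ^ n < e" if "0 < e" for c e :: real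
  proof (rule eventually_conj)
    show "\<forall>\<^sub>F n in sequentially. c \<le> real n"
      using filterlim_real_sequentially by (simp add: filterlim_at_top)
    show "\<forall>\<^sub>F n in sequentially. 2 * (1/2) ^ n < e"
      by (rule order_tendstoD(2)[OF two_geometric_tendsto_0 that])
  qed
  have small: "\<exists>n. c \<le> real n \<and> 2 * (1/2) ^ n < e" if "0 < e" for c e :: real
    by (rule eventually_happens'[OF sequentially_bot small_ev[OF that]])
  \<comment> \<open>Interchange of limits: the bound \<open>c\<close> on the times lets a single
    \<open>n\<close> approximate \<open>y\<close> at all times near the limit point.\<close>
  have unif: "(y \<longlongrightarrow> l) F"
    if F: "\<forall>\<^sub>F u in F. 0 \<le> u \<and> u \<le> c" and ln: "\<And>n. ((\<lambda>u. g n (\<theta> n u)) \<longlongrightarrow> ll n) F"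
      and ll: "\<And>n. c + 2 \<le> real n \<Longrightarrow> dist (ll n) l \<le> 2 * (1/2) ^ n" for F c l ll
  proof (rule tendstoI)
    fix e :: real assume e: "0 < e"
    obtain n where n: "c + 2 \<le> real n" "2 * (1/2) ^ n < e / 3"
      using small[of "e / 3" "c + 2"] e by auto
    have "\<forall>\<^sub>F u in F. dist (g n (\<theta> n u)) (ll n) < e / 3"
      by (rule tendstoD[OF ln]) (use e in simp)
    then show "\<forall>\<^sub>F u in F. dist (y u) l < e"
      using F
    proof eventually_elim
      case (elim u)
      have "dist (y u) (ll n) \<le> dist (g n (\<theta> n u)) (y u) + dist (g n (\<theta> n u)) (ll n)"
        by (metis dist_commute dist_triangle)
      moreover have "dist (y u) l \<le> dist (y u) (ll n) + dist (ll n) l"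
        by (rule dist_triangle)
      moreover have "dist (g n (\<theta> n u)) (y u) \<le> 2 * (1/2) ^ n"
        by (rule yd) (use elim n in auto)
      ultimately show ?case using elim ll[OF n(1)] n(2) by linarith
    qed
  qed
  have right: "continuous (at_right t) y" if t: "0 \<le> t" for t
    unfolding continuous_within
  proof (rule unif[where c = "t + 1" and ll = "\<lambda>n. g n (\<theta> n t)"])
    show "\<forall>\<^sub>F u in at_right t. 0 \<le> u \<and> u \<le> t + 1"
      using t by (auto simp: eventually_at_right_field intro!: exI[of _ "t + 1"])
    show "((\<lambda>u. g n (\<theta> n u)) \<longlongrightarrow> g n (\<theta> n t)) (at_right t)" for n
      by (rule cadlag_comp_right[OF g \<theta>(1) t])
    show "dist (g n (\<theta> n t)) (y t) \<le> 2 * (1/2) ^ n" if "t + 1 + 2 \<le> real n" for n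
      by (rule yd) (use that t in auto)
  qed
  have left: "\<exists>l\<in>S. (y \<longlongrightarrow> l) (at_left t)" if t: "0 < t" for t
  proof -
    have ev: "\<forall>\<^sub>F u in at_left t. 0 \<le> u \<and> u \<le> t"
      using t by (auto simp: eventually_at_left_field intro!: exI[of _ 0])
    have "\<exists>l\<in>S. ((\<lambda>u. g n (\<theta> n u)) \<longlongrightarrow> l) (at_left t)" for n
      by (rule cadlag_comp_left[OF g \<theta>(1) t])
    then obtain ll where ll: "\<And>n. ll n \<in> S" "\<And>n. ((\<lambda>u. g n (\<theta> n u)) \<longlongrightarrow> ll n) (at_left t)" by metis
    \<comment> \<open>The left limits of the approximating paths inherit the bound on consecutive
      differences, so they converge too.\<close>
    have "\<exists>l\<in>S. \<forall>n. t + 2 \<le> real n \<longrightarrow> dist (ll n) l \<le> 2 * (1/2) ^ n"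
    proof (rule geometric_limit_real[OF S])
      fix n assume n: "t + 2 \<le> real n"
      have "((\<lambda>u. dist (g n (\<theta> n u)) (g (Suc n) (\<theta> (Suc n) u))) \<longlongrightarrow> dist (ll n) (ll (Suc n))) (at_left t)"
        by (intro tendsto_intros ll)
      then show "dist (ll n) (ll (Suc n)) \<le> (1/2) ^ n"
      proof (rule tendsto_upperbound)
        show "\<forall>\<^sub>F u in at_left t. dist (g n (\<theta> n u)) (g (Suc n) (\<theta> (Suc n) u)) \<le> (1/2) ^ n"
          using ev by eventually_elim (use n in \<open>auto intro!: step\<close>)
      qed simp
    qed (use ll in auto)
    then obtain l where l: "l \<in> S" "\<And>n. t + 2 \<le> real n \<Longrightarrow> dist (ll n) l \<le> 2 * (1/2) ^ n"
      by blast
    then show ?thesis using unif[OF ev ll(2) l(2)] by blast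
  qed
  have yD: "y \<in> cadlag_paths S"
    using yS right left by (auto simp: cadlag_paths_def y_def)
  have "J1_limit g y"
    unfolding J1_limit_def
  proof (intro allI impI)
    fix N \<epsilon> :: real assume \<epsilon>: "0 < \<epsilon>"
    show "\<forall>\<^sub>F n in sequentially. J1_close N \<epsilon> y (g n)"
      using small_ev[OF \<epsilon>, of "N + 2"]
    proof eventually_elim
      case (elim n)
      have "\<bar>\<theta> n s - s\<bar> < \<epsilon> \<and> dist (g n (\<theta> n s)) (y s) < \<epsilon>" if "s \<in> {0..N}" for s
        using that lip_changeD(2)[OF \<theta>(1), of s n] yd[of s n] elim by auto
      then show ?case
        using lip_change_time_change[OF \<theta>(1)] unfolding J1_close_def by blast
    qed
  qed
  then show ?thesis using yD by blast
qed

text \<open>A bound for Skorohod's modulus with mesh \<delta>, on the whole half line at once. The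
  cells are half open so that large jumps may sit at grid points; for positive \<delta> the grid
  points tend to infinity.\<close>

definition osc_grid :: "real \<Rightarrow> real \<Rightarrow> (real \<Rightarrow> 'a::metric_space) \<Rightarrow> bool" where
  "osc_grid e \<delta> x \<longleftrightarrow> (\<exists>t::nat \<Rightarrow> real. t 0 = 0 \<and> (\<forall>i. t i + \<delta> \<le> t (Suc i)) \<and>
     (\<forall>i. \<forall>s\<in>{t i..<t (Suc i)}. dist (x s) (x (t i)) \<le> e))"

lemma grid_ge:
  fixes t :: "nat \<Rightarrow> real"
  assumes "\<And>i. t i + \<delta> \<le> t (Suc i)"
  shows "t i + real k * \<delta> \<le> t (i + k)"
proof (induction k)
  case (Suc k)
  then show ?case using assms[of "i + k"] by (simp add: algebra_simps)
qed simp

text \<open>Grid points beyond the horizon could be arbitrarily far away, which would give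
  infinitely many classes of paths. The cap \<open>N + i * \<delta>\<close> grows fast enough to
  preserve the gaps and changes no point below \<open>N\<close>.\<close>

lemma osc_grid_capped:
  assumes "osc_grid e \<delta> x" and \<delta>: "0 < \<delta>" and N: "0 \<le> N"
  shows "\<exists>t::nat \<Rightarrow> real. t 0 = 0 \<and> (\<forall>i. t i + \<delta> \<le> t (Suc i)) \<and> (\<forall>i. t i \<le> N + real i * \<delta>) \<and>
     (\<forall>i. \<forall>s\<in>{t i..<t (Suc i)}. s < N \<longrightarrow> dist (x s) (x (t i)) \<le> e)"
proof -
  obtain t :: "nat \<Rightarrow> real" where t: "t 0 = 0" "\<And>i. t i + \<delta> \<le> t (Suc i)"
      "\<And>i s. s \<in> {t i..<t (Suc i)} \<Longrightarrow> dist (x s) (x (t i)) \<le> e"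
    using assms(1) unfolding osc_grid_def by blast
  define u where "u i = min (t i) (N + real i * \<delta>)" for i
  have "u i + \<delta> \<le> u (Suc i)" for i
    using t(2)[of i] by (simp add: u_def algebra_simps min_def)
  moreover have "dist (x s) (x (u i)) \<le> e" if s: "s \<in> {u i..<u (Suc i)}" "s < N" for i s
  proof -
    have i0: "0 \<le> real i * \<delta>" using \<delta> by simp
    \<comment> \<open>A cell that contains a time before \<open>N\<close> starts before
      \<open>N\<close>, where the cap has no effect.\<close>
    have "u i = t i" using s i0 by (auto simp: u_def min_def split: if_splits)
    then show ?thesis using t(3)[of s i] s by (simp add: u_def)
  qed
  ultimately show ?thesis using t(1) N by (intro exI[of _ u]) (auto simp: u_def)
qed

text \<open>Paths are classified by their grid points up to \<open>\<kappa>\<close> and their values there up to \<open>e\<close>.\<close>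

lemma osc_grid_finite_classes:
  fixes S :: "'a::metric_space set"
  assumes S: "compact S" and \<delta>: "0 < \<delta>" and \<eta>: "0 < \<eta>" "\<eta> \<le> 1" and N: "0 \<le> N" and e: "0 < e" "4 * e \<le> \<eta>"
  shows "\<exists>c :: (real \<Rightarrow> 'a) \<Rightarrow> (int \<times> 'a) list.
    finite (c ` {x \<in> cadlag_paths S. osc_grid e \<delta> x}) \<and>
    (\<forall>x y. x \<in> cadlag_paths S \<longrightarrow> osc_grid e \<delta> x \<longrightarrow> y \<in> cadlag_paths S \<longrightarrow> osc_grid e \<delta> y \<longrightarrow>
       c x = c y \<longrightarrow> lip_close N \<eta> x y)"
proof -
  \<comment> \<open>The time change may move \<open>N\<close> to \<open>N + 1\<close>, since \<eta>
    is at most 1; the oscillation bound is needed for times strictly below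
    \<open>N'\<close>.\<close>
  define N' where "N' = N + 2"
  let ?K = "{x \<in> cadlag_paths S. osc_grid e \<delta> x}"
  define grid where "grid x t \<longleftrightarrow> t 0 = (0::real) \<and> (\<forall>i::nat. t i + \<delta> \<le> t (Suc i)) \<and> (\<forall>i. t i \<le> N' + real i * \<delta>) \<and>
     (\<forall>i. \<forall>s\<in>{t i..<t (Suc i)}. s < N' \<longrightarrow> dist (x s) (x (t i)) \<le> e)" for x :: "real \<Rightarrow> 'a" and t
  have "\<exists>t. grid x t" if "x \<in> ?K" for x
    using osc_grid_capped[of e \<delta> x N'] that \<delta> N by (simp add: N'_def grid_def)
  then have "\<exists>T. \<forall>x\<in>?K. grid x (T x)"
    by (intro bchoice ballI)
  then obtain T where T': "\<forall>x\<in>?K. grid x (T x)"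
    by (rule exE)
  have T: "T x 0 = 0" "T x i + \<delta> \<le> T x (Suc i)" "T x i \<le> N' + real i * \<delta>"
      "s \<in> {T x i..<T x (Suc i)} \<Longrightarrow> s < N' \<Longrightarrow> dist (x s) (x (T x i)) \<le> e" if "x \<in> ?K" for x i s
    using bspec[OF T' that] by (simp_all add: grid_def)
  have T0: "0 \<le> T x i" if "x \<in> ?K" for x i
  proof -
    have "0 \<le> real i * \<delta>" using \<delta> by simp
    also have "\<dots> \<le> T x i" using grid_ge[of "T x" \<delta> 0 i, OF T(2)[OF that]] T(1)[OF that] by simp
    finally show ?thesis .
  qed
  obtain F where F: "finite F" "F \<subseteq> S" "S \<subseteq> (\<Union>z\<in>F. ball z e)"
    using seq_compact_imp_totally_bounded[OF compact_imp_seq_compact[OF S], rule_format, OF e(1)]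
    by (elim exE conjE)
  define q where "q v = (SOME z. z \<in> F \<and> dist z v < e)" for v
  have q: "q v \<in> F \<and> dist (q v) v < e" if "v \<in> S" for v
    unfolding q_def by (rule someI_ex) (use subsetD[OF F(3) that] in auto)
  \<comment> \<open>By the lower bound on the mesh, the first \<open>k\<close> cells cover the
    extended horizon.\<close>
  obtain k :: nat where k: "N' \<le> real k * \<delta>"
    using reals_Archimedean3[OF \<delta>] less_imp_le by blast
  \<comment> \<open>At most \<open>k\<close> grid points are moved, each by at most \<kappa>; the
    minimum is what \<open>lip_change_interpolation\<close> allows in total.\<close>
  define \<kappa> where "\<kappa> = min \<eta> (\<delta> * (1 - exp (- \<eta>))) / (real k + 1)"
  have \<kappa>: "0 < \<kappa>" "real k * \<kappa> \<le> \<eta>" "real k * \<kappa> \<le> \<delta> * (1 - exp (- \<eta>))"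
  proof -
    define m where "m = min \<eta> (\<delta> * (1 - exp (- \<eta>)))"
    have m: "0 < m" "m \<le> \<eta>" "m \<le> \<delta> * (1 - exp (- \<eta>))" using \<eta> \<delta> by (auto simp: m_def)
    have \<kappa>m: "\<kappa> = m / (real k + 1)" by (simp only: \<kappa>_def m_def)
    show "0 < \<kappa>" using m(1) by (simp add: \<kappa>m)
    have "real k * \<kappa> \<le> m" using m(1) by (simp add: \<kappa>m field_simps)
    then show "real k * \<kappa> \<le> \<eta>" "real k * \<kappa> \<le> \<delta> * (1 - exp (- \<eta>))" using m by linarith+
  qed
  define c where "c x = map (\<lambda>i. (\<lfloor>T x i / \<kappa>\<rfloor>, q (x (T x i)))) [0..<Suc k]" for x
  have "finite (c ` ?K)"
  proof (rule finite_subset)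
    let ?A = "{0..\<lfloor>(N' + real k * \<delta>) / \<kappa>\<rfloor>} \<times> F"
    show "finite {xs. set xs \<subseteq> ?A \<and> length xs = Suc k}"
      by (rule finite_lists_length_eq) (use F in auto)
    show "c ` ?K \<subseteq> {xs. set xs \<subseteq> ?A \<and> length xs = Suc k}"
    proof (intro image_subsetI CollectI conjI subsetI)
      fix x p assume x: "x \<in> ?K" and p: "p \<in> set (c x)"
      then obtain i where i: "i \<le> k" "p = (\<lfloor>T x i / \<kappa>\<rfloor>, q (x (T x i)))"
        by (auto simp: c_def less_Suc_eq_le simp del: upt_Suc)
      have "real i * \<delta> \<le> real k * \<delta>" using i \<delta> by simp
      then have "T x i \<le> N' + real k * \<delta>" using T(3)[OF x, of i] by linarith
      then have "\<lfloor>T x i / \<kappa>\<rfloor> \<le> \<lfloor>(N' + real k * \<delta>) / \<kappa>\<rfloor>"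
        using \<kappa>(1) by (intro floor_mono divide_right_mono) auto
      moreover have "0 \<le> T x i / \<kappa>" using T0[OF x, of i] \<kappa>(1) by simp
      moreover have "x (T x i) \<in> S" using x T0[OF x, of i] by (auto simp: cadlag_paths_def)
      ultimately show "p \<in> ?A" using q i(2) by simp
    qed (simp add: c_def)
  qed
  moreover have "lip_close N \<eta> x y" if x: "x \<in> ?K" and y: "y \<in> ?K" and eq: "c x = c y" for x y
  proof -
    have eqi: "\<lfloor>T x i / \<kappa>\<rfloor> = \<lfloor>T y i / \<kappa>\<rfloor>" "q (x (T x i)) = q (y (T y i))" if "i \<le> k" for i
      using arg_cong[OF eq, of "\<lambda>l. l ! i"] that by (simp_all add: c_def del: upt_Suc)
    have near: "\<bar>T y i - T x i\<bar> \<le> \<kappa>" if "i \<le> k" for i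
    proof -
      have "\<bar>T y i / \<kappa> - T x i / \<kappa>\<bar> \<le> 1"
        using eqi(1)[OF that] by linarith
      then show ?thesis using \<kappa>(1) by (simp add: field_simps abs_le_iff flip: diff_divide_distrib)
    qed
    have gap: "\<delta> \<le> \<bar>T x i - T x j\<bar>" if "i < j" for i j
    proof -
      have "T x i + real (j - i) * \<delta> \<le> T x j"
        using grid_ge[of "T x" \<delta> i "j - i", OF T(2)[OF x]] that by simp
      moreover have "1 * \<delta> \<le> real (j - i) * \<delta>" using that \<delta> by (intro mult_right_mono) auto
      ultimately show ?thesis by simp
    qed
    \<comment> \<open>The grid point with index 0 is left out, because it is 0 and every
      \<open>lip_change\<close> fixes 0.\<close>
    have "\<exists>\<mu>. lip_change \<eta> \<mu> \<and> (\<forall>i\<in>{1..k}. \<mu> (T x i) = T y i)"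
    proof (rule lip_change_interpolation)
      fix i assume "i \<in> {1..k}"
      then show "\<delta> \<le> T x i" using gap[of 0 i] T(1)[OF x] T0[OF x, of i] by simp
      show "\<bar>T y i - T x i\<bar> \<le> \<kappa>" using near \<open>i \<in> {1..k}\<close> by simp
    next
      fix i j :: nat assume "i \<noteq> j"
      then show "\<delta> \<le> \<bar>T x i - T x j\<bar>"
        using gap[of i j] gap[of j i] by (cases "i < j") (auto simp: abs_minus_commute)
    qed (use \<kappa> \<delta> \<eta> in auto)
    then obtain \<mu> where \<mu>: "lip_change \<eta> \<mu>" "\<And>i. i \<in> {1..k} \<Longrightarrow> \<mu> (T x i) = T y i" by blast
    have \<mu>i: "\<mu> (T x i) = T y i" if "i \<le> k" for i
      using \<mu>(2)[of i] that lip_changeD(1)[OF \<mu>(1)] T(1)[OF x] T(1)[OF y] by (cases "i = 0") auto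
    have "dist (y (\<mu> s)) (x s) \<le> \<eta>" if s: "s \<in> {0..N}" for s
    proof -
      have sN: "s < T x k"
        using grid_ge[of "T x" \<delta> 0 k, OF T(2)[OF x]] T(1)[OF x] k s by (simp add: N'_def)
      define j where "j = (LEAST j. s < T x j)"
      have j: "s < T x j" "j \<le> k"
        using LeastI[of "\<lambda>j. s < T x j", OF sN] Least_le[of "\<lambda>j. s < T x j", OF sN] by (simp_all add: j_def)
      obtain i where i: "j = Suc i"
        using j(1) T(1)[OF x] s by (cases j) auto
      have "\<not> s < T x i"
        using not_less_Least[of i "\<lambda>j. s < T x j"] i by (simp add: j_def)
      then have si: "s \<in> {T x i..<T x (Suc i)}" "i \<le> k" "Suc i \<le> k" using j i by auto
      have "\<mu> (T x i) \<le> \<mu> s" "\<mu> s < \<mu> (T x (Suc i))"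
        using lip_change_less[OF \<mu>(1), of "T x i" s] lip_change_less[OF \<mu>(1), of s "T x (Suc i)"]
          T0[OF x, of i] s si(1) by (cases "T x i = s"; auto)+
      then have \<mu>s: "\<mu> s \<in> {T y i..<T y (Suc i)}" using \<mu>i si by simp
      have "\<bar>\<mu> s - s\<bar> \<le> \<eta>" using lip_changeD(2)[OF \<mu>(1)] s by simp
      then have "\<mu> s < N'" using s \<eta>(2) by (auto simp: N'_def)
      then have 1: "dist (y (\<mu> s)) (y (T y i)) \<le> e" by (intro T(4)[OF y \<mu>s]) simp
      have 2: "dist (x s) (x (T x i)) \<le> e" by (intro T(4)[OF x si(1)]) (use s in \<open>simp add: N'_def\<close>)
      have "x (T x i) \<in> S" "y (T y i) \<in> S"
        using x y T0[OF x, of i] T0[OF y, of i] by (auto simp: cadlag_paths_def)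
      then have 3: "dist (y (T y i)) (x (T x i)) \<le> e + e"
        using q[of "x (T x i)"] q[of "y (T y i)"] eqi(2)[OF si(2)]
          dist_triangle3[of "y (T y i)" "x (T x i)" "q (x (T x i))"] by auto
      \<comment> \<open>One \<open>e\<close> for the oscillation of \<open>y\<close>, two for the
        distances to the common net point and one for the oscillation of \<open>x\<close>: this is
        why \<open>4 * e \<le> \<eta>\<close>.\<close>
      have "dist (y (\<mu> s)) (x s) \<le> dist (y (\<mu> s)) (y (T y i)) + dist (y (T y i)) (x s)"
        by (rule dist_triangle)
      also have "dist (y (T y i)) (x s) \<le> dist (y (T y i)) (x (T x i)) + dist (x (T x i)) (x s)"
        by (rule dist_triangle)
      finally show ?thesis using 1 2 3 e(2) by (simp add: dist_commute)
    qed
    then show ?thesis using \<mu>(1) unfolding lip_close_def by blast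
  qed
  ultimately show ?thesis by (intro exI[of _ c]) simp
qed

lemma finite_image_constant_subseq:
  fixes f :: "nat \<Rightarrow> 'a"
  assumes "finite (range f)"
  shows "\<exists>r::nat \<Rightarrow> nat. strict_mono r \<and> (\<forall>m n. f (r m) = f (r n))"
proof -
  obtain n0 where n0: "infinite {n \<in> UNIV. f n = f n0}"
    using pigeonhole_infinite[of "UNIV :: nat set" f] assms by auto
  then obtain r :: "nat \<Rightarrow> nat" where "strict_mono r" "\<And>n. r n \<in> {n. f n = f n0}"
    using infinite_enumerate[of "{n. f n = f n0}"] by auto
  then show ?thesis by (intro exI[of _ r]) auto
qed

text \<open>At each level \<open>j\<close> the paths fall into finitely many classes, so the
  pigeonhole principle refines a sequence to one with pairwise \<open>(1/2) ^ j\<close>-close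
  members. The diagonal sequence is then a fast Cauchy chain. The oscillation is a quarter of the
  closeness, as \<open>osc_grid_finite_classes\<close> demands.\<close>

theorem osc_grid_compactin:
  fixes S :: "'a::metric_space set" and \<delta> :: "nat \<Rightarrow> real"
  assumes S: "compact S" and \<delta>: "\<And>j. 0 < \<delta> j"
  shows "compactin (J1_topology S) ((J1_topology S) closure_of
    {x \<in> cadlag_paths S. \<forall>j. osc_grid ((1/2) ^ j / 4) (\<delta> j) x})"
proof (rule J1_compactin_closure)
  let ?K = "{x \<in> cadlag_paths S. \<forall>j. osc_grid ((1/2) ^ j / 4) (\<delta> j) x}"
  show "?K \<subseteq> cadlag_paths S" by blast
  fix f :: "nat \<Rightarrow> real \<Rightarrow> 'a" assume f: "range f \<subseteq> ?K"
  define P where "P j s \<longleftrightarrow> (\<forall>m n. lip_close (real j) ((1/2) ^ j) (f (s m)) (f (s n)))" for j and s :: "nat \<Rightarrow> nat"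
  interpret subseqs P
  proof
    fix j and s :: "nat \<Rightarrow> nat" assume "strict_mono s"
    let ?Kj = "{x \<in> cadlag_paths S. osc_grid ((1/2) ^ j / 4) (\<delta> j) x}"
    obtain c :: "(real \<Rightarrow> 'a) \<Rightarrow> (int \<times> 'a) list" where c: "finite (c ` ?Kj)"
        "\<And>x y. x \<in> ?Kj \<Longrightarrow> y \<in> ?Kj \<Longrightarrow> c x = c y \<Longrightarrow> lip_close (real j) ((1/2) ^ j) x y"
      using osc_grid_finite_classes[OF S \<delta>[of j], of "(1/2) ^ j" "real j" "(1/2) ^ j / 4"]
      by (auto simp: power_le_one)
    have fj: "f n \<in> ?Kj" for n using f by auto
    have "range (\<lambda>n. c (f (s n))) \<subseteq> c ` ?Kj" using fj by blast
    then have "finite (range (\<lambda>n. c (f (s n))))"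
      using c(1) by (rule finite_subset)
    from finite_image_constant_subseq[OF this]
    obtain r :: "nat \<Rightarrow> nat" where r: "strict_mono r" "\<forall>m n. c (f (s (r m))) = c (f (s (r n)))"
      by (elim exE conjE)
    then show "\<exists>r'. strict_mono r' \<and> P j (s \<circ> r')"
      using c(2) fj by (intro exI[of _ r]) (simp add: P_def)
  qed
  have P: "P j (diagseq \<circ> ((+) (Suc j)))" for j
    by (rule diagseq_holds) (auto simp: P_def)
  \<comment> \<open>\<open>P n\<close> holds for the diagonal sequence only from index
    \<open>n + 1\<close> on, hence the shift.\<close>
  define r where "r = diagseq \<circ> Suc"
  have r: "strict_mono r"
    unfolding r_def by (rule strict_mono_o[OF subseq_diagseq]) (simp add: strict_mono_def)
  have "lip_close (real n) ((1/2) ^ n) ((f \<circ> r) n) ((f \<circ> r) (Suc n))" for n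
    using P_def[THEN iffD1, OF P[of n], rule_format, of 0 1] by (simp add: r_def)
  then have "\<exists>y\<in>cadlag_paths S. J1_limit (f \<circ> r) y"
    by (intro lip_close_chain_limit compact_imp_complete[OF S]) (use f in auto)
  then show "\<exists>r y. strict_mono r \<and> y \<in> cadlag_paths S \<and> J1_limit (f \<circ> r) y"
    using r by blast
qed

text \<open>A closed subset of a cube that is compact by Tychonoff. The infinite sum is not
  continuous for the product topology, so its bound is expressed through the partial sums, which
  are.\<close>

lemma compact_mass_sequences: "compact mass_sequences"
proof -
  have "compact (PiE UNIV (\<lambda>_::nat. {0..1::real}))"
    using compactin_PiE[of "\<lambda>_::nat. euclidean" UNIV "\<lambda>_. {0..1::real}"]
    by (simp add: euclidean_product_topology)
  moreover have eq: "mass_sequences = PiE UNIV (\<lambda>_::nat. {0..1::real}) \<inter>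
      ((\<Inter>i. {x. x (Suc i) \<le> x i}) \<inter> (\<Inter>n. {x. (\<Sum>i<n. x i) \<le> 1}))"
  proof (intro equalityI subsetI)
    fix x :: "nat \<Rightarrow> real" assume x: "x \<in> mass_sequences"
    have s: "(\<Sum>i<n. x i) \<le> 1" for n
      using sum_le_suminf[of x "{..<n}"] x by (force simp: mass_sequences_def)
    have "x i \<le> 1" for i
      using s[of "Suc i"] sum_nonneg[of "{..<i}" x] x by (simp add: mass_sequences_def)
    then show "x \<in> PiE UNIV (\<lambda>_::nat. {0..1::real}) \<inter>
      ((\<Inter>i. {x. x (Suc i) \<le> x i}) \<inter> (\<Inter>n. {x. (\<Sum>i<n. x i) \<le> 1}))"
      using x s by (auto simp: mass_sequences_def PiE_def)
  next
    fix x :: "nat \<Rightarrow> real" assume x: "x \<in> PiE UNIV (\<lambda>_::nat. {0..1::real}) \<inter>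
      ((\<Inter>i. {x. x (Suc i) \<le> x i}) \<inter> (\<Inter>n. {x. (\<Sum>i<n. x i) \<le> 1}))"
    then have x': "\<And>i. 0 \<le> x i" "\<And>i. x (Suc i) \<le> x i" "\<And>n. (\<Sum>i<n. x i) \<le> 1"
      by (auto simp: PiE_def Pi_def)
    have "summable x"
      by (rule summableI_nonneg_bounded[of x 1]) (use x' in auto)
    moreover have "(\<Sum>i. x i) \<le> 1"
      by (rule suminf_le_const[OF \<open>summable x\<close>]) (use x' in auto)
    ultimately show "x \<in> mass_sequences" using x' by (simp add: mass_sequences_def)
  qed
  moreover have "closed ((\<Inter>i. {x :: nat \<Rightarrow> real. x (Suc i) \<le> x i}) \<inter> (\<Inter>n. {x. (\<Sum>i<n. x i) \<le> 1}))"
    by (intro closed_Int closed_INT ballI closed_Collect_le continuous_intros)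
      (auto intro!: continuous_on_product_coordinates continuous_on_sum)
  ultimately show ?thesis by (simp only: eq compact_Int_closed)
qed

section \<open>The path as a random element\<close>

lemma eventually_alive_right:
  fixes t :: real
  assumes "finite E"
  shows "\<forall>\<^sub>F s in at_right t. {e \<in> E. \<not> \<tau> e \<le> s} = {e \<in> E. \<not> \<tau> e \<le> t}"
proof -
  have "\<forall>\<^sub>F s in at_right t. \<tau> e \<le> s \<longleftrightarrow> \<tau> e \<le> t" for e
  proof (cases "\<tau> e \<le> t")
    case True
    then show ?thesis by (auto simp: eventually_at_right_field intro!: exI[of _ "t + 1"])
  next
    case False
    then show ?thesis by (auto simp: eventually_at_right_field intro!: exI[of _ "\<tau> e"])
  qed
  then have "\<forall>\<^sub>F s in at_right t. \<forall>e\<in>E. \<tau> e \<le> s \<longleftrightarrow> \<tau> e \<le> t"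
    using assms by (simp add: eventually_ball_finite_distrib)
  then show ?thesis by eventually_elim blast
qed

lemma eventually_alive_left:
  fixes t :: real
  assumes "finite E"
  shows "\<forall>\<^sub>F s in at_left t. {e \<in> E. \<not> \<tau> e \<le> s} = {e \<in> E. \<not> \<tau> e < t}"
proof -
  have "\<forall>\<^sub>F s in at_left t. \<tau> e \<le> s \<longleftrightarrow> \<tau> e < t" for e
  proof (cases "\<tau> e < t")
    case True
    then show ?thesis by (auto simp: eventually_at_left_field intro!: exI[of _ "\<tau> e"])
  next
    case False
    then show ?thesis by (auto simp: eventually_at_left_field intro!: exI[of _ "t - 1"])
  qed
  then have "\<forall>\<^sub>F s in at_left t. \<forall>e\<in>E. \<tau> e \<le> s \<longleftrightarrow> \<tau> e < t"
    using assms by (simp add: eventually_ball_finite_distrib)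
  then show ?thesis by eventually_elim blast
qed

lemma is_sgraph_pruned: "is_sgraph G \<Longrightarrow> is_sgraph (pruned G \<tau> t)"
  by (auto simp: pruned_def is_sgraph_def)

text \<open>Finitely many edges make the path a step function; its left limit at \<open>t\<close>
  still has the edges that are deleted exactly at \<open>t\<close>.\<close>

lemma fragmentation_in_cadlag_paths:
  assumes G: "is_sgraph G"
  shows "fragmentation G \<tau> \<in> cadlag_paths mass_sequences"
  unfolding cadlag_paths_def
proof (intro CollectI conjI allI impI)
  note fin = is_sgraph_finite_edges[OF G]
  show "fragmentation G \<tau> \<in> {0..} \<rightarrow>\<^sub>E mass_sequences"
    using ranked_masses_in_mass_sequences[OF is_sgraph_pruned[OF G]] by (simp add: fragmentation_def)
  show "continuous (at_right t) (fragmentation G \<tau>)" if t: "0 \<le> t" for t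
    unfolding continuous_within
  proof (rule tendsto_eventually)
    have "\<forall>\<^sub>F s in at_right t. t < s" by (simp add: eventually_at_right_less)
    then show "\<forall>\<^sub>F s in at_right t. fragmentation G \<tau> s = fragmentation G \<tau> t"
      using eventually_alive_right[OF fin, of \<tau> t]
      by eventually_elim (use t in \<open>simp add: fragmentation_def pruned_def\<close>)
  qed
  show "\<exists>l\<in>mass_sequences. (fragmentation G \<tau> \<longlongrightarrow> l) (at_left t)" if t: "0 < t" for t
  proof
    let ?l = "ranked_masses (verts G, {e \<in> edges G. \<not> \<tau> e < t})"
    show "?l \<in> mass_sequences"
      by (rule ranked_masses_in_mass_sequences) (use G in \<open>auto simp: is_sgraph_def\<close>)
    have "\<forall>\<^sub>F s in at_left t. 0 < s"
      using t by (auto simp: eventually_at_left_field)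
    then have "\<forall>\<^sub>F s in at_left t. fragmentation G \<tau> s = ?l"
      using eventually_alive_left[OF fin, of \<tau> t]
      by eventually_elim (simp add: fragmentation_def pruned_def)
    then show "(fragmentation G \<tau> \<longlongrightarrow> ?l) (at_left t)"
      by (rule tendsto_eventually)
  qed
qed

lemma finite_set_gap:
  fixes A :: "real set"
  assumes "finite A" "\<And>x. x \<in> A \<Longrightarrow> 0 < x"
  shows "\<exists>\<delta>>0. \<forall>x\<in>A. \<delta> \<le> x \<and> (\<forall>y\<in>A. x \<noteq> y \<longrightarrow> \<delta> \<le> \<bar>x - y\<bar>)"
proof -
  let ?B = "insert 1 (A \<union> (\<lambda>(x, y). \<bar>x - y\<bar>) ` {(x, y) \<in> A \<times> A. x \<noteq> y})"
  have fin: "finite ?B"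
    using assms(1) by (auto intro: finite_subset[of _ "A \<times> A"])
  have "0 < Min ?B"
    using assms fin by (subst Min_gr_iff) auto
  moreover have "Min ?B \<le> x" if "x \<in> A" for x
    using that by (intro Min_le fin) auto
  moreover have "Min ?B \<le> \<bar>x - y\<bar>" if "x \<in> A" "y \<in> A" "x \<noteq> y" for x y
    using that by (intro Min_le fin) auto
  ultimately show ?thesis by blast
qed

text \<open>Moving the deletion times without changing their coincidences only changes time.\<close>

lemma fragmentation_J1_close:
  assumes G: "is_sgraph G" and \<epsilon>: "0 < \<epsilon>" and \<sigma>: "\<And>e. 0 \<le> \<sigma> e"
  shows "\<exists>\<kappa>>0. \<forall>\<tau>. (\<forall>e\<in>edges G. \<bar>\<tau> e - \<sigma> e\<bar> < \<kappa>) \<longrightarrow> (\<forall>e\<in>edges G. \<sigma> e = 0 \<longrightarrow> \<tau> e = 0) \<longrightarrow>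
      (\<forall>e\<in>edges G. \<forall>f\<in>edges G. \<sigma> e = \<sigma> f \<longrightarrow> \<tau> e = \<tau> f) \<longrightarrow>
      J1_close N \<epsilon> (fragmentation G \<sigma>) (fragmentation G \<tau>)"
proof -
  \<comment> \<open>Time 0 is left out because time changes fix it; edges deleted at 0 must stay
    there, which is the second condition on \<open>\<tau>\<close>.\<close>
  define A where "A = \<sigma> ` edges G - {0}"
  have fin: "finite A" using is_sgraph_finite_edges[OF G] by (simp add: A_def)
  have pos: "0 < x" if "x \<in> A" for x using that \<sigma> by (auto simp: A_def less_le)
  obtain \<delta> where \<delta>: "0 < \<delta>" "\<And>x. x \<in> A \<Longrightarrow> \<delta> \<le> x" "\<And>x y. x \<in> A \<Longrightarrow> y \<in> A \<Longrightarrow> x \<noteq> y \<Longrightarrow> \<delta> \<le> \<bar>x - y\<bar>"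
    using finite_set_gap[OF fin pos] by blast
  define \<eta> where "\<eta> = \<epsilon> / 2"
  have \<eta>: "0 < \<eta>" "\<eta> < \<epsilon>" using \<epsilon> by (auto simp: \<eta>_def)
  define m where "m = min \<eta> (\<delta> * (1 - exp (- \<eta>)))"
  define \<kappa> where "\<kappa> = m / (real (card A) + 1)"
  have m: "0 < m" "m \<le> \<eta>" "m \<le> \<delta> * (1 - exp (- \<eta>))" using \<eta> \<delta> by (auto simp: m_def)
  have \<kappa>: "0 < \<kappa>" "real (card A) * \<kappa> \<le> m" using m(1) by (simp_all add: \<kappa>_def field_simps)
  have "J1_close N \<epsilon> (fragmentation G \<sigma>) (fragmentation G \<tau>)"
    if near: "\<forall>e\<in>edges G. \<bar>\<tau> e - \<sigma> e\<bar> < \<kappa>" and zero: "\<forall>e\<in>edges G. \<sigma> e = 0 \<longrightarrow> \<tau> e = 0"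
      and eq: "\<forall>e\<in>edges G. \<forall>f\<in>edges G. \<sigma> e = \<sigma> f \<longrightarrow> \<tau> e = \<tau> f" for \<tau>
  proof -
    \<comment> \<open>The new time for all edges with old time \<open>x\<close>; the choice of the
      edge does not matter, since coincidences are kept.\<close>
    define b where "b x = \<tau> (SOME e. e \<in> edges G \<and> \<sigma> e = x)" for x
    have b: "b (\<sigma> e) = \<tau> e" if "e \<in> edges G" for e
    proof -
      let ?f = "SOME f. f \<in> edges G \<and> \<sigma> f = \<sigma> e"
      have "?f \<in> edges G \<and> \<sigma> ?f = \<sigma> e" by (rule someI[of _ e]) (use that in simp)
      then show ?thesis using eq that unfolding b_def by blast
    qed
    have "\<exists>\<mu>. lip_change \<eta> \<mu> \<and> (\<forall>x\<in>A. \<mu> x = b x)"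
    proof (rule lip_change_interpolation[OF fin \<delta>(1)])
      fix x assume "x \<in> A"
      then show "\<bar>b x - x\<bar> \<le> \<kappa>" using b near by (force simp: A_def)
    qed (use \<delta> \<eta> m \<kappa> in auto)
    then obtain \<mu> where \<mu>: "lip_change \<eta> \<mu>" "\<And>x. x \<in> A \<Longrightarrow> \<mu> x = b x" by blast
    have \<mu>\<sigma>: "\<mu> (\<sigma> e) = \<tau> e" if "e \<in> edges G" for e
      using \<mu>(2)[of "\<sigma> e"] b[OF that] zero that lip_changeD(1)[OF \<mu>(1)] by (cases "\<sigma> e = 0") (auto simp: A_def)
    have "fragmentation G \<tau> (\<mu> s) = fragmentation G \<sigma> s" if s: "0 \<le> s" for s
    proof -
      have "\<tau> e \<le> \<mu> s \<longleftrightarrow> \<sigma> e \<le> s" if "e \<in> edges G" for e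
        using lip_change_less[OF \<mu>(1) \<sigma>[of e], of s] lip_change_less[OF \<mu>(1) s, of "\<sigma> e"] \<mu>\<sigma>[OF that]
        by (cases "\<sigma> e" s rule: linorder_cases) auto
      then have "{e \<in> edges G. \<not> \<tau> e \<le> \<mu> s} = {e \<in> edges G. \<not> \<sigma> e \<le> s}" by blast
      then show ?thesis
        using s lip_change_nonneg[OF \<mu>(1) s] by (simp add: fragmentation_def pruned_def)
    qed
    then have "\<bar>\<mu> s - s\<bar> < \<epsilon> \<and> dist (fragmentation G \<tau> (\<mu> s)) (fragmentation G \<sigma> s) < \<epsilon>" if "0 \<le> s" for s
      using lip_changeD(2)[OF \<mu>(1) that] \<eta> \<epsilon> that by simp
    then show ?thesis
      using lip_change_time_change[OF \<mu>(1)] unfolding J1_close_def by auto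
  qed
  then show ?thesis using \<kappa>(1) by blast
qed

text \<open>Only times from 0 on are observed, so a negative deletion time acts like time 0. This
  provides the nonnegative times that \<open>fragmentation_J1_close\<close> requires.\<close>

lemma fragmentation_max_0:
  "fragmentation G (\<lambda>e. max 0 (\<tau> e)) = fragmentation G \<tau>"
proof -
  have "{e \<in> edges G. \<not> max 0 (\<tau> e) \<le> t} = {e \<in> edges G. \<not> \<tau> e \<le> t}" if "0 \<le> t" for t
    using that by auto
  then show ?thesis
    by (auto simp: fragmentation_def pruned_def fun_eq_iff)
qed

lemma fragmentation_cong:
  "(\<And>e. e \<in> edges G \<Longrightarrow> \<tau> e = \<sigma> e) \<Longrightarrow> fragmentation G \<tau> = fragmentation G \<sigma>"
proof -
  assume "\<And>e. e \<in> edges G \<Longrightarrow> \<tau> e = \<sigma> e"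
  then have "{e \<in> edges G. \<not> \<tau> e \<le> t} = {e \<in> edges G. \<not> \<sigma> e \<le> t}" for t by auto
  then show ?thesis by (simp add: fragmentation_def pruned_def)
qed

text \<open>A perturbation of the deletion times can split simultaneous jumps or move a deletion
  away from time 0, and continuity may fail there. There are only finitely many patterns of such
  coincidences, and within each of them the path varies continuously by
  \<open>fragmentation_J1_close\<close>.\<close>

lemma fragmentation_measurable_fixed:
  assumes G: "is_sgraph G" and \<tau>: "\<And>e. \<tau> e \<in> borel_measurable M"
  shows "(\<lambda>\<omega>. fragmentation G (\<lambda>e. \<tau> e \<omega>)) \<in> M \<rightarrow>\<^sub>M borel_of (J1_topology mass_sequences)"
proof -
  let ?X = "J1_topology mass_sequences"
  \<comment> \<open>Numbering the edges turns the deletion times into a point of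
    \<open>nat \<Rightarrow> real\<close>, whose topology and Borel sets can be handled by
    coordinates.\<close>
  obtain ix :: "_ \<Rightarrow> nat" where ix: "inj_on ix (edges G)"
    using finite_imp_inj_to_nat_seg[OF is_sgraph_finite_edges[OF G]] by metis
  define ed where "ed = inv_into (edges G) ix"
  have ed: "ed (ix e) = e" if "e \<in> edges G" for e
    using ix that by (simp add: ed_def)
  define h where "h \<omega> i = max 0 (\<tau> (ed i) \<omega>)" for \<omega> i
  have h: "h \<in> borel_measurable M"
    unfolding h_def by (intro measurable_coordinatewise_then_product borel_measurable_max \<tau>) simp
  define \<Psi> where "\<Psi> v = fragmentation G (\<lambda>e. v (ix e))" for v :: "nat \<Rightarrow> real"
  have \<Psi>h: "\<Psi> (h \<omega>) = fragmentation G (\<lambda>e. \<tau> e \<omega>)" for \<omega>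
    unfolding \<Psi>_def h_def
    by (subst fragmentation_max_0[symmetric], intro fragmentation_cong) (simp add: ed)
  define I where "I = ix ` edges G"
  have finI: "finite I" using is_sgraph_finite_edges[OF G] by (simp add: I_def)
  define pat where "pat v = ({(i, j) \<in> I \<times> I. v i = v j}, {i \<in> I. v i = 0})" for v :: "nat \<Rightarrow> real"
  have finpat: "finite (range pat)"
    by (rule finite_subset[of _ "Pow (I \<times> I) \<times> Pow I"]) (use finI in \<open>auto simp: pat_def\<close>)
  have coord [measurable]: "(\<lambda>v :: nat \<Rightarrow> real. v i) \<in> borel_measurable borel" for i
    by (intro borel_measurable_continuous_onI continuous_on_product_coordinates)
  have [measurable]: "Measurable.pred borel (\<lambda>v :: nat \<Rightarrow> real. v i = v j)" for i j
    unfolding pred_def using borel_closed[OF closed_Collect_eq[OF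
        continuous_on_product_coordinates[of i] continuous_on_product_coordinates[of j]]] by simp
  have [measurable]: "Measurable.pred borel (\<lambda>v :: nat \<Rightarrow> real. v i = 0)" for i
    unfolding pred_def using borel_closed[OF closed_Collect_eq[OF
        continuous_on_product_coordinates[of i] continuous_on_const]] by simp
  have pat_sets: "{v. pat v = p} \<in> sets borel" for p
  proof -
    have "{v. pat v = p} = {v \<in> space borel. fst p \<subseteq> I \<times> I \<and> snd p \<subseteq> I \<and>
        (\<forall>i\<in>I. \<forall>j\<in>I. v i = v j \<longleftrightarrow> (i, j) \<in> fst p) \<and> (\<forall>i\<in>I. v i = 0 \<longleftrightarrow> i \<in> snd p)}"
      by (cases p) (auto simp: pat_def set_eq_iff)
    also have "\<dots> \<in> sets borel"
      using finI by measurable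
    finally show ?thesis .
  qed
  have preimage: "{v. (\<forall>i. 0 \<le> v i) \<and> pat v = p \<and> \<Psi> v \<in> U} \<in> sets borel" if U: "openin ?X U" for p U
  proof -
    let ?V = "{v. (\<forall>i. 0 \<le> v i) \<and> pat v = p \<and> \<Psi> v \<in> U}"
    have nn: "{v :: nat \<Rightarrow> real. \<forall>i. 0 \<le> v i} \<in> sets borel"
    proof -
      have "{v :: nat \<Rightarrow> real. \<forall>i. 0 \<le> v i} = {v \<in> space borel. \<forall>i. 0 \<le> v i}" by simp
      also have "\<dots> \<in> sets borel" by measurable
      finally show ?thesis .
    qed
    have "\<exists>\<kappa>>0. \<forall>w. (\<forall>i\<in>I. \<bar>w i - v i\<bar> < \<kappa>) \<longrightarrow> pat w = p \<longrightarrow> \<Psi> w \<in> U" if v: "v \<in> ?V" for v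
    proof -
      obtain N \<epsilon> where \<epsilon>: "0 < \<epsilon>" "\<forall>y\<in>cadlag_paths mass_sequences. J1_close N \<epsilon> (\<Psi> v) y \<longrightarrow> y \<in> U"
        using U v by (auto simp: openin_J1_topology)
      obtain \<kappa> where \<kappa>: "0 < \<kappa>" "\<forall>\<tau>. (\<forall>e\<in>edges G. \<bar>\<tau> e - v (ix e)\<bar> < \<kappa>) \<longrightarrow> (\<forall>e\<in>edges G. v (ix e) = 0 \<longrightarrow> \<tau> e = 0) \<longrightarrow>
          (\<forall>e\<in>edges G. \<forall>f\<in>edges G. v (ix e) = v (ix f) \<longrightarrow> \<tau> e = \<tau> f) \<longrightarrow>
          J1_close N \<epsilon> (fragmentation G (\<lambda>e. v (ix e))) (fragmentation G \<tau>)"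
        using fragmentation_J1_close[OF G \<epsilon>(1), of "\<lambda>e. v (ix e)" N] v by auto
      have "\<Psi> w \<in> U" if w: "\<forall>i\<in>I. \<bar>w i - v i\<bar> < \<kappa>" "pat w = p" for w
      proof -
        have "pat w = pat v" using w v by simp
        then have z: "\<forall>i\<in>I. v i = 0 \<longleftrightarrow> w i = 0" "\<forall>i\<in>I. \<forall>j\<in>I. v i = v j \<longleftrightarrow> w i = w j"
          by (auto simp: pat_def set_eq_iff)
        have "J1_close N \<epsilon> (\<Psi> v) (\<Psi> w)"
          unfolding \<Psi>_def by (rule \<kappa>(2)[rule_format]) (use w z in \<open>auto simp: I_def\<close>)
        then show ?thesis
          using \<epsilon>(2) fragmentation_in_cadlag_paths[OF G] by (simp add: \<Psi>_def)
      qed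
      then show ?thesis using \<kappa>(1) by blast
    qed
    then have "\<exists>k. \<forall>v\<in>?V. 0 < k v \<and> (\<forall>w. (\<forall>i\<in>I. \<bar>w i - v i\<bar> < k v) \<longrightarrow> pat w = p \<longrightarrow> \<Psi> w \<in> U)"
      by (intro bchoice ballI)
    then obtain k where k: "\<forall>v\<in>?V. 0 < k v \<and> (\<forall>w. (\<forall>i\<in>I. \<bar>w i - v i\<bar> < k v) \<longrightarrow> pat w = p \<longrightarrow> \<Psi> w \<in> U)"
      by (rule exE)
    \<comment> \<open>The piece is the trace of the open set \<open>W\<close> on a Borel set; the
      union may be uncountable, which is harmless for open sets.\<close>
    define W where "W = (\<Union>v\<in>?V. \<Inter>i\<in>I. {w :: nat \<Rightarrow> real. \<bar>w i - v i\<bar> < k v})"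
    have "open W"
      unfolding W_def
      by (intro open_UN open_INT ballI finI open_Collect_less continuous_intros continuous_on_product_coordinates)
    moreover have "?V = {v. pat v = p} \<inter> {v. \<forall>i. 0 \<le> v i} \<inter> W"
    proof (intro equalityI subsetI)
      fix v assume v: "v \<in> ?V"
      then have "v \<in> W" using bspec[OF k v] by (auto simp: W_def)
      then show "v \<in> {v. pat v = p} \<inter> {v. \<forall>i. 0 \<le> v i} \<inter> W" using v by simp
    next
      fix w assume w: "w \<in> {v. pat v = p} \<inter> {v. \<forall>i. 0 \<le> v i} \<inter> W"
      then obtain v where v: "v \<in> ?V" "\<forall>i\<in>I. \<bar>w i - v i\<bar> < k v" by (auto simp: W_def)
      then show "w \<in> ?V" using bspec[OF k v(1)] w by simp
    qed
    ultimately show ?thesis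
      using nn pat_sets by (simp add: sets.Int borel_open)
  qed
  show ?thesis
    unfolding borel_of_def
  proof (rule measurable_measure_of)
    show "{U. openin ?X U} \<subseteq> Pow (topspace ?X)" using openin_subset by auto
    show "(\<lambda>\<omega>. fragmentation G (\<lambda>e. \<tau> e \<omega>)) \<in> space M \<rightarrow> topspace ?X"
      using fragmentation_in_cadlag_paths[OF G] by (simp add: topspace_J1_topology)
    fix U assume "U \<in> {U. openin ?X U}"
    then have U: "openin ?X U" by simp
    have "(\<Union>p\<in>range pat. {v. (\<forall>i. 0 \<le> v i) \<and> pat v = p \<and> \<Psi> v \<in> U}) \<in> sets borel"
      using finpat preimage[OF U] by (intro sets.finite_UN) auto
    then have "h -` (\<Union>p\<in>range pat. {v. (\<forall>i. 0 \<le> v i) \<and> pat v = p \<and> \<Psi> v \<in> U}) \<inter> space M \<in> sets M"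
      by (rule measurable_sets[OF h])
    also have "h -` (\<Union>p\<in>range pat. {v. (\<forall>i. 0 \<le> v i) \<and> pat v = p \<and> \<Psi> v \<in> U}) \<inter> space M
        = (\<lambda>\<omega>. fragmentation G (\<lambda>e. \<tau> e \<omega>)) -` U \<inter> space M"
      by (auto simp flip: \<Psi>h simp: h_def)
    finally show "(\<lambda>\<omega>. fragmentation G (\<lambda>e. \<tau> e \<omega>)) -` U \<inter> space M \<in> sets M" .
  qed
qed

section \<open>First passage times\<close>

definition first_time :: "(real \<Rightarrow> bool) \<Rightarrow> real \<Rightarrow> bool" where
  "first_time \<Phi> s \<longleftrightarrow> 0 \<le> s \<and> \<Phi> s \<and> (\<forall>u. 0 \<le> u \<longrightarrow> u < s \<longrightarrow> \<not> \<Phi> u)"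

lemma first_time_unique: "first_time \<Phi> s \<Longrightarrow> first_time \<Phi> t \<Longrightarrow> s = t"
  unfolding first_time_def by (meson linorder_neqE)

text \<open>The set of remaining edges changes only at deletion times, so the candidates for a
  passage are 0 and finitely many positive times, and the least one that qualifies is
  attained.\<close>

lemma first_time_alive_ex:
  fixes \<tau> :: "'e \<Rightarrow> real"
  assumes "finite E" "0 \<le> u" "F {e \<in> E. \<not> \<tau> e \<le> u}"
  shows "\<exists>s. first_time (\<lambda>s. F {e \<in> E. \<not> \<tau> e \<le> s}) s"
proof -
  let ?T = "{s \<in> insert 0 (\<tau> ` E). 0 \<le> s}"
  have fin: "finite ?T" using assms(1) by simp
  \<comment> \<open>The remaining edges at time \<open>u\<close> are those at the last candidate up
    to \<open>u\<close>.\<close>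
  have last: "\<exists>s\<in>?T. s \<le> u \<and> {e \<in> E. \<not> \<tau> e \<le> u} = {e \<in> E. \<not> \<tau> e \<le> s}" if u: "0 \<le> u" for u
  proof -
    let ?Tu = "{s \<in> ?T. s \<le> u}"
    have ne: "finite ?Tu" "?Tu \<noteq> {}"
      by (rule finite_subset[OF _ fin], blast) (use u in auto)
    have M: "Max ?Tu \<in> ?Tu" by (rule Max_in[OF ne])
    have "\<tau> e \<le> u \<longleftrightarrow> \<tau> e \<le> Max ?Tu" if "e \<in> E" for e
    proof
      assume "\<tau> e \<le> u"
      show "\<tau> e \<le> Max ?Tu"
      proof (cases "0 \<le> \<tau> e")
        case True
        then show ?thesis using \<open>\<tau> e \<le> u\<close> that by (intro Max_ge[OF ne(1)]) auto
      next
        case False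
        then show ?thesis using M by auto
      qed
    qed (use M in auto)
    then show ?thesis using M by (intro bexI[of _ "Max ?Tu"]) auto
  qed
  let ?S = "{s \<in> ?T. F {e \<in> E. \<not> \<tau> e \<le> s}}"
  obtain s0 where "s0 \<in> ?T" "{e \<in> E. \<not> \<tau> e \<le> u} = {e \<in> E. \<not> \<tau> e \<le> s0}"
    using last[OF assms(2)] by (elim bexE conjE)
  then have "s0 \<in> ?S" using assms(3) by simp
  then have S: "finite ?S" "?S \<noteq> {}"
    by (auto intro: finite_subset[OF _ fin])
  have M: "Min ?S \<in> ?S" by (rule Min_in[OF S])
  have "\<not> F {e \<in> E. \<not> \<tau> e \<le> v}" if v: "0 \<le> v" "v < Min ?S" for v
  proof
    assume F: "F {e \<in> E. \<not> \<tau> e \<le> v}"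
    obtain s where "s \<in> ?T" "s \<le> v" "{e \<in> E. \<not> \<tau> e \<le> v} = {e \<in> E. \<not> \<tau> e \<le> s}"
      using last[OF v(1)] by (elim bexE conjE)
    then have "s \<in> ?S" "s \<le> v" using F by auto
    then show False using Min_le[OF S(1), of s] v(2) by linarith
  qed
  then have "first_time (\<lambda>s. F {e \<in> E. \<not> \<tau> e \<le> s}) (Min ?S)"
    using M by (simp add: first_time_def)
  then show ?thesis by blast
qed

text \<open>If the decreasing function \<open>q\<close> loses at most \<open>\<eta>\<close> in the time \<open>\<delta>\<close> after it first passes
  a multiple of \<open>\<eta>\<close>, a grid is obtained by moving on to the next such passage that is at least
  \<open>\<delta>\<close> away.\<close>

lemma grid_from_levels:
  fixes q :: "real \<Rightarrow> real"
  assumes anti: "\<And>s t. 0 \<le> s \<Longrightarrow> s \<le> t \<Longrightarrow> q t \<le> q s" and q: "\<And>t. 0 \<le> t \<Longrightarrow> 0 \<le> q t" "q 0 \<le> 1"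
    and \<eta>: "0 < \<eta>" and \<delta>: "0 < \<delta>" and K: "1 \<le> real K * \<eta>"
    and ex: "\<And>k u. 0 \<le> u \<Longrightarrow> q u \<le> 1 - real k * \<eta> \<Longrightarrow> \<exists>s. first_time (\<lambda>s. q s \<le> 1 - real k * \<eta>) s"
    and good: "\<And>k s. k \<le> K \<Longrightarrow> first_time (\<lambda>s. q s \<le> 1 - real k * \<eta>) s \<Longrightarrow> q s - q (s + \<delta>) \<le> \<eta>"
  shows "\<exists>t::nat \<Rightarrow> real. t 0 = 0 \<and> (\<forall>i. t i + \<delta> \<le> t (Suc i)) \<and>
    (\<forall>i. \<forall>s\<in>{t i..<t (Suc i)}. q (t i) - q s \<le> 2 * \<eta>)"
proof -
  define P where "P t \<longleftrightarrow> 0 \<le> t \<and> q t - q (t + \<delta>) \<le> \<eta>" for t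
  have next_ex: "\<exists>t'. P t' \<and> t + \<delta> \<le> t' \<and> (\<forall>s\<in>{t..<t'}. q t - q s \<le> 2 * \<eta>)" if t: "P t" for t
  proof -
    define u where "u = t + \<delta>"
    have u: "0 \<le> u" "t \<le> u" using t \<delta> by (auto simp: P_def u_def)
    have qtu: "q t - q u \<le> \<eta>" using t by (simp add: P_def u_def)
    have qu: "0 \<le> (1 - q u) / \<eta>" using anti[of 0 u] u q \<eta> by simp
    \<comment> \<open>The first level strictly below \<open>q u\<close>, at most \<eta> lower.
      Together with the loss of at most \<eta> between \<open>t\<close> and \<open>u\<close> this
      gives \<open>2 * \<eta>\<close>.\<close>
    define k where "k = nat (\<lfloor>(1 - q u) / \<eta>\<rfloor> + 1)"
    have "real k = \<lfloor>(1 - q u) / \<eta>\<rfloor> + 1" using qu by (simp add: k_def)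
    then have "(1 - q u) / \<eta> < real k" "real k - 1 \<le> (1 - q u) / \<eta>" by linarith+
    then have k: "1 - real k * \<eta> < q u" "q u - (1 - real k * \<eta>) \<le> \<eta>"
      using \<eta> by (simp_all add: field_simps)
    show ?thesis
    proof (cases "\<exists>v\<ge>0. q v \<le> 1 - real k * \<eta>")
      case True
      then obtain v where v: "0 \<le> v" "q v \<le> 1 - real k * \<eta>" by blast
      then obtain s where s: "first_time (\<lambda>s. q s \<le> 1 - real k * \<eta>) s" using ex by blast
      have "0 \<le> s" "q s \<le> 1 - real k * \<eta>" using s by (auto simp: first_time_def)
      have "real k * \<eta> \<le> real K * \<eta>" using v q(1)[of v] K by linarith
      then have "k \<le> K" using \<eta> by simp
      have "P s" using good[OF \<open>k \<le> K\<close> s] \<open>0 \<le> s\<close> by (simp add: P_def)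
      moreover have "u \<le> s"
        using anti[of s u] \<open>0 \<le> s\<close> \<open>q s \<le> 1 - real k * \<eta>\<close> k(1) by force
      moreover have "q t - q w \<le> 2 * \<eta>" if w: "w \<in> {t..<s}" for w
      proof -
        have "0 \<le> w" using w u t by (auto simp: P_def)
        then have "1 - real k * \<eta> < q w" using s w by (force simp: first_time_def)
        then show ?thesis using qtu k(2) by linarith
      qed
      ultimately show ?thesis by (intro exI[of _ s]) (auto simp: u_def)
    next
      case False
      \<comment> \<open>The next level is never reached, so \<open>q\<close> loses at most \<eta>
        after \<open>u\<close> altogether, and \<open>u\<close> itself can be the next grid
        point.\<close>
      then have "1 - real k * \<eta> < q v" if "0 \<le> v" for v using that by force
      then have "P u" using k(2) u \<delta> by (smt (verit) P_def)
      moreover have "q t - q w \<le> 2 * \<eta>" if "w \<in> {t..<u}" for w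
        using anti[of w u] that qtu \<eta> t by (auto simp: P_def)
      ultimately show ?thesis by (intro exI[of _ u]) (auto simp: u_def)
    qed
  qed
  \<comment> \<open>Level 0 is passed at time 0, so the grid can start there.\<close>
  have "first_time (\<lambda>s. q s \<le> 1 - real 0 * \<eta>) 0"
    using q by (simp add: first_time_def)
  then have P0: "P 0" using good[of 0 0] by (simp add: P_def)
  have "\<exists>f. f 0 = 0 \<and> (\<forall>i::nat. P (f i) \<and> (f i + \<delta> \<le> f (Suc i) \<and> (\<forall>s\<in>{f i..<f (Suc i)}. q (f i) - q s \<le> 2 * \<eta>)))"
  proof -
    have "\<exists>f. \<forall>n. (P (f n) \<and> (n = 0 \<longrightarrow> f n = 0)) \<and>
        (f n + \<delta> \<le> f (Suc n) \<and> (\<forall>s\<in>{f n..<f (Suc n)}. q (f n) - q s \<le> 2 * \<eta>))"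
      by (rule dependent_nat_choice) (use P0 next_ex in auto)
    then show ?thesis by blast
  qed
  then show ?thesis by blast
qed

section \<open>Measurability of the remaining edges and deletions shortly after a passage\<close>

lemma measurable_alive:
  assumes "finite E" "\<And>e. e \<in> E \<Longrightarrow> \<tau> e \<in> borel_measurable M"
  shows "(\<lambda>\<omega>. {e \<in> E. \<not> \<tau> e \<omega> \<le> (t::real)}) \<in> M \<rightarrow>\<^sub>M count_space (Pow E)"
  unfolding measurable_count_space_eq2[OF finite_Pow_iff[THEN iffD2, OF assms(1)]]
proof (intro conjI ballI)
  fix A assume A: "A \<in> Pow E"
  have "(\<lambda>\<omega>. {e \<in> E. \<not> \<tau> e \<omega> \<le> t}) -` {A} \<inter> space M
      = {\<omega> \<in> space M. \<forall>e\<in>E. \<tau> e \<omega> \<le> t \<longleftrightarrow> e \<notin> A}"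
    using A by auto
  also have "\<dots> \<in> sets M"
  proof (rule sets.sets_Collect_finite_All[OF _ assms(1)])
    fix e assume "e \<in> E"
    then have [measurable]: "\<tau> e \<in> borel_measurable M" by (rule assms(2))
    show "{\<omega> \<in> space M. \<tau> e \<omega> \<le> t \<longleftrightarrow> e \<notin> A} \<in> sets M" by measurable
  qed
  finally show "(\<lambda>\<omega>. {e \<in> E. \<not> \<tau> e \<omega> \<le> t}) -` {A} \<inter> space M \<in> sets M" .
qed auto

lemma measurable_alive_fun:
  assumes "finite E" "\<And>e. e \<in> E \<Longrightarrow> \<tau> e \<in> borel_measurable M"
  shows "(\<lambda>\<omega>. g {e \<in> E. \<not> \<tau> e \<omega> \<le> (t::real)}) \<in> M \<rightarrow>\<^sub>M count_space UNIV"
  by (rule measurable_compose[OF measurable_alive[OF assms]]) auto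

lemma exponential_density_le: "0 < r \<Longrightarrow> exponential_density r x \<le> r"
  by (auto simp: exponential_density_def)

text \<open>Given \<open>Y = y\<close>, the variable \<open>X\<close> has to fall into an interval
  of length \<delta>, and its density is at most \<open>r\<close>. Fubini integrates this bound over
  the law of \<open>Y\<close>.\<close>

lemma (in prob_space) indep_exponential_interval:
  assumes ind: "indep_var borel X borel Y" and X: "distributed M lborel X (exponential_density r)"
    and r: "0 < r" and \<delta>: "0 \<le> \<delta>"
  shows "{\<omega> \<in> space M. Y \<omega> < X \<omega> \<and> X \<omega> \<le> Y \<omega> + \<delta>} \<in> events"
    and "prob {\<omega> \<in> space M. Y \<omega> < X \<omega> \<and> X \<omega> \<le> Y \<omega> + \<delta>} \<le> r * \<delta>"
proof -
  have [measurable]: "random_variable borel X" "random_variable borel Y"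
    using ind by (auto dest: indep_var_rv1 indep_var_rv2)
  have joint: "distr M borel X \<Otimes>\<^sub>M distr M borel Y = distr M (borel \<Otimes>\<^sub>M borel) (\<lambda>\<omega>. (X \<omega>, Y \<omega>))"
    using ind by (simp add: indep_var_distribution_eq)
  let ?B = "{p \<in> space (borel \<Otimes>\<^sub>M borel). snd p < fst p \<and> fst p \<le> snd p + \<delta>} :: (real \<times> real) set"
  let ?E = "{\<omega> \<in> space M. Y \<omega> < X \<omega> \<and> X \<omega> \<le> Y \<omega> + \<delta>}"
  show E: "?E \<in> events" by measurable
  have B: "?B \<in> sets (borel \<Otimes>\<^sub>M borel)" by measurable
  interpret DX: prob_space "distr M borel X" by (rule prob_space_distr) measurable
  interpret DY: prob_space "distr M borel Y" by (rule prob_space_distr) measurable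
  interpret pair_sigma_finite "distr M borel X" "distr M borel Y" ..
  have slice: "emeasure (distr M borel X) ((\<lambda>x. (x, y)) -` ?B) \<le> ennreal (r * \<delta>)" for y
  proof -
    have "(\<lambda>x. (x, y)) -` ?B = {y<..y + \<delta>}"
      by (auto simp: space_pair_measure)
    moreover have "emeasure (distr M borel X) {y<..y + \<delta>} = emeasure M (X -` {y<..y + \<delta>} \<inter> space M)"
      by (simp add: emeasure_distr)
    moreover have "\<dots> = (\<integral>\<^sup>+x. ennreal (exponential_density r x) * indicator {y<..y + \<delta>} x \<partial>lborel)"
      by (rule distributed_emeasure[OF X]) simp
    moreover have "\<dots> \<le> (\<integral>\<^sup>+x. ennreal r * indicator {y<..y + \<delta>} x \<partial>lborel)"
      by (intro nn_integral_mono mult_right_mono ennreal_leI exponential_density_le r) simp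
    moreover have "\<dots> = ennreal (r * \<delta>)"
      using r \<delta> by (simp add: nn_integral_cmult ennreal_mult')
    ultimately show ?thesis by simp
  qed
  have "emeasure M ?E = emeasure (distr M (borel \<Otimes>\<^sub>M borel) (\<lambda>\<omega>. (X \<omega>, Y \<omega>))) ?B"
    using B by (subst emeasure_distr) (auto intro!: arg_cong[where f = "emeasure M"] simp: space_pair_measure)
  also have "\<dots> = emeasure (distr M borel X \<Otimes>\<^sub>M distr M borel Y) ?B"
    by (simp only: joint)
  also have "\<dots> = (\<integral>\<^sup>+y. emeasure (distr M borel X) ((\<lambda>x. (x, y)) -` ?B) \<partial>distr M borel Y)"
    by (rule emeasure_pair_measure_alt2) (use B in \<open>simp cong: sets_pair_measure_cong\<close>)
  also have "\<dots> \<le> (\<integral>\<^sup>+y. ennreal (r * \<delta>) \<partial>distr M borel Y)"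
    by (intro nn_integral_mono slice)
  also have "\<dots> = ennreal (r * \<delta>)"
    using DY.emeasure_space_1 by simp
  finally show "prob ?E \<le> r * \<delta>"
    using r \<delta> by (simp add: emeasure_eq_measure)
qed

text \<open>Before edge \<open>e\<close> is deleted, the first passage time does not depend on \<open>\<tau> e\<close>.\<close>

lemma (in prob_space) exponential_after_first_time:
  assumes iid: "iid_exponential M r E \<tau>" and E: "finite E" "e \<in> E" and r: "0 < r" and \<delta>: "0 \<le> \<delta>"
    and F: "\<And>A B. B \<subseteq> A \<Longrightarrow> A \<subseteq> E \<Longrightarrow> F A \<Longrightarrow> F B"
  defines "Ev \<equiv> {\<omega> \<in> space M. \<exists>s. first_time (\<lambda>s. F (insert e {f \<in> E. \<not> \<tau> f \<omega> \<le> s})) s \<and>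
      s < \<tau> e \<omega> \<and> \<tau> e \<omega> \<le> s + \<delta>}"
  shows "Ev \<in> events \<and> prob Ev \<le> r * \<delta>"
proof -
  define J where "J = E - {e}"
  have finJ: "finite J" using E by (simp add: J_def)
  define al where "al y s = {f \<in> J. \<not> y f \<le> s}" for y :: "_ \<Rightarrow> real" and s
  have ins: "insert e {f \<in> E. \<not> y f \<le> s} = insert e (al y s)" for y :: "_ \<Rightarrow> real" and s
    using E(2) by (auto simp: al_def J_def)
  show ?thesis
  \<comment> \<open>If even \<open>{e}\<close> does not satisfy \<open>F\<close>, there is no
    passage while \<open>e\<close> is kept. Otherwise deleting all other edges forces one, so
    \<sigma> is a genuine passage time for all values of the other deletion times.\<close>
  proof (cases "F {e}")
    case False
    have "\<not> F (insert e {f \<in> E. \<not> \<tau> f \<omega> \<le> s})" for \<omega> s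
      using F[of "{e}" "insert e {f \<in> E. \<not> \<tau> f \<omega> \<le> s}"] E(2) False by auto
    then have "Ev = {}" by (auto simp: Ev_def first_time_def)
    then show ?thesis using r \<delta> by simp
  next
    case True
    have al_anti: "F (insert e (al y t))" if "F (insert e (al y s))" "s \<le> t" for y s t
      by (rule F[OF _ _ that(1)]) (use that(2) E in \<open>auto simp: al_def J_def\<close>)
    have ex: "\<exists>s. first_time (\<lambda>s. F (insert e (al y s))) s" for y
    proof -
      define u where "u = Max (insert 0 (y ` J))"
      have "0 \<le> u" "\<And>f. f \<in> J \<Longrightarrow> y f \<le> u" using finJ by (auto simp: u_def)
      then have "al y u = {}" by (auto simp: al_def)
      then have "(\<lambda>A. F (insert e A)) {f \<in> J. \<not> y f \<le> u}" using True by (simp only: al_def)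
      from first_time_alive_ex[where F = "\<lambda>A. F (insert e A)", OF finJ \<open>0 \<le> u\<close> this]
      show ?thesis by (simp only: al_def)
    qed
    define \<sigma> where "\<sigma> y = (SOME s. first_time (\<lambda>s. F (insert e (al y s))) s)" for y
    have \<sigma>: "first_time (\<lambda>s. F (insert e (al y s))) (\<sigma> y)" for y
      unfolding \<sigma>_def by (rule someI_ex[OF ex])
    \<comment> \<open>Monotonicity of \<open>F\<close> turns passage by time \<open>t\<close> into a
      condition on the edges present at \<open>t\<close>, which is measurable.\<close>
    have \<sigma>_le: "\<sigma> y \<le> t \<longleftrightarrow> 0 \<le> t \<and> F (insert e (al y t))" for y t
    proof
      assume "\<sigma> y \<le> t"
      then show "0 \<le> t \<and> F (insert e (al y t))"
        using \<sigma>[of y] al_anti[of y "\<sigma> y" t] by (auto simp: first_time_def)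
    next
      assume "0 \<le> t \<and> F (insert e (al y t))"
      then show "\<sigma> y \<le> t" using \<sigma>[of y] by (force simp: first_time_def)
    qed
    have \<sigma>_meas: "\<sigma> \<in> borel_measurable (PiM J (\<lambda>_. borel))"
      unfolding borel_measurable_iff_le
    proof
      fix t
      have "(\<lambda>y. F (insert e (al y t))) \<in> PiM J (\<lambda>_. borel) \<rightarrow>\<^sub>M count_space UNIV"
        unfolding al_def by (rule measurable_alive_fun[OF finJ]) (rule measurable_component_singleton)
      then have [measurable]: "Measurable.pred (PiM J (\<lambda>_. borel)) (\<lambda>y. F (insert e (al y t)))" .
      show "{y \<in> space (PiM J (\<lambda>_. borel)). \<sigma> y \<le> t} \<in> sets (PiM J (\<lambda>_. borel))"
        unfolding \<sigma>_le by measurable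
    qed
    have ind: "indep_vars (\<lambda>_. borel) \<tau> E" and dist: "distributed M lborel (\<tau> e) (exponential_density r)"
      using iid E(2) by (auto simp: iid_exponential_def)
    have "indep_var (PiM {e} (\<lambda>_. borel)) (\<lambda>\<omega>. restrict (\<lambda>i. \<tau> i \<omega>) {e})
        (PiM J (\<lambda>_. borel)) (\<lambda>\<omega>. restrict (\<lambda>i. \<tau> i \<omega>) J)"
      by (rule indep_var_restrict[OF ind]) (use E in \<open>auto simp: J_def\<close>)
    then have "indep_var borel ((\<lambda>y. y e) \<circ> (\<lambda>\<omega>. restrict (\<lambda>i. \<tau> i \<omega>) {e}))
        borel (\<sigma> \<circ> (\<lambda>\<omega>. restrict (\<lambda>i. \<tau> i \<omega>) J))"
      by (rule indep_var_compose) (use \<sigma>_meas in \<open>auto intro: measurable_component_singleton\<close>)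
    \<comment> \<open>\<sigma> reads only the deletion times in \<open>J\<close>, a block
      independent of \<open>\<tau> e\<close>.\<close>
    moreover have "\<sigma> (restrict (\<lambda>i. \<tau> i \<omega>) J) = \<sigma> (\<lambda>i. \<tau> i \<omega>)" for \<omega>
    proof -
      have "al (restrict (\<lambda>i. \<tau> i \<omega>) J) = al (\<lambda>i. \<tau> i \<omega>)" by (auto simp: al_def fun_eq_iff)
      then show ?thesis by (simp add: \<sigma>_def)
    qed
    ultimately have iv: "indep_var borel (\<tau> e) borel (\<lambda>\<omega>. \<sigma> (\<lambda>i. \<tau> i \<omega>))"
      by (simp add: comp_def)
    have key: "(\<exists>s. first_time (\<lambda>s. F (insert e (al y s))) s \<and> s < c \<and> c \<le> s + \<delta>) \<longleftrightarrow>
        \<sigma> y < c \<and> c \<le> \<sigma> y + \<delta>" for y c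
    proof
      assume "\<exists>s. first_time (\<lambda>s. F (insert e (al y s))) s \<and> s < c \<and> c \<le> s + \<delta>"
      then obtain s where s: "first_time (\<lambda>s. F (insert e (al y s))) s" "s < c \<and> c \<le> s + \<delta>"
        by (elim exE conjE) simp
      show "\<sigma> y < c \<and> c \<le> \<sigma> y + \<delta>"
        using s(2) unfolding first_time_unique[OF s(1) \<sigma>] .
    next
      assume "\<sigma> y < c \<and> c \<le> \<sigma> y + \<delta>"
      then show "\<exists>s. first_time (\<lambda>s. F (insert e (al y s))) s \<and> s < c \<and> c \<le> s + \<delta>"
        using \<sigma>[of y] by (intro exI[of _ "\<sigma> y"]) simp
    qed
    have "Ev = {\<omega> \<in> space M. \<sigma> (\<lambda>i. \<tau> i \<omega>) < \<tau> e \<omega> \<and> \<tau> e \<omega> \<le> \<sigma> (\<lambda>i. \<tau> i \<omega>) + \<delta>}"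
      unfolding Ev_def ins key ..
    then show ?thesis
      using indep_exponential_interval[OF iv dist r \<delta>] by simp
  qed
qed

section \<open>Deleting the edges of a fixed tree\<close>

definition mean_dist :: "'v sgraph \<Rightarrow> real" where
  "mean_dist G = (\<Sum>p\<in>verts G \<times> verts G. real (graph_dist G (fst p) (snd p))) / (real (card (verts G)))\<^sup>2"

text \<open>In a tree, the mean number of edges of \<open>D\<close> on the path between two uniform
  vertices. It is additive in \<open>D\<close>, so its expectation only involves the edges one by
  one.\<close>

definition sep_mass :: "'v sgraph \<Rightarrow> 'v set set \<Rightarrow> real" where
  "sep_mass G D = (\<Sum>p\<in>verts G \<times> verts G. \<Sum>e\<in>sep_edges G (fst p) (snd p). indicator D e) / (real (card (verts G)))\<^sup>2"

lemma mean_dist_nonneg: "0 \<le> mean_dist G"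
  by (simp add: mean_dist_def sum_nonneg)

lemma sep_mass_nonneg: "0 \<le> sep_mass G D"
  by (simp add: sep_mass_def sum_nonneg)

lemma sep_mass_mono: "D \<subseteq> D' \<Longrightarrow> sep_mass G D \<le> sep_mass G D'"
  unfolding sep_mass_def by (intro divide_right_mono sum_mono) (auto simp: indicator_def)

lemma sep_edges_subset: "sep_edges G v w \<subseteq> edges G"
  by (auto simp: sep_edges_def)

lemma is_tree_sgraph: "is_tree G \<Longrightarrow> is_sgraph G"
  by (simp add: is_tree_def)

lemma is_tree_connected: "is_tree G \<Longrightarrow> v \<in> verts G \<Longrightarrow> w \<in> verts G \<Longrightarrow> (v, w) \<in> (adj G)\<^sup>*"
  by (simp add: is_tree_def is_connected_def)

lemma is_tree_verts: "is_tree G \<Longrightarrow> finite (verts G) \<and> verts G \<noteq> {}"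
  by (simp add: is_tree_def is_connected_def is_sgraph_def)

text \<open>A lost pair has at least one separating edge among the deleted ones; counting all of
  them is a union bound.\<close>

lemma sum_squares_diff_le_sep_mass:
  assumes tree: "is_tree G" and A: "A \<subseteq> edges G" and B: "B \<subseteq> A"
  shows "sum_squares (ranked_masses (verts G, A)) - sum_squares (ranked_masses (verts G, B)) \<le> sep_mass G (A - B)"
proof -
  let ?V = "verts G"
  have G: "is_sgraph (?V, A)"
    using is_sgraph_subset[of ?V "edges G" A] is_tree_sgraph[OF tree] A by simp
  have fin: "finite ?V" using is_tree_verts[OF tree] by simp
  have sub: "lost_pairs ?V A B \<subseteq> ?V \<times> ?V" by (auto simp: lost_pairs_def conn_pairs_def)
  have "real (card (lost_pairs ?V A B)) = (\<Sum>p\<in>lost_pairs ?V A B. 1)" by simp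
  also have "\<dots> \<le> (\<Sum>p\<in>lost_pairs ?V A B. \<Sum>e\<in>sep_edges G (fst p) (snd p). indicator (A - B) e)"
  proof (rule sum_mono)
    fix p assume p: "p \<in> lost_pairs ?V A B"
    obtain e where e: "e \<in> A - B" "e \<in> sep_edges G (fst p) (snd p)"
      using sep_edge_ex[OF tree A B, of "fst p" "snd p"] p by (auto simp: lost_pairs_def conn_pairs_def)
    have "finite (sep_edges G (fst p) (snd p))"
      using sep_edges_subset is_sgraph_finite_edges[OF is_tree_sgraph[OF tree]] by (rule finite_subset)
    then have "indicator (A - B) e \<le> (\<Sum>e\<in>sep_edges G (fst p) (snd p). indicator (A - B) e :: real)"
      by (intro member_le_sum e) auto
    then show "1 \<le> (\<Sum>e\<in>sep_edges G (fst p) (snd p). indicator (A - B) e :: real)"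
      using e(1) by simp
  qed
  also have "\<dots> \<le> (\<Sum>p\<in>?V \<times> ?V. \<Sum>e\<in>sep_edges G (fst p) (snd p). indicator (A - B) e)"
    using sub fin by (intro sum_mono2) (auto intro: sum_nonneg)
  finally have "real (card (lost_pairs ?V A B)) \<le> \<dots>" .
  then show ?thesis
    unfolding sum_squares_diff[OF G B] sep_mass_def by (simp add: divide_right_mono)
qed

text \<open>Linearity leaves \<open>c\<close> times the mean number of separating edges. The events
  are kept general because they are used twice: deletion by time \<open>t\<close> with
  \<open>c = r * t\<close>, and deletion within \<delta> after a passage with
  \<open>c = r * \<delta>\<close>.\<close>

lemma (in prob_space) expectation_sep_mass:
  assumes tree: "is_tree G" and D: "\<And>e. e \<in> edges G \<Longrightarrow> Ev e \<in> events" "\<And>e. e \<in> edges G \<Longrightarrow> prob (Ev e) \<le> c"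
    and c: "0 \<le> c"
  shows "integrable M (\<lambda>\<omega>. sep_mass G {e \<in> edges G. \<omega> \<in> Ev e})"
    and "expectation (\<lambda>\<omega>. sep_mass G {e \<in> edges G. \<omega> \<in> Ev e}) \<le> c * mean_dist G"
proof -
  let ?V = "verts G"
  let ?n = "(real (card ?V))\<^sup>2"
  have eq: "sep_mass G {e \<in> edges G. \<omega> \<in> Ev e}
      = (\<Sum>p\<in>?V \<times> ?V. \<Sum>e\<in>sep_edges G (fst p) (snd p). indicator (Ev e) \<omega>) / ?n" for \<omega>
    unfolding sep_mass_def
    by (intro arg_cong2[where f = "(/)"] sum.cong refl) (use sep_edges_subset in \<open>fastforce simp: indicator_def\<close>)
  have int1: "integrable M (indicator (Ev e) :: _ \<Rightarrow> real)" if "e \<in> sep_edges G v w" for e v w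
    using D(1)[of e] that sep_edges_subset[of G v w] by (intro integrable_real_indicator) (auto simp: emeasure_eq_measure)
  show "integrable M (\<lambda>\<omega>. sep_mass G {e \<in> edges G. \<omega> \<in> Ev e})"
    unfolding eq by (intro integrable_divide Bochner_Integration.integrable_sum int1)
  have "expectation (\<lambda>\<omega>. sep_mass G {e \<in> edges G. \<omega> \<in> Ev e})
      = (\<Sum>p\<in>?V \<times> ?V. \<Sum>e\<in>sep_edges G (fst p) (snd p). prob (Ev e)) / ?n"
  proof -
    have "expectation (indicator (Ev e)) = prob (Ev e)" if "e \<in> sep_edges G v w" for e v w
      using D(1)[of e] that sep_edges_subset[of G v w] by auto
    then show ?thesis
      unfolding eq using int1 by (simp add: Bochner_Integration.integral_sum Bochner_Integration.integrable_sum)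
  qed
  also have "\<dots> \<le> (\<Sum>p\<in>?V \<times> ?V. c * real (graph_dist G (fst p) (snd p))) / ?n"
  proof (intro divide_right_mono sum_mono)
    fix p assume p: "p \<in> ?V \<times> ?V"
    let ?S = "sep_edges G (fst p) (snd p)"
    have "(\<Sum>e\<in>?S. prob (Ev e)) \<le> (\<Sum>e\<in>?S. c)"
      by (intro sum_mono D(2) subsetD[OF sep_edges_subset[of G "fst p" "snd p"]])
    also have "\<dots> = c * real (card ?S)" by simp
    also have "\<dots> \<le> c * real (graph_dist G (fst p) (snd p))"
      using card_sep_edges_le[OF is_tree_connected[OF tree], of "fst p" "snd p"] p c
      by (intro mult_left_mono) auto
    finally show "(\<Sum>e\<in>?S. prob (Ev e)) \<le> c * real (graph_dist G (fst p) (snd p))" .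
  qed simp
  also have "\<dots> = c * mean_dist G"
    by (simp add: mean_dist_def sum_distrib_left)
  finally show "expectation (\<lambda>\<omega>. sep_mass G {e \<in> edges G. \<omega> \<in> Ev e}) \<le> c * mean_dist G" .
qed

lemma sum_squares_tree:
  assumes "is_tree G"
  shows "sum_squares (ranked_masses G) = 1"
proof -
  have "conn_pairs G = verts G \<times> verts G"
    using is_tree_connected[OF assms] by (auto simp: conn_pairs_def)
  then show ?thesis
    using is_tree_verts[OF assms] sum_squares_ranked_masses[OF is_tree_sgraph[OF assms]]
    by (simp add: card_cartesian_product power2_eq_square)
qed

lemma fragmentation_eq:
  "0 \<le> t \<Longrightarrow> fragmentation G \<tau> t = ranked_masses (verts G, {e \<in> edges G. \<not> \<tau> e \<le> t})"
  by (simp add: fragmentation_def pruned_def)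

text \<open>An intact tree has \<open>sum_squares\<close> equal to 1, and an edge is gone by time
  \<open>t\<close> with probability at most \<open>r * t\<close>. The nonnegative integral is the
  form in which conditional bounds are assembled over the possible trees.\<close>

lemma (in prob_space) nn_integral_sum_squares_bound:
  assumes tree: "is_tree G" and iid: "iid_exponential M r (edges G) \<tau>" and r: "0 < r" and t: "0 \<le> t"
  shows "(\<integral>\<^sup>+\<omega>. ennreal (1 - sum_squares (fragmentation G (\<lambda>e. \<tau> e \<omega>) t)) \<partial>M) \<le> ennreal (t * r * mean_dist G)"
proof -
  define Ev where "Ev e = {\<omega> \<in> space M. \<tau> e \<omega> \<le> t}" for e
  have meas: "Ev e \<in> events" and prob: "prob (Ev e) \<le> r * t" if "e \<in> edges G" for e
  proof -
    have d: "distributed M lborel (\<tau> e) (exponential_density r)"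
      using iid that by (simp add: iid_exponential_def)
    then have [measurable]: "random_variable borel (\<tau> e)"
      using distributed_measurable[OF d] by simp
    show "Ev e \<in> events" unfolding Ev_def by measurable
    have "prob (Ev e) = 1 - exp (- t * r)"
      unfolding Ev_def by (rule exponential_distributedD_le[OF d t r])
    then show "prob (Ev e) \<le> r * t"
      using exp_ge_add_one_self[of "- t * r"] by (simp add: mult.commute)
  qed
  have rt: "0 \<le> r * t" using r t by simp
  have sm: "integrable M (\<lambda>\<omega>. sep_mass G {e \<in> edges G. \<omega> \<in> Ev e})"
      "expectation (\<lambda>\<omega>. sep_mass G {e \<in> edges G. \<omega> \<in> Ev e}) \<le> r * t * mean_dist G"
    using expectation_sep_mass[OF tree, of Ev "r * t"] meas prob rt by auto
  have "(\<integral>\<^sup>+\<omega>. ennreal (1 - sum_squares (fragmentation G (\<lambda>e. \<tau> e \<omega>) t)) \<partial>M)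
      \<le> (\<integral>\<^sup>+\<omega>. ennreal (sep_mass G {e \<in> edges G. \<omega> \<in> Ev e}) \<partial>M)"
  proof (intro nn_integral_mono ennreal_leI)
    fix \<omega> assume \<omega>: "\<omega> \<in> space M"
    let ?A = "{e \<in> edges G. \<not> \<tau> e \<omega> \<le> t}"
    have "1 - sum_squares (fragmentation G (\<lambda>e. \<tau> e \<omega>) t) \<le> sep_mass G (edges G - ?A)"
      using sum_squares_diff_le_sep_mass[OF tree subset_refl, of ?A] sum_squares_tree[OF tree] t
      by (auto simp: fragmentation_eq)
    also have "\<dots> \<le> sep_mass G {e \<in> edges G. \<omega> \<in> Ev e}"
      by (rule sep_mass_mono) (use \<omega> in \<open>auto simp: Ev_def\<close>)
    finally show "1 - sum_squares (fragmentation G (\<lambda>e. \<tau> e \<omega>) t) \<le> sep_mass G {e \<in> edges G. \<omega> \<in> Ev e}" .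
  qed
  also have "\<dots> = ennreal (expectation (\<lambda>\<omega>. sep_mass G {e \<in> edges G. \<omega> \<in> Ev e}))"
    by (rule nn_integral_eq_integral[OF sm(1)]) (rule AE_I2, rule sep_mass_nonneg)
  also have "\<dots> \<le> ennreal (t * r * mean_dist G)"
    using sm(2) by (intro ennreal_leI) (simp add: mult.commute)
  finally show ?thesis .
qed

lemma sum_squares_alive_anti:
  assumes "is_tree G" "B \<subseteq> A" "A \<subseteq> edges G"
  shows "sum_squares (ranked_masses (verts G, B)) \<le> sum_squares (ranked_masses (verts G, A))"
proof -
  have "is_sgraph (verts G, A)"
    using is_sgraph_subset[of "verts G" "edges G" A] is_tree_sgraph[OF assms(1)] assms(3) by simp
  from sum_squares_diff[OF this assms(2)] show ?thesis
    by (metis diff_ge_0_iff_ge divide_nonneg_nonneg of_nat_0_le_iff)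
qed

text \<open>The exceptional set collects, for each of the \<open>K + 1\<close> levels, the event
  that the edges deleted within \<delta> after its passage have \<open>sep_mass\<close> at least
  \<eta>. By the choice of \<open>K\<close> the levels reach down to 0.\<close>

lemma (in prob_space) osc_grid_fragmentation:
  assumes tree: "is_tree G" and iid: "iid_exponential M r (edges G) \<tau>" and r: "0 < r"
    and \<eta>: "0 < \<eta>" and \<delta>: "0 < \<delta>" and K: "1 \<le> real K * \<eta>"
  shows "\<exists>B\<in>events. prob B \<le> (real K + 1) * (r * \<delta> * mean_dist G / \<eta>) \<and>
    (\<forall>\<omega>\<in>space M - B. osc_grid (2 * sqrt (2 * \<eta>)) \<delta> (fragmentation G (\<lambda>e. \<tau> e \<omega>)))"
proof -
  define Q where "Q A = sum_squares (ranked_masses (verts G, A))" for A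
  define al where "al \<omega> s = {e \<in> edges G. \<not> \<tau> e \<omega> \<le> s}" for \<omega> s
  define F where "F k A \<longleftrightarrow> Q A \<le> 1 - real k * \<eta>" for k A
  define Ev where "Ev k e = {\<omega> \<in> space M. \<exists>s. first_time (\<lambda>s. F k (insert e {f \<in> edges G. \<not> \<tau> f \<omega> \<le> s})) s \<and>
      s < \<tau> e \<omega> \<and> \<tau> e \<omega> \<le> s + \<delta>}" for k e
  note finE = is_sgraph_finite_edges[OF is_tree_sgraph[OF tree]]
  have G: "is_sgraph (verts G, A)" if "A \<subseteq> edges G" for A
    using is_sgraph_subset[of "verts G" "edges G" A] is_tree_sgraph[OF tree] that by simp
  have Ev: "Ev k e \<in> events \<and> prob (Ev k e) \<le> r * \<delta>" if "e \<in> edges G" for k e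
    unfolding Ev_def
  proof (rule exponential_after_first_time[OF iid finE that r less_imp_le[OF \<delta>]])
    fix A B assume "B \<subseteq> A" "A \<subseteq> edges G" "F k A"
    then show "F k B"
      using sum_squares_alive_anti[OF tree, of B A] by (simp add: F_def Q_def)
  qed
  define Z where "Z k \<omega> = sep_mass G {e \<in> edges G. \<omega> \<in> Ev k e}" for k \<omega>
  have Z: "integrable M (Z k)" "expectation (Z k) \<le> r * \<delta> * mean_dist G" for k
    unfolding Z_def
    using expectation_sep_mass[OF tree, of "Ev k" "r * \<delta>"] Ev r \<delta> by auto
  define B where "B = (\<Union>k\<in>{..K}. {\<omega> \<in> space M. \<eta> \<le> Z k \<omega>})"
  have Zev: "{\<omega> \<in> space M. \<eta> \<le> Z k \<omega>} \<in> events" for k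
    using borel_measurable_integrable[OF Z(1)[of k]] by measurable
  then have Bev: "B \<in> events" unfolding B_def by auto
  have "prob B \<le> (\<Sum>k\<in>{..K}. prob {\<omega> \<in> space M. \<eta> \<le> Z k \<omega>})"
    unfolding B_def by (rule finite_measure_subadditive_finite) (use Zev in auto)
  also have "\<dots> \<le> (\<Sum>k\<in>{..K}. r * \<delta> * mean_dist G / \<eta>)"
  proof (rule sum_mono)
    fix k
    have "prob {\<omega> \<in> space M. \<eta> \<le> Z k \<omega>} \<le> expectation (Z k) / \<eta>"
      by (rule integral_Markov_inequality_measure[OF Z(1) sets.top _ \<eta>]) (simp add: Z_def sep_mass_nonneg)
    also have "\<dots> \<le> r * \<delta> * mean_dist G / \<eta>"
      using Z(2)[of k] \<eta> by (simp add: divide_right_mono)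
    finally show "prob {\<omega> \<in> space M. \<eta> \<le> Z k \<omega>} \<le> r * \<delta> * mean_dist G / \<eta>" .
  qed
  also have "\<dots> = (real K + 1) * (r * \<delta> * mean_dist G / \<eta>)" by simp
  finally have probB: "prob B \<le> (real K + 1) * (r * \<delta> * mean_dist G / \<eta>)" .
  have "osc_grid (2 * sqrt (2 * \<eta>)) \<delta> (fragmentation G (\<lambda>e. \<tau> e \<omega>))" if \<omega>: "\<omega> \<in> space M - B" for \<omega>
  proof -
    have alE: "al \<omega> s \<subseteq> edges G" for s by (auto simp: al_def)
    have al_anti: "al \<omega> t \<subseteq> al \<omega> s" if "s \<le> t" for s t using that by (auto simp: al_def)
    have "\<exists>t::nat \<Rightarrow> real. t 0 = 0 \<and> (\<forall>i. t i + \<delta> \<le> t (Suc i)) \<and>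
        (\<forall>i. \<forall>s\<in>{t i..<t (Suc i)}. Q (al \<omega> (t i)) - Q (al \<omega> s) \<le> 2 * \<eta>)"
    proof (rule grid_from_levels[where K = K])
      show "Q (al \<omega> t) \<le> Q (al \<omega> s)" if "s \<le> t" for s t
        unfolding Q_def by (rule sum_squares_alive_anti[OF tree al_anti[OF that] alE])
      show "0 \<le> Q (al \<omega> t)" for t
        unfolding Q_def sum_squares_ranked_masses[OF G[OF alE]] by simp
      show "Q (al \<omega> 0) \<le> 1"
        using sum_squares_alive_anti[OF tree alE subset_refl] sum_squares_tree[OF tree] by (simp add: Q_def)
    next
      fix k u assume "0 \<le> (u::real)" "Q (al \<omega> u) \<le> 1 - real k * \<eta>"
      then show "\<exists>s. first_time (\<lambda>s. Q (al \<omega> s) \<le> 1 - real k * \<eta>) s"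
        using first_time_alive_ex[where F = "\<lambda>A. Q A \<le> 1 - real k * \<eta>" and \<tau> = "\<lambda>e. \<tau> e \<omega>" and u = u, OF finE]
        by (simp add: al_def)
    next
      fix k s assume k: "k \<le> K" and s: "first_time (\<lambda>s. Q (al \<omega> s) \<le> 1 - real k * \<eta>) s"
      have s0: "0 \<le> s" using s by (simp add: first_time_def)
      have "Q (al \<omega> s) - Q (al \<omega> (s + \<delta>)) \<le> sep_mass G (al \<omega> s - al \<omega> (s + \<delta>))"
        unfolding Q_def by (rule sum_squares_diff_le_sep_mass[OF tree alE al_anti]) (use \<delta> in simp)
      also have "\<dots> \<le> Z k \<omega>"
        unfolding Z_def
      proof (rule sep_mass_mono, rule subsetI)
        fix e assume e: "e \<in> al \<omega> s - al \<omega> (s + \<delta>)"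
        then have te: "s < \<tau> e \<omega>" "\<tau> e \<omega> \<le> s + \<delta>" "e \<in> edges G" by (auto simp: al_def)
        \<comment> \<open>Up to time \<open>s\<close> the edge \<open>e\<close> is still present, so
          keeping it artificially changes nothing.\<close>
        have ins: "insert e {f \<in> edges G. \<not> \<tau> f \<omega> \<le> u} = al \<omega> u" if "u \<le> s" for u
          using te that by (auto simp: al_def)
        have "first_time (\<lambda>s. F k (insert e {f \<in> edges G. \<not> \<tau> f \<omega> \<le> s})) s"
          using s ins by (simp add: first_time_def F_def)
        then show "e \<in> {e \<in> edges G. \<omega> \<in> Ev k e}"
          using te \<omega> by (auto simp: Ev_def)
      qed
      also have "\<dots> \<le> \<eta>" using \<omega> k by (force simp: B_def)
      finally show "Q (al \<omega> s) - Q (al \<omega> (s + \<delta>)) \<le> \<eta>" .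
    qed (use \<eta> \<delta> K in auto)
    then obtain t :: "nat \<Rightarrow> real" where t: "t 0 = 0" "\<forall>i. t i + \<delta> \<le> t (Suc i)"
        "\<And>i s. s \<in> {t i..<t (Suc i)} \<Longrightarrow> Q (al \<omega> (t i)) - Q (al \<omega> s) \<le> 2 * \<eta>"
      by blast
    have tnn: "0 \<le> t i" for i
      using grid_ge[of t \<delta> 0 i] t(1,2) \<delta> by (smt (verit) add_0 mult_nonneg_nonneg of_nat_0_le_iff)
    have "dist (fragmentation G (\<lambda>e. \<tau> e \<omega>) s) (fragmentation G (\<lambda>e. \<tau> e \<omega>) (t i)) \<le> 2 * sqrt (2 * \<eta>)"
      if s: "s \<in> {t i..<t (Suc i)}" for i s
    proof -
      have "dist (ranked_masses (verts G, al \<omega> (t i))) (ranked_masses (verts G, al \<omega> s))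
          \<le> 2 * sqrt (Q (al \<omega> (t i)) - Q (al \<omega> s))"
        unfolding Q_def
        by (rule dist_ranked_masses_le[OF G[OF alE] al_anti]) (use s is_tree_verts[OF tree] in auto)
      also have "\<dots> \<le> 2 * sqrt (2 * \<eta>)" using t(3)[OF s] by simp
      finally show ?thesis
        using s tnn[of i] by (simp add: fragmentation_eq al_def dist_commute)
    qed
    then show ?thesis
      unfolding osc_grid_def using t(1,2) by blast
  qed
  then show ?thesis using Bev probB by blast
qed

section \<open>Random trees\<close>

lemma (in prob_space) nn_integral_indep_uniform_pair:
  fixes V1 V2 :: "'a \<Rightarrow> 'v::countable"
  assumes V: "indep_uniform_pair M A V1 V2" and A: "finite A" "A \<noteq> {}"
    and V1: "V1 \<in> M \<rightarrow>\<^sub>M count_space UNIV" and V2: "V2 \<in> M \<rightarrow>\<^sub>M count_space UNIV"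
  shows "(\<integral>\<^sup>+\<omega>. ennreal (real (d (V1 \<omega>) (V2 \<omega>))) \<partial>M)
    = ennreal ((\<Sum>p\<in>A \<times> A. real (d (fst p) (snd p))) / (real (card A))\<^sup>2)"
proof -
  let ?C = "count_space UNIV :: 'v measure"
  let ?P = "measure_pmf (pmf_of_set A)"
  have joint: "?P \<Otimes>\<^sub>M ?P = distr M (?C \<Otimes>\<^sub>M ?C) (\<lambda>\<omega>. (V1 \<omega>, V2 \<omega>))"
  proof -
    have "indep_var ?C V1 ?C V2" and d: "distr M ?C V1 = ?P" "distr M ?C V2 = ?P"
      using V by (simp_all add: indep_uniform_pair_def)
    then have "distr M ?C V1 \<Otimes>\<^sub>M distr M ?C V2 = distr M (?C \<Otimes>\<^sub>M ?C) (\<lambda>\<omega>. (V1 \<omega>, V2 \<omega>))"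
      unfolding indep_var_distribution_eq by (elim conjE)
    then show ?thesis by (simp only: d)
  qed
  let ?g = "\<lambda>p. ennreal (real (d (fst p) (snd p)))"
  \<comment> \<open>As the vertex type is countable, every function of the pair of vertices is
    measurable.\<close>
  have prod: "?C \<Otimes>\<^sub>M ?C = count_space UNIV"
    by (simp add: pair_measure_countable)
  have gC: "?g \<in> borel_measurable (?C \<Otimes>\<^sub>M ?C)" unfolding prod by simp
  have gP: "?g \<in> borel_measurable (?P \<Otimes>\<^sub>M ?P)"
  proof -
    have "sets (?P \<Otimes>\<^sub>M ?P) = sets (?C \<Otimes>\<^sub>M ?C)" by (intro sets_pair_measure_cong) simp_all
    then show ?thesis using gC measurable_cong_sets by blast
  qed
  have pm: "(\<lambda>\<omega>. (V1 \<omega>, V2 \<omega>)) \<in> M \<rightarrow>\<^sub>M ?C \<Otimes>\<^sub>M ?C" using V1 V2 by simp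
  have "(\<integral>\<^sup>+\<omega>. ennreal (real (d (V1 \<omega>) (V2 \<omega>))) \<partial>M) = (\<integral>\<^sup>+p. ?g p \<partial>distr M (?C \<Otimes>\<^sub>M ?C) (\<lambda>\<omega>. (V1 \<omega>, V2 \<omega>)))"
    by (subst nn_integral_distr[OF pm]) (use gC in simp_all)
  also have "\<dots> = (\<integral>\<^sup>+v. \<integral>\<^sup>+w. ?g (v, w) \<partial>?P \<partial>?P)"
    unfolding joint[symmetric] by (rule measure_pmf.nn_integral_fst[OF gP, symmetric])
  also have "\<dots> = (\<Sum>v\<in>A. (\<Sum>w\<in>A. ?g (v, w)) / card A) / card A"
    using A by (simp add: nn_integral_pmf_of_set)
  also have "\<dots> = ennreal ((\<Sum>v\<in>A. (\<Sum>w\<in>A. real (d v w)) / card A) / card A)"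
  proof -
    have c: "0 < real (card A)" using A by (simp add: card_gt_0_iff)
    have div: "ennreal x / of_nat (card A) = ennreal (x / real (card A))" if "0 \<le> x" for x
      by (simp only: ennreal_of_nat_eq_real_of_nat divide_ennreal[OF that c])
    have "(\<Sum>w\<in>A. ?g (v, w)) = ennreal (\<Sum>w\<in>A. real (d v w))" for v
      by (simp only: fst_conv snd_conv) (rule sum_ennreal, simp)
    then have inner: "(\<Sum>w\<in>A. ?g (v, w)) / of_nat (card A) = ennreal ((\<Sum>w\<in>A. real (d v w)) / real (card A))" for v
      by (simp only: div[OF sum_nonneg[OF of_nat_0_le_iff]])
    have "(\<Sum>v\<in>A. ennreal ((\<Sum>w\<in>A. real (d v w)) / real (card A)))
        = ennreal (\<Sum>v\<in>A. (\<Sum>w\<in>A. real (d v w)) / real (card A))"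
      by (rule sum_ennreal) (simp add: sum_nonneg)
    then show ?thesis
      unfolding inner by (simp add: div sum_nonneg)
  qed
  also have "(\<Sum>v\<in>A. (\<Sum>w\<in>A. real (d v w)) / card A) / card A
      = (\<Sum>p\<in>A \<times> A. real (d (fst p) (snd p))) / (real (card A))\<^sup>2"
    by (simp add: sum.cartesian_product' sum_divide_distrib power2_eq_square)
  finally show ?thesis .
qed

lemma (in prob_space) given_properties:
  assumes T: "{\<omega> \<in> space M. T \<omega> = G} \<in> events" and pos: "0 < prob {\<omega> \<in> space M. T \<omega> = G}"
  shows "prob_space (given M T G)" "sets (given M T G) = sets M" "space (given M T G) = space M"
    "AE \<omega> in given M T G. T \<omega> = G"
proof -
  let ?S = "{\<omega> \<in> space M. T \<omega> = G}"
  have nz: "emeasure M ?S \<noteq> 0" "emeasure M ?S \<noteq> \<infinity>"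
    using pos by (auto simp: emeasure_eq_measure)
  show "prob_space (given M T G)" unfolding given_def by (rule prob_space_uniform_measure[OF nz])
  show "sets (given M T G) = sets M" "space (given M T G) = space M"
    by (simp_all add: given_def)
  show "AE \<omega> in given M T G. T \<omega> = G"
    unfolding given_def by (rule AE_uniform_measureI[OF T]) auto
qed

text \<open>Total expectation over countably many trees; those of probability 0 contribute nothing
  to either side. Nonnegative integrals allow the comparison before integrability is known.\<close>

lemma (in prob_space) nn_integral_given_mono:
  assumes C: "countable C" and T: "T \<in> M \<rightarrow>\<^sub>M count_space C"
    and f: "f \<in> borel_measurable M" and g: "g \<in> borel_measurable M"
    and le: "\<And>G. G \<in> C \<Longrightarrow> 0 < prob {\<omega> \<in> space M. T \<omega> = G} \<Longrightarrow>
      (\<integral>\<^sup>+\<omega>. f \<omega> \<partial>given M T G) \<le> (\<integral>\<^sup>+\<omega>. g \<omega> \<partial>given M T G)"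
  shows "(\<integral>\<^sup>+\<omega>. f \<omega> \<partial>M) \<le> (\<integral>\<^sup>+\<omega>. g \<omega> \<partial>M)"
proof -
  let ?S = "\<lambda>G. {\<omega> \<in> space M. T \<omega> = G}"
  have S: "?S G \<in> events" if "G \<in> C" for G
  proof -
    have "T -` {G} \<inter> space M \<in> events" by (rule measurable_sets[OF T]) (use that in simp)
    moreover have "T -` {G} \<inter> space M = ?S G" by auto
    ultimately show ?thesis by simp
  qed
  have split: "(\<integral>\<^sup>+\<omega>. h \<omega> \<partial>M) = (\<integral>\<^sup>+G. \<integral>\<^sup>+\<omega>. h \<omega> * indicator (?S G) \<omega> \<partial>M \<partial>count_space C)"
    if h: "h \<in> borel_measurable M" for h :: "'a \<Rightarrow> ennreal"
  proof -
    have "(\<integral>\<^sup>+\<omega>. h \<omega> \<partial>M) = (\<integral>\<^sup>+\<omega>. \<integral>\<^sup>+G. h \<omega> * indicator (?S G) \<omega> \<partial>count_space C \<partial>M)"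
    proof (rule nn_integral_cong)
      fix \<omega> assume \<omega>: "\<omega> \<in> space M"
      have TC: "T \<omega> \<in> C" using measurable_space[OF T \<omega>] by simp
      have "(\<integral>\<^sup>+G. h \<omega> * indicator (?S G) \<omega> \<partial>count_space C)
          = (\<integral>\<^sup>+G. h \<omega> * indicator {T \<omega>} G \<partial>count_space C)"
        by (intro nn_integral_cong) (use \<omega> in \<open>auto simp: indicator_def\<close>)
      also have "\<dots> = h \<omega>" using TC by (simp add: nn_integral_cmult_indicator)
      finally show "h \<omega> = (\<integral>\<^sup>+G. h \<omega> * indicator (?S G) \<omega> \<partial>count_space C)" by simp
    qed
    also have "\<dots> = (\<integral>\<^sup>+G. \<integral>\<^sup>+\<omega>. h \<omega> * indicator (?S G) \<omega> \<partial>M \<partial>count_space C)"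
      by (rule nn_integral_count_space_nn_integral[OF C]) (use h S in measurable)
    finally show ?thesis .
  qed
  have "(\<integral>\<^sup>+\<omega>. f \<omega> * indicator (?S G) \<omega> \<partial>M) \<le> (\<integral>\<^sup>+\<omega>. g \<omega> * indicator (?S G) \<omega> \<partial>M)" if G: "G \<in> C" for G
  proof (cases "prob (?S G) = 0")
    case True
    then have "?S G \<in> null_sets M" using S[OF G] by (simp add: null_sets_def emeasure_eq_measure)
    then have "AE \<omega> in M. \<omega> \<notin> ?S G" by (rule AE_not_in)
    then have "(\<integral>\<^sup>+\<omega>. f \<omega> * indicator (?S G) \<omega> \<partial>M) = (\<integral>\<^sup>+\<omega>. 0 \<partial>M)"
      by (intro nn_integral_cong_AE) (auto elim!: eventually_mono simp: indicator_def)
    then show ?thesis by simp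
  next
    case False
    then have pos: "0 < prob (?S G)" by (simp add: zero_less_measure_iff)
    have nz: "emeasure M (?S G) \<noteq> 0" "emeasure M (?S G) \<noteq> \<infinity>" "emeasure M (?S G) < top"
      using pos by (auto simp: emeasure_eq_measure)
    have eq: "(\<integral>\<^sup>+\<omega>. h \<omega> * indicator (?S G) \<omega> \<partial>M) = (\<integral>\<^sup>+\<omega>. h \<omega> \<partial>given M T G) * emeasure M (?S G)"
      if h: "h \<in> borel_measurable M" for h
      unfolding given_def nn_integral_uniform_measure[OF h S[OF G]]
      by (simp only: ennreal_divide_times ennreal_divide_self[OF nz(1,3)] mult_1_right)
    show ?thesis
      unfolding eq[OF f] eq[OF g] by (intro mult_right_mono le G pos) simp
  qed
  then show ?thesis
    unfolding split[OF f] split[OF g] by (rule nn_integral_mono) simp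
qed

lemma countable_trees: "countable {G :: 'v::countable sgraph. is_tree G \<and> card (verts G) = n}"
proof (rule countable_subset)
  show "{G :: 'v sgraph. is_tree G \<and> card (verts G) = n} \<subseteq> {V. finite V} \<times> {E. finite E \<and> E \<subseteq> {e. finite e}}"
    using is_sgraph_finite_edges is_sgraph_edges_subset is_tree_verts is_tree_sgraph
    by (fastforce dest: finite_subset)
  have "countable {e :: 'v set. finite e}" by (rule countable_Collect_finite)
  then show "countable ({V :: 'v set. finite V} \<times> {E :: 'v set set. finite E \<and> E \<subseteq> {e. finite e}})"
    by (intro countable_SIGMA countable_Collect_finite_subset)
qed

section \<open>The random tree with a fixed number of vertices\<close>

locale deleted_tree = prob_space M for M :: "'w measure" +
  fixes n :: nat and T :: "'w \<Rightarrow> 'v::countable sgraph" and r :: real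
    and \<tau> :: "'v set \<Rightarrow> 'w \<Rightarrow> real" and V1 V2 :: "'w \<Rightarrow> 'v"
  assumes random_tree: "random_tree M n T"
    and rate: "0 < r"
    and \<tau>_measurable: "\<And>e. \<tau> e \<in> borel_measurable M"
    and V_measurable: "V1 \<in> M \<rightarrow>\<^sub>M count_space UNIV" "V2 \<in> M \<rightarrow>\<^sub>M count_space UNIV"
    and iid: "\<And>G. 0 < prob {\<omega> \<in> space M. T \<omega> = G} \<Longrightarrow> iid_exponential (given M T G) r (edges G) \<tau>"
    and uniform_pair: "\<And>G. 0 < prob {\<omega> \<in> space M. T \<omega> = G} \<Longrightarrow> indep_uniform_pair (given M T G) (verts G) V1 V2"
begin

abbreviation trees :: "'v sgraph set" where
  "trees \<equiv> {G. is_tree G \<and> card (verts G) = n}"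

lemma T_measurable: "T \<in> M \<rightarrow>\<^sub>M count_space trees"
  using random_tree by (simp add: random_tree_def)

lemma T_tree: "\<omega> \<in> space M \<Longrightarrow> is_tree (T \<omega>) \<and> card (verts (T \<omega>)) = n"
  using measurable_space[OF T_measurable] by simp

lemma T_event: "{\<omega> \<in> space M. T \<omega> = G} \<in> events" if "G \<in> trees"
proof -
  have "T -` {G} \<inter> space M \<in> events" by (rule measurable_sets[OF T_measurable]) (use that in simp)
  moreover have "T -` {G} \<inter> space M = {\<omega> \<in> space M. T \<omega> = G}" by auto
  ultimately show ?thesis by simp
qed

text \<open>As the tree has countably many values, measurability may be checked with the tree held
  fixed.\<close>

lemma measurable_over_trees:
  assumes "\<And>G. G \<in> trees \<Longrightarrow> (\<lambda>\<omega>. f G \<omega>) \<in> M \<rightarrow>\<^sub>M N"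
  shows "(\<lambda>\<omega>. f (T \<omega>) \<omega>) \<in> M \<rightarrow>\<^sub>M N"
  using assms T_measurable countable_trees by (rule measurable_compose_countable')

lemma measurable_T_fun:
  assumes "\<And>G. f G \<in> space N"
  shows "(\<lambda>\<omega>. f (T \<omega>)) \<in> M \<rightarrow>\<^sub>M N"
  by (rule measurable_over_trees, rule measurable_const, rule assms)

abbreviation path :: "'w \<Rightarrow> real \<Rightarrow> nat \<Rightarrow> real" where
  "path \<omega> \<equiv> fragmentation (T \<omega>) (\<lambda>e. \<tau> e \<omega>)"

lemma path_measurable: "path \<in> M \<rightarrow>\<^sub>M borel_of (J1_topology mass_sequences)"
  by (rule measurable_over_trees)
    (auto intro!: fragmentation_measurable_fixed \<tau>_measurable dest: is_tree_sgraph)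

lemma sum_squares_path_measurable:
  assumes t: "0 \<le> t"
  shows "(\<lambda>\<omega>. sum_squares (path \<omega> t)) \<in> borel_measurable M"
proof (rule measurable_over_trees)
  fix G assume "G \<in> trees"
  then have "finite (edges G)" using is_tree_sgraph is_sgraph_finite_edges by blast
  then have "(\<lambda>\<omega>. sum_squares (ranked_masses (verts G, {e \<in> edges G. \<not> \<tau> e \<omega> \<le> t}))) \<in> M \<rightarrow>\<^sub>M count_space UNIV"
    using \<tau>_measurable by (intro measurable_alive_fun[where g = "\<lambda>A. sum_squares (ranked_masses (verts G, A))"])
  then show "(\<lambda>\<omega>. sum_squares (fragmentation G (\<lambda>e. \<tau> e \<omega>) t)) \<in> borel_measurable M"
    unfolding fragmentation_eq[OF t] by (rule measurable_compose) simp
qed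

lemma sum_squares_path_bounds:
  assumes "\<omega> \<in> space M" "0 \<le> t"
  shows "0 \<le> sum_squares (path \<omega> t)" "sum_squares (path \<omega> t) \<le> 1"
proof -
  let ?A = "{e \<in> edges (T \<omega>). \<not> \<tau> e \<omega> \<le> t}"
  have tree: "is_tree (T \<omega>)" using T_tree[OF assms(1)] by simp
  have G: "is_sgraph (verts (T \<omega>), ?A)"
    using is_sgraph_subset[of "verts (T \<omega>)" "edges (T \<omega>)" ?A] is_tree_sgraph[OF tree] by simp
  show "0 \<le> sum_squares (path \<omega> t)"
    unfolding fragmentation_eq[OF assms(2)] sum_squares_ranked_masses[OF G] by simp
  show "sum_squares (path \<omega> t) \<le> 1"
    using sum_squares_alive_anti[OF tree _ subset_refl, of ?A] sum_squares_tree[OF tree]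
    by (simp add: fragmentation_eq[OF assms(2)])
qed

lemma dist_measurable: "(\<lambda>\<omega>. real (graph_dist (T \<omega>) (V1 \<omega>) (V2 \<omega>))) \<in> borel_measurable M"
proof (rule measurable_over_trees)
  fix G
  have "(\<lambda>\<omega>. real (graph_dist G v (V2 \<omega>))) \<in> borel_measurable M" for v
    by (rule measurable_compose[OF V_measurable(2)]) simp
  then show "(\<lambda>\<omega>. real (graph_dist G (V1 \<omega>) (V2 \<omega>))) \<in> borel_measurable M"
    by (rule measurable_compose_countable) (rule V_measurable(1))
qed

lemma mean_dist_measurable: "(\<lambda>\<omega>. mean_dist (T \<omega>)) \<in> borel_measurable M"
  by (rule measurable_T_fun) simp

lemma nn_integral_given_dist:
  assumes "G \<in> trees" "0 < prob {\<omega> \<in> space M. T \<omega> = G}"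
  shows "(\<integral>\<^sup>+\<omega>. ennreal (real (graph_dist (T \<omega>) (V1 \<omega>) (V2 \<omega>))) \<partial>given M T G) = ennreal (mean_dist G)"
    and "(\<integral>\<^sup>+\<omega>. ennreal (mean_dist (T \<omega>)) \<partial>given M T G) = ennreal (mean_dist G)"
proof -
  note g = given_properties[OF T_event[OF assms(1)] assms(2)]
  interpret P: prob_space "given M T G" by (rule g(1))
  have "(\<integral>\<^sup>+\<omega>. ennreal (real (graph_dist (T \<omega>) (V1 \<omega>) (V2 \<omega>))) \<partial>given M T G)
      = (\<integral>\<^sup>+\<omega>. ennreal (real (graph_dist G (V1 \<omega>) (V2 \<omega>))) \<partial>given M T G)"
    by (rule nn_integral_cong_AE) (use g(4) in \<open>auto elim: eventually_mono\<close>)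
  also have "\<dots> = ennreal (mean_dist G)"
    unfolding mean_dist_def
  proof (rule P.nn_integral_indep_uniform_pair[OF uniform_pair[OF assms(2)]])
    show "finite (verts G)" "verts G \<noteq> {}" using is_tree_verts[of G] assms(1) by simp_all
    show "V1 \<in> given M T G \<rightarrow>\<^sub>M count_space UNIV" "V2 \<in> given M T G \<rightarrow>\<^sub>M count_space UNIV"
      unfolding measurable_cong_sets[OF g(2) refl] by (rule V_measurable)+
  qed
  finally show "(\<integral>\<^sup>+\<omega>. ennreal (real (graph_dist (T \<omega>) (V1 \<omega>) (V2 \<omega>))) \<partial>given M T G) = ennreal (mean_dist G)" .
  have "(\<integral>\<^sup>+\<omega>. ennreal (mean_dist (T \<omega>)) \<partial>given M T G) = (\<integral>\<^sup>+\<omega>. ennreal (mean_dist G) \<partial>given M T G)"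
    by (rule nn_integral_cong_AE) (use g(4) in \<open>auto elim: eventually_mono\<close>)
  then show "(\<integral>\<^sup>+\<omega>. ennreal (mean_dist (T \<omega>)) \<partial>given M T G) = ennreal (mean_dist G)"
    by (simp add: P.emeasure_space_1)
qed

text \<open>Both integrals agree conditionally on every tree of positive probability, so the
  comparison applies in both directions.\<close>

lemma nn_integral_dist_eq:
  "(\<integral>\<^sup>+\<omega>. ennreal (real (graph_dist (T \<omega>) (V1 \<omega>) (V2 \<omega>))) \<partial>M) = (\<integral>\<^sup>+\<omega>. ennreal (mean_dist (T \<omega>)) \<partial>M)"
proof (rule antisym)
  have m: "(\<lambda>\<omega>. ennreal (real (graph_dist (T \<omega>) (V1 \<omega>) (V2 \<omega>)))) \<in> borel_measurable M"
      "(\<lambda>\<omega>. ennreal (mean_dist (T \<omega>))) \<in> borel_measurable M"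
    using dist_measurable mean_dist_measurable by measurable
  show "(\<integral>\<^sup>+\<omega>. ennreal (real (graph_dist (T \<omega>) (V1 \<omega>) (V2 \<omega>))) \<partial>M) \<le> (\<integral>\<^sup>+\<omega>. ennreal (mean_dist (T \<omega>)) \<partial>M)"
    by (rule nn_integral_given_mono[OF countable_trees T_measurable m]) (simp only: nn_integral_given_dist order_refl)
  show "(\<integral>\<^sup>+\<omega>. ennreal (mean_dist (T \<omega>)) \<partial>M) \<le> (\<integral>\<^sup>+\<omega>. ennreal (real (graph_dist (T \<omega>) (V1 \<omega>) (V2 \<omega>))) \<partial>M)"
    by (rule nn_integral_given_mono[OF countable_trees T_measurable m(2,1)]) (simp only: nn_integral_given_dist order_refl)
qed

lemma mean_dist_le:
  assumes "G \<in> trees"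
  shows "mean_dist G \<le> (real n)\<^sup>2"
proof -
  have tree: "is_tree G" and n: "card (verts G) = n" using assms by auto
  have n0: "0 < n" using is_tree_verts[OF tree] n by (auto simp: card_gt_0_iff)
  have "(\<Sum>p\<in>verts G \<times> verts G. real (graph_dist G (fst p) (snd p))) \<le> (\<Sum>p\<in>verts G \<times> verts G. (real n)\<^sup>2)"
  proof (rule sum_mono)
    fix p assume "p \<in> verts G \<times> verts G"
    then have "graph_dist G (fst p) (snd p) \<le> n\<^sup>2"
      using graph_dist_le[OF is_tree_sgraph[OF tree] is_tree_connected[OF tree]] n by auto
    then have "real (graph_dist G (fst p) (snd p)) \<le> real (n\<^sup>2)" by (rule of_nat_mono)
    then show "real (graph_dist G (fst p) (snd p)) \<le> (real n)\<^sup>2" by simp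
  qed
  also have "\<dots> = (real n)\<^sup>2 * (real n)\<^sup>2"
    by (simp add: card_cartesian_product n power2_eq_square)
  finally show ?thesis
    using n0 by (simp add: mean_dist_def n divide_le_eq)
qed

text \<open>The bound on the mean distance in terms of \<open>n\<close> gives integrability, so the
  Bochner integral is the true mean and not the default value 0.\<close>

lemma nn_integral_mean_dist:
  "(\<integral>\<^sup>+\<omega>. ennreal (mean_dist (T \<omega>)) \<partial>M) = ennreal (\<integral>\<omega>. real (graph_dist (T \<omega>) (V1 \<omega>) (V2 \<omega>)) \<partial>M)"
proof -
  have "(\<integral>\<^sup>+\<omega>. ennreal (mean_dist (T \<omega>)) \<partial>M) \<le> (\<integral>\<^sup>+\<omega>. ennreal ((real n)\<^sup>2) \<partial>M)"
    using T_tree by (intro nn_integral_mono ennreal_leI mean_dist_le) simp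
  also have "\<dots> < \<infinity>" by (simp add: emeasure_space_1)
  finally have "integrable M (\<lambda>\<omega>. real (graph_dist (T \<omega>) (V1 \<omega>) (V2 \<omega>)))"
    unfolding nn_integral_dist_eq[symmetric] by (intro integrableI_nonneg dist_measurable) auto
  from nn_integral_eq_integral[OF this] show ?thesis
    unfolding nn_integral_dist_eq by simp
qed

theorem sum_squares_bound:
  assumes t: "0 \<le> t"
  shows "1 - (\<integral>\<omega>. sum_squares (path \<omega> t) \<partial>M)
    \<le> t * r * (\<integral>\<omega>. real (graph_dist (T \<omega>) (V1 \<omega>) (V2 \<omega>)) \<partial>M)"
proof -
  have intQ: "integrable M (\<lambda>\<omega>. sum_squares (path \<omega> t))"
    by (rule integrable_const_bound[where B = 1])
      (use sum_squares_path_bounds t sum_squares_path_measurable in auto)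
  have m1: "(\<lambda>\<omega>. ennreal (1 - sum_squares (path \<omega> t))) \<in> borel_measurable M"
    using sum_squares_path_measurable[OF t] by measurable
  have m2: "(\<lambda>\<omega>. ennreal (t * r * mean_dist (T \<omega>))) \<in> borel_measurable M"
    using mean_dist_measurable by measurable
  have "ennreal (\<integral>\<omega>. 1 - sum_squares (path \<omega> t) \<partial>M) = (\<integral>\<^sup>+\<omega>. ennreal (1 - sum_squares (path \<omega> t)) \<partial>M)"
    using intQ sum_squares_path_bounds t by (intro nn_integral_eq_integral[symmetric]) auto
  also have "\<dots> \<le> (\<integral>\<^sup>+\<omega>. ennreal (t * r * mean_dist (T \<omega>)) \<partial>M)"
  proof (rule nn_integral_given_mono[OF countable_trees T_measurable m1 m2])
    fix G assume G: "G \<in> trees" "0 < prob {\<omega> \<in> space M. T \<omega> = G}"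
    note g = given_properties[OF T_event[OF G(1)] G(2)]
    interpret P: prob_space "given M T G" by (rule g(1))
    have "(\<integral>\<^sup>+\<omega>. ennreal (1 - sum_squares (path \<omega> t)) \<partial>given M T G)
        = (\<integral>\<^sup>+\<omega>. ennreal (1 - sum_squares (fragmentation G (\<lambda>e. \<tau> e \<omega>) t)) \<partial>given M T G)"
      by (rule nn_integral_cong_AE) (use g(4) in \<open>auto elim: eventually_mono\<close>)
    also have "\<dots> \<le> ennreal (t * r * mean_dist G)"
      by (rule P.nn_integral_sum_squares_bound[OF _ iid[OF G(2)] rate t]) (use G in simp)
    also have "\<dots> = (\<integral>\<^sup>+\<omega>. ennreal (t * r * mean_dist G) \<partial>given M T G)"
      by (simp add: P.emeasure_space_1)
    also have "\<dots> = (\<integral>\<^sup>+\<omega>. ennreal (t * r * mean_dist (T \<omega>)) \<partial>given M T G)"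
      by (rule nn_integral_cong_AE) (use g(4) in \<open>auto elim: eventually_mono\<close>)
    finally show "(\<integral>\<^sup>+\<omega>. ennreal (1 - sum_squares (path \<omega> t)) \<partial>given M T G)
        \<le> (\<integral>\<^sup>+\<omega>. ennreal (t * r * mean_dist (T \<omega>)) \<partial>given M T G)" .
  qed
  also have "\<dots> = ennreal (t * r) * (\<integral>\<^sup>+\<omega>. ennreal (mean_dist (T \<omega>)) \<partial>M)"
    using mean_dist_measurable t rate
    by (subst nn_integral_cmult[symmetric]) (auto simp: ennreal_mult' mean_dist_nonneg)
  also have "\<dots> = ennreal (t * r * (\<integral>\<omega>. real (graph_dist (T \<omega>) (V1 \<omega>) (V2 \<omega>)) \<partial>M))"
    unfolding nn_integral_mean_dist using t rate by (simp add: ennreal_mult')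
  finally have "(\<integral>\<omega>. 1 - sum_squares (path \<omega> t) \<partial>M) \<le> t * r * (\<integral>\<omega>. real (graph_dist (T \<omega>) (V1 \<omega>) (V2 \<omega>)) \<partial>M)"
    using t rate by (subst (asm) ennreal_le_iff) (auto intro!: mult_nonneg_nonneg)
  then show ?thesis using intQ by (simp add: prob_space)
qed

text \<open>Markov's inequality discards the trees with \<open>r * mean_dist\<close> at least
  \<open>A\<close>; for the others the exceptional probabilities at the levels \<open>j\<close> sum
  to at most \<epsilon>. The paths with all grids are enclosed in a Borel set \<open>W\<close>,
  which makes leaving it an event.\<close>

lemma prob_path_notin:
  assumes A: "0 < A" and \<epsilon>: "0 < \<epsilon>" and \<eta>: "\<And>j. 0 < \<eta> j" and \<delta>: "\<And>j. 0 < \<delta> j"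
    and K: "\<And>j. 1 \<le> real (K j) * \<eta> j"
    and small: "\<And>j. (real (K j) + 1) * (\<delta> j * A / \<eta> j) \<le> \<epsilon> * (1/2) ^ Suc j"
    and W: "W \<in> sets (borel_of (J1_topology mass_sequences))"
      "{x \<in> cadlag_paths mass_sequences. \<forall>j. osc_grid (2 * sqrt (2 * \<eta> j)) (\<delta> j) x} \<subseteq> W"
  shows "prob {\<omega> \<in> space M. path \<omega> \<notin> W}
    \<le> r * (\<integral>\<omega>. real (graph_dist (T \<omega>) (V1 \<omega>) (V2 \<omega>)) \<partial>M) / A + \<epsilon>"
proof -
  let ?E = "\<integral>\<omega>. real (graph_dist (T \<omega>) (V1 \<omega>) (V2 \<omega>)) \<partial>M"
  let ?out = "{\<omega> \<in> space M. path \<omega> \<notin> W}"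
  let ?far = "{\<omega> \<in> space M. A \<le> r * mean_dist (T \<omega>)}"
  have far: "?far \<in> events" using mean_dist_measurable by measurable
  have out: "?out \<in> events"
  proof -
    have "path -` W \<inter> space M \<in> events" by (rule measurable_sets[OF path_measurable W(1)])
    moreover have "?out = space M - (path -` W \<inter> space M)" by auto
    ultimately show ?thesis by auto
  qed
  have "emeasure M ?far \<le> ennreal (1 / A) * (\<integral>\<^sup>+\<omega>. ennreal (r * mean_dist (T \<omega>)) \<partial>M)"
  proof -
    have "?far = {\<omega> \<in> space M. 1 \<le> ennreal (1 / A) * ennreal (r * mean_dist (T \<omega>))}"
      using A rate by (auto simp: mean_dist_nonneg le_divide_eq simp flip: ennreal_mult' ennreal_1)
    also have "emeasure M \<dots> \<le> ennreal (1 / A) * (\<integral>\<^sup>+\<omega>. ennreal (r * mean_dist (T \<omega>)) * indicator (space M) \<omega> \<partial>M)"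
      by (rule nn_integral_Markov_inequality) (use mean_dist_measurable in measurable)
    also have "(\<integral>\<^sup>+\<omega>. ennreal (r * mean_dist (T \<omega>)) * indicator (space M) \<omega> \<partial>M)
        = (\<integral>\<^sup>+\<omega>. ennreal (r * mean_dist (T \<omega>)) \<partial>M)"
      by (rule nn_integral_cong) simp
    finally show ?thesis .
  qed
  also have "(\<integral>\<^sup>+\<omega>. ennreal (r * mean_dist (T \<omega>)) \<partial>M) = ennreal r * (\<integral>\<^sup>+\<omega>. ennreal (mean_dist (T \<omega>)) \<partial>M)"
    using mean_dist_measurable rate
    by (subst nn_integral_cmult[symmetric]) (auto simp: ennreal_mult' mean_dist_nonneg)
  also have "ennreal (1 / A) * (ennreal r * (\<integral>\<^sup>+\<omega>. ennreal (mean_dist (T \<omega>)) \<partial>M)) = ennreal (r * ?E / A)"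
    unfolding nn_integral_mean_dist using A rate by (simp flip: ennreal_mult')
  finally have P_far: "prob ?far \<le> r * ?E / A"
    using A rate by (simp add: emeasure_eq_measure)
  have "(\<integral>\<^sup>+\<omega>. indicator (?out - ?far) \<omega> \<partial>M) \<le> (\<integral>\<^sup>+\<omega>. ennreal \<epsilon> \<partial>M)"
  proof (rule nn_integral_given_mono[OF countable_trees T_measurable])
    show "indicator (?out - ?far) \<in> borel_measurable M" using out far by measurable
    show "(\<lambda>\<omega>. ennreal \<epsilon>) \<in> borel_measurable M" by simp
    fix G assume G: "G \<in> trees" "0 < prob {\<omega> \<in> space M. T \<omega> = G}"
    note g = given_properties[OF T_event[OF G(1)] G(2)]
    let ?P = "given M T G"
    interpret P: prob_space ?P by (rule g(1))
    have eps: "(\<integral>\<^sup>+\<omega>. ennreal \<epsilon> \<partial>?P) = ennreal \<epsilon>" by (simp add: P.emeasure_space_1)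
    show "(\<integral>\<^sup>+\<omega>. indicator (?out - ?far) \<omega> \<partial>?P) \<le> (\<integral>\<^sup>+\<omega>. ennreal \<epsilon> \<partial>?P)"
    \<comment> \<open>Whether the tree is discarded depends on \<open>G\<close> alone, so each
      conditional integral falls entirely into one case.\<close>
    proof (cases "A \<le> r * mean_dist G")
      case True
      have "(\<integral>\<^sup>+\<omega>. indicator (?out - ?far) \<omega> \<partial>?P) = (\<integral>\<^sup>+\<omega>. 0 \<partial>?P)"
        by (rule nn_integral_cong_AE) (use g(4) True in \<open>auto elim!: eventually_mono simp: indicator_def\<close>)
      then show ?thesis by simp
    next
      case False
      have tree: "is_tree G" using G by simp
      have "\<exists>B\<in>P.events. P.prob B \<le> (real (K j) + 1) * (r * \<delta> j * mean_dist G / \<eta> j) \<and>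
          (\<forall>\<omega>\<in>space ?P - B. osc_grid (2 * sqrt (2 * \<eta> j)) (\<delta> j) (fragmentation G (\<lambda>e. \<tau> e \<omega>)))" for j
        by (rule P.osc_grid_fragmentation[OF tree iid[OF G(2)] rate \<eta> \<delta> K])
      then obtain B where B: "\<And>j. B j \<in> P.events"
          "\<And>j. P.prob (B j) \<le> (real (K j) + 1) * (r * \<delta> j * mean_dist G / \<eta> j)"
          "\<And>j. \<forall>\<omega>\<in>space ?P - B j. osc_grid (2 * sqrt (2 * \<eta> j)) (\<delta> j) (fragmentation G (\<lambda>e. \<tau> e \<omega>))"
        by metis
      have PB: "P.prob (B j) \<le> \<epsilon> * (1/2) ^ Suc j" for j
      proof -
        have "(real (K j) + 1) * (r * \<delta> j * mean_dist G / \<eta> j) = (real (K j) + 1) * (\<delta> j * (r * mean_dist G) / \<eta> j)"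
          by (simp add: mult_ac)
        also have "\<dots> \<le> (real (K j) + 1) * (\<delta> j * A / \<eta> j)"
          using False less_imp_le[OF \<delta>[of j]] less_imp_le[OF \<eta>[of j]]
          by (intro mult_left_mono divide_right_mono) auto
        finally show ?thesis using B(2)[of j] small[of j] by linarith
      qed
      have sums: "(\<lambda>j. \<epsilon> * (1/2) ^ Suc j) sums \<epsilon>"
        using sums_mult[OF power_half_series, of \<epsilon>] by simp
      have "(\<integral>\<^sup>+\<omega>. indicator (?out - ?far) \<omega> \<partial>?P) \<le> (\<integral>\<^sup>+\<omega>. indicator (\<Union>j. B j) \<omega> \<partial>?P)"
      proof (rule nn_integral_mono_AE)
        have "indicator (?out - ?far) \<omega> \<le> (indicator (\<Union>j. B j) \<omega> :: ennreal)" if "T \<omega> = G" for \<omega>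
        proof (cases "\<omega> \<in> ?out - ?far")
          case True
          have "\<omega> \<in> (\<Union>j. B j)"
          proof (rule ccontr)
            assume "\<omega> \<notin> (\<Union>j. B j)"
            then have "\<forall>j. osc_grid (2 * sqrt (2 * \<eta> j)) (\<delta> j) (fragmentation G (\<lambda>e. \<tau> e \<omega>))"
              using B(3) True g(3) by auto
            then have "fragmentation G (\<lambda>e. \<tau> e \<omega>) \<in> W"
              using W(2) fragmentation_in_cadlag_paths[OF is_tree_sgraph[OF tree]] by blast
            then show False using True that by simp
          qed
          then show ?thesis by (simp split: split_indicator)
        qed simp
        then show "AE \<omega> in ?P. indicator (?out - ?far) \<omega> \<le> (indicator (\<Union>j. B j) \<omega> :: ennreal)"
          using g(4) by (auto elim: eventually_mono)
      qed
      also have "\<dots> = emeasure ?P (\<Union>j. B j)"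
        using B(1) by (intro nn_integral_indicator) auto
      also have "\<dots> \<le> (\<Sum>j. emeasure ?P (B j))"
        using B(1) by (intro emeasure_subadditive_countably) auto
      also have "\<dots> \<le> (\<Sum>j. ennreal (\<epsilon> * (1/2) ^ Suc j))"
        by (intro suminf_le) (simp_all add: P.emeasure_eq_measure ennreal_leI PB del: power_Suc)
      also have "\<dots> = ennreal \<epsilon>"
        using sums \<epsilon> by (subst suminf_ennreal2) (auto simp: sums_iff simp del: power_Suc)
      finally show ?thesis unfolding eps .
    qed
  qed
  moreover have "(\<integral>\<^sup>+\<omega>. indicator (?out - ?far) \<omega> \<partial>M) = emeasure M (?out - ?far)"
    by (rule nn_integral_indicator) (use out far in blast)
  moreover have "(\<integral>\<^sup>+\<omega>. ennreal \<epsilon> \<partial>M) = ennreal \<epsilon>" by (simp add: emeasure_space_1)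
  ultimately have "prob (?out - ?far) \<le> \<epsilon>"
    using \<epsilon> by (simp only: emeasure_eq_measure) (simp add: ennreal_le_iff)
  moreover have "prob ?out \<le> prob ?far + prob (?out - ?far)"
  proof -
    have "prob ?out \<le> prob (?far \<union> (?out - ?far))"
      using out far by (intro finite_measure_mono) auto
    also have "\<dots> \<le> prob ?far + prob (?out - ?far)"
      using out far by (intro measure_Un_le) auto
    finally show ?thesis .
  qed
  ultimately show ?thesis using P_far by linarith
qed

end

section \<open>Uniform constants and tightness of the family\<close>

lemma closedin_sets_borel_of: "closedin X K \<Longrightarrow> K \<in> sets (borel_of X)"
proof -
  assume K: "closedin X K"
  have "topspace X - (topspace X - K) \<in> sets (borel_of X)"
  proof (rule sets.Diff)
    have sub: "{U. openin X U} \<subseteq> Pow (topspace X)" using openin_subset by auto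
    show "topspace X \<in> sets (borel_of X)" "topspace X - K \<in> sets (borel_of X)"
      using K sub by (auto simp: borel_of_def sets_measure_of openin_diff)
  qed
  then show ?thesis using closedin_subset[OF K] by (simp add: double_diff)
qed

text \<open>Finitely many initial terms are absorbed into the constant, so that one compact set can
  serve all \<open>n\<close>.\<close>

lemma bounded_from_bigo:
  fixes f :: "nat \<Rightarrow> real"
  assumes "f \<in> O(\<lambda>_. 1)"
  shows "\<exists>C>0. \<forall>n. f n \<le> C"
proof -
  obtain c where c0: "0 < c" "\<forall>\<^sub>F n in sequentially. norm (f n) \<le> c * norm (1 :: real)"
    using assms by (elim landau_o.bigE)
  then obtain N where c: "0 < c" "\<And>n. N \<le> n \<Longrightarrow> \<bar>f n\<bar> \<le> c"
    by (auto simp: eventually_sequentially)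
  define C where "C = Max (insert c (f ` {..<N}))"
  have "c \<le> C" and small: "\<And>n. n < N \<Longrightarrow> f n \<le> C" unfolding C_def by auto
  moreover have "f n \<le> C" for n
    using c(2)[of n] small[of n] \<open>c \<le> C\<close> by (cases "n < N") auto
  ultimately show ?thesis using c(1) by (intro exI[of _ C]) auto
qed

theorem theorem5p3:
  fixes M :: "nat \<Rightarrow> 'w measure"
    and T :: "nat \<Rightarrow> 'w \<Rightarrow> 'v::countable sgraph"
    and r :: "nat \<Rightarrow> real"
    and \<tau> :: "nat \<Rightarrow> 'v set \<Rightarrow> 'w \<Rightarrow> real"
    and V1 V2 :: "nat \<Rightarrow> 'w \<Rightarrow> 'v"
  assumes "\<And>n. n \<ge> 1 \<Longrightarrow> prob_space (M n)"
    and "\<And>n. n \<ge> 1 \<Longrightarrow> random_tree (M n) n (T n)"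
    and "\<And>n. n \<ge> 1 \<Longrightarrow> r n > 0"
    and "\<And>n e. n \<ge> 1 \<Longrightarrow> \<tau> n e \<in> borel_measurable (M n)"
    and "\<And>n. n \<ge> 1 \<Longrightarrow> V1 n \<in> M n \<rightarrow>\<^sub>M count_space UNIV"
    and "\<And>n. n \<ge> 1 \<Longrightarrow> V2 n \<in> M n \<rightarrow>\<^sub>M count_space UNIV"
    and "\<And>n G. n \<ge> 1 \<Longrightarrow> measure (M n) {\<omega> \<in> space (M n). T n \<omega> = G} > 0 \<Longrightarrow>
           iid_exponential (given (M n) (T n) G) (r n) (edges G) (\<tau> n)"
    and "\<And>n G. n \<ge> 1 \<Longrightarrow> measure (M n) {\<omega> \<in> space (M n). T n \<omega> = G} > 0 \<Longrightarrow>
           indep_uniform_pair (given (M n) (T n) G) (verts G) (V1 n) (V2 n)"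
  shows "(\<forall>n\<ge>1. \<forall>t\<ge>0.
            1 - (\<integral>\<omega>. sum_squares (fragmentation (T n \<omega>) (\<lambda>e. \<tau> n e \<omega>) t) \<partial>M n)
              \<le> t * r n * (\<integral>\<omega>. real (graph_dist (T n \<omega>) (V1 n \<omega>) (V2 n \<omega>)) \<partial>M n)) \<and>
         ((\<lambda>n. r n * (\<integral>\<omega>. real (graph_dist (T n \<omega>) (V1 n \<omega>) (V2 n \<omega>)) \<partial>M n)) \<in> O(\<lambda>_. 1)
            \<longrightarrow> tight_family (J1_topology mass_sequences) {1..} M
                  (\<lambda>n \<omega>. fragmentation (T n \<omega>) (\<lambda>e. \<tau> n e \<omega>)))"
proof (intro conjI impI allI)
  have tree: "deleted_tree (M n) n (T n) (r n) (\<tau> n) (V1 n) (V2 n)" if "n \<ge> 1" for n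
    unfolding deleted_tree_def deleted_tree_axioms_def using assms that by blast
  show "1 - (\<integral>\<omega>. sum_squares (fragmentation (T n \<omega>) (\<lambda>e. \<tau> n e \<omega>) t) \<partial>M n)
      \<le> t * r n * (\<integral>\<omega>. real (graph_dist (T n \<omega>) (V1 n \<omega>) (V2 n \<omega>)) \<partial>M n)"
    if "1 \<le> n" "0 \<le> t" for n t
    using deleted_tree.sum_squares_bound[OF tree[OF that(1)] that(2)] .
  let ?X = "J1_topology mass_sequences"
  let ?E = "\<lambda>n. r n * (\<integral>\<omega>. real (graph_dist (T n \<omega>) (V1 n \<omega>) (V2 n \<omega>)) \<partial>M n)"
  assume "?E \<in> O(\<lambda>_. 1)"
  then obtain C where C: "0 < C" "\<And>n. ?E n \<le> C" using bounded_from_bigo by blast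
  show "tight_family ?X {1..} M (\<lambda>n \<omega>. fragmentation (T n \<omega>) (\<lambda>e. \<tau> n e \<omega>))"
    unfolding tight_family_def
  proof (intro conjI ballI allI impI)
    show "(\<lambda>\<omega>. fragmentation (T n \<omega>) (\<lambda>e. \<tau> n e \<omega>)) \<in> M n \<rightarrow>\<^sub>M borel_of ?X" if "n \<in> {1..}" for n
      using deleted_tree.path_measurable[OF tree] that by simp
    fix \<epsilon> :: real assume \<epsilon>: "0 < \<epsilon>"
    \<comment> \<open>Makes the bound \<open>C / A\<close> for the discarded trees equal to
      \<open>\<epsilon> / 2\<close>; the other half goes to the oscillation events.\<close>
    define A where "A = 2 * C / \<epsilon>"
    define \<eta> :: "nat \<Rightarrow> real" where "\<eta> j = ((1/2) ^ j / 8)\<^sup>2 / 2" for j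
    define K where "K j = nat \<lceil>1 / \<eta> j\<rceil>" for j
    \<comment> \<open>Solves \<open>small\<close> with equality. Only \<open>C\<close>, \<epsilon>
      and \<open>j\<close> enter, so the mesh is the same for all \<open>n\<close>.\<close>
    define \<delta> where "\<delta> j = \<epsilon> / 2 * (1/2) ^ Suc j * \<eta> j / (A * (real (K j) + 1))" for j
    have A: "0 < A" using C \<epsilon> by (simp add: A_def)
    have \<eta>: "0 < \<eta> j" for j by (simp add: \<eta>_def)
    have K: "1 \<le> real (K j) * \<eta> j" for j
    proof -
      have "1 / \<eta> j \<le> real (K j)" by (simp add: K_def real_nat_ceiling_ge)
      then show ?thesis by (simp only: pos_divide_le_eq[OF \<eta>])
    qed
    have \<delta>: "0 < \<delta> j" for j using A \<eta>[of j] \<epsilon> by (simp add: \<delta>_def)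
    have small: "(real (K j) + 1) * (\<delta> j * A / \<eta> j) \<le> \<epsilon> / 2 * (1/2) ^ Suc j" for j
    proof -
      have eq: "k * (c * h / (A * k) * A / h) = c" if "k \<noteq> 0" "h \<noteq> 0" for k c h :: real
        using that A by (simp add: field_simps)
      have "real (K j) + 1 \<noteq> 0" "\<eta> j \<noteq> 0"
        using \<eta>[of j] of_nat_0_le_iff[of "K j", where 'a = real] by linarith+
      from eq[OF this] show ?thesis unfolding \<delta>_def by (rule eq_refl)
    qed
    have osc: "2 * sqrt (2 * \<eta> j) = (1/2) ^ j / 4" for j
    proof -
      have "2 * \<eta> j = ((1/2) ^ j / 8)\<^sup>2" by (simp add: \<eta>_def)
      then show ?thesis by (simp only: real_sqrt_abs) simp
    qed
    let ?K0 = "{x \<in> cadlag_paths mass_sequences. \<forall>j. osc_grid ((1/2) ^ j / 4) (\<delta> j) x}"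
    \<comment> \<open>The closure is compact and, being closed, a Borel set.\<close>
    define W where "W = ?X closure_of ?K0"
    have W: "W \<in> sets (borel_of ?X)" unfolding W_def by (rule closedin_sets_borel_of) simp
    have sub: "?K0 \<subseteq> W"
      unfolding W_def by (rule closure_of_subset) (auto simp: topspace_J1_topology)
    show "\<exists>W. compactin ?X W \<and> (\<forall>n\<in>{1..}. 1 - \<epsilon> \<le>
        measure (distr (M n) (borel_of ?X) (\<lambda>\<omega>. fragmentation (T n \<omega>) (\<lambda>e. \<tau> n e \<omega>))) W)"
    proof (intro exI conjI ballI)
      show "compactin ?X W"
        unfolding W_def by (rule osc_grid_compactin[OF compact_mass_sequences \<delta>])
      fix n :: nat assume "n \<in> {1..}"
      then interpret D: deleted_tree "M n" n "T n" "r n" "\<tau> n" "V1 n" "V2 n" by (intro tree) simp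
      have "D.prob {\<omega> \<in> space (M n). D.path \<omega> \<notin> W} \<le> ?E n / A + \<epsilon> / 2"
        by (rule D.prob_path_notin[OF A half_gt_zero[OF \<epsilon>] \<eta> \<delta> K small W]) (unfold osc, rule sub)
      also have "?E n / A \<le> C / A" using C(2) A by (intro divide_right_mono) auto
      also have "C / A = \<epsilon> / 2" using C(1) \<epsilon> by (simp add: A_def)
      finally have bad: "D.prob {\<omega> \<in> space (M n). D.path \<omega> \<notin> W} \<le> \<epsilon>" by simp
      have ev: "D.path -` W \<inter> space (M n) \<in> D.events" by (rule measurable_sets[OF D.path_measurable W])
      have "measure (distr (M n) (borel_of ?X) D.path) W = D.prob (D.path -` W \<inter> space (M n))"
        by (rule measure_distr[OF D.path_measurable W])
      also have "\<dots> = 1 - D.prob (space (M n) - (D.path -` W \<inter> space (M n)))"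
        using D.prob_compl[OF ev] by simp
      also have "space (M n) - (D.path -` W \<inter> space (M n)) = {\<omega> \<in> space (M n). D.path \<omega> \<notin> W}" by auto
      finally show "1 - \<epsilon> \<le> measure (distr (M n) (borel_of ?X) (\<lambda>\<omega>. fragmentation (T n \<omega>) (\<lambda>e. \<tau> n e \<omega>))) W"
        using bad by simp
    qed
  qed
qed

end
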